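(* Let $V$ be a finite-dimensional complex representation of a complex reductive group $G$, let $Y\subset V$ be a closed subvariety and $W$ a finite group acting faithfully on $Y$ by birational automorphisms, and suppose $(Y,W)$ has the Galois restriction property. Let $\pi:V\dashrightarrow Z$ be the rational quotient of $V$ by $G$. Then there is a nonempty Zariski open set $U$ in $V$ all of whose points $p$ satisfy the condition that $G\cdot p$ intersects $Y$. Furthermore, for any $p$ belonging to this open set $U$ and any $y\in(G\cdot p)\cap Y$, there is an analytic neighborhood $U_p$ of $p$ in $V$, an analytic neighborhood $U_y$ of $y$ in $Y$, and a holomorphic map $\rho:U_p\to U_y$ such that $\pi\circ\rho=\pi$. The fibers of $\rho$ are intersections of $G$-orbits with $U_p$.
   Context: Subvarieties are irreducible. $(Y,W)$ has the Galois restriction property if restriction of functions gives a (well-defined) isomorphism $\mathbb{C}(V)^G\to\mathbb{C}(Y)^W$. It is not assumed that $\mathbb{C}(V)^G=\operatorname{Frac}(\mathbb{C}[V]^G)$. The rational quotient, which exists by Rosenlicht's theorem, is a variety $Z$ with function field $\mathbb{C}(V)^G$ together with a dominant rational map $\pi:V\dashrightarrow Z$ inducing the inclusion $\mathbb{C}(V)^G\subset\mathbb{C}(V)$ and whose fibers (on a $G$-stable Zariski open domain of definition) are $G$-orbits in $V$.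
   Formalization: Added hypothesis: Y meets the G-stable open domain on which the fibers of π are G-orbits. Without it the claim fails (C* acting on C² by t(x,y)=(tx,y), Y={x=0}, W=1), and the first conclusion forces it. V is taken of dimension at least 1. *)

theory Defs
  imports "HOL-Analysis.Analysis" "HOL-Algebra.QuotRing"
begin

section \<open>Varieties as spaces with functions\<close>

text \<open>A space with functions is a topological space with a sheaf of complex-valued functions.
  Functions are total in HOL, so membership \<open>f \<in> reg X U\<close> depends only on the values of \<open>f\<close> on \<open>U\<close>.\<close>

record 'a fspace =
  ztop :: "'a topology"
  reg :: "'a set \<Rightarrow> ('a \<Rightarrow> complex) set"

text \<open>\<open>poly_funs C\<close> is the algebra of polynomial functions in the coordinate functions \<open>C\<close>.\<close>

inductive_set poly_funs :: "('a \<Rightarrow> complex) set \<Rightarrow> ('a \<Rightarrow> complex) set"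
  for C :: "('a \<Rightarrow> complex) set" where
  const: "(\<lambda>_. c) \<in> poly_funs C"
| coord: "f \<in> C \<Longrightarrow> f \<in> poly_funs C"
| add: "f \<in> poly_funs C \<Longrightarrow> g \<in> poly_funs C \<Longrightarrow> (\<lambda>x. f x + g x) \<in> poly_funs C"
| mult: "f \<in> poly_funs C \<Longrightarrow> g \<in> poly_funs C \<Longrightarrow> (\<lambda>x. f x * g x) \<in> poly_funs C"

definition zariski :: "('a \<Rightarrow> complex) set \<Rightarrow> 'a topology" where
  "zariski C = topology (\<lambda>U. \<exists>F\<subseteq>poly_funs C. U = - {x. \<forall>f\<in>F. f x = 0})"

lemma istopology_zariski:
  "istopology (\<lambda>U. \<exists>F\<subseteq>poly_funs C. U = - {x. \<forall>f\<in>F. f x = 0})"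
  unfolding istopology_def
proof (intro conjI allI impI)
  fix S T :: "'a set"
  assume "\<exists>F\<subseteq>poly_funs C. S = - {x. \<forall>f\<in>F. f x = 0}"
    and "\<exists>F\<subseteq>poly_funs C. T = - {x. \<forall>f\<in>F. f x = 0}"
  then obtain F H where *: "F \<subseteq> poly_funs C" "S = - {x. \<forall>f\<in>F. f x = 0}"
      "H \<subseteq> poly_funs C" "T = - {x. \<forall>f\<in>H. f x = 0}"
    by blast
  show "\<exists>F\<subseteq>poly_funs C. S \<inter> T = - {x. \<forall>f\<in>F. f x = 0}"
  proof (intro exI conjI)
    show "{(\<lambda>x. f x * h x) | f h. f \<in> F \<and> h \<in> H} \<subseteq> poly_funs C"
      using * by (auto intro: poly_funs.mult)
    show "S \<inter> T = - {x. \<forall>k\<in>{(\<lambda>x. f x * h x) | f h. f \<in> F \<and> h \<in> H}. k x = 0}"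
      unfolding *(2,4) by (auto 4 4)
  qed
next
  fix K :: "'a set set"
  assume K: "\<forall>S\<in>K. \<exists>F\<subseteq>poly_funs C. S = - {x. \<forall>f\<in>F. f x = 0}"
  let ?F = "{f \<in> poly_funs C. \<forall>x. f x \<noteq> 0 \<longrightarrow> x \<in> \<Union> K}"
  have "\<exists>f\<in>?F. f x \<noteq> 0" if "x \<in> \<Union> K" for x
  proof -
    from that obtain S where S: "S \<in> K" "x \<in> S" by blast
    from K S(1) obtain F where F: "F \<subseteq> poly_funs C" "S = - {x. \<forall>f\<in>F. f x = 0}"
      by blast
    from S(2) obtain f where f: "f \<in> F" "f x \<noteq> 0" unfolding F(2) by blast
    have "y \<in> S" if "f y \<noteq> 0" for y
      unfolding F(2) using f(1) that by blast
    then show ?thesis using F(1) f S(1) by blast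
  qed
  then have "\<Union> K = - {x. \<forall>f\<in>?F. f x = 0}" by blast
  then show "\<exists>F\<subseteq>poly_funs C. \<Union> K = - {x. \<forall>f\<in>F. f x = 0}"
    by (intro exI[of _ ?F] conjI) (blast, assumption)
qed

lemma openin_zariski:
  "openin (zariski C) U \<longleftrightarrow> (\<exists>F\<subseteq>poly_funs C. U = - {x. \<forall>f\<in>F. f x = 0})"
  by (simp add: zariski_def istopology_zariski topology_inverse')

lemma topspace_zariski [simp]: "topspace (zariski C) = UNIV"
proof -
  have "openin (zariski C) UNIV"
    unfolding openin_zariski
    by (rule exI[of _ "{\<lambda>_. 1}"]) (auto intro: poly_funs.const)
  then show ?thesis
    using openin_subset by fastforce
qed

lemma closedin_zariski:
  "closedin (zariski C) S \<longleftrightarrow> (\<exists>F\<subseteq>poly_funs C. S = {x. \<forall>f\<in>F. f x = 0})"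
proof -
  have "UNIV - S = - A \<longleftrightarrow> S = A" for A by blast
  then show ?thesis
    unfolding closedin_def openin_zariski topspace_zariski by simp
qed

definition aff_space :: "('a \<Rightarrow> complex) set \<Rightarrow> 'a fspace" where
  "aff_space C = \<lparr>ztop = zariski C,
     reg = (\<lambda>U. {f. \<forall>x\<in>U. \<exists>N p q. openin (zariski C) N \<and> x \<in> N \<and>
       p \<in> poly_funs C \<and> q \<in> poly_funs C \<and> (\<forall>y\<in>N \<inter> U. q y \<noteq> 0 \<and> f y = p y / q y)})\<rparr>"

text \<open>Structure induced on a subset: regular functions are locally restrictions of
  regular functions of the ambient space. Used for open subsets as well as for closed ones.\<close>

definition induced :: "'a fspace \<Rightarrow> 'a set \<Rightarrow> 'a fspace" where
  "induced X S = \<lparr>ztop = subtopology (ztop X) S,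
     reg = (\<lambda>U. {f. \<forall>x\<in>U. \<exists>N h. openin (ztop X) N \<and> x \<in> N \<and> h \<in> reg X N \<and>
       (\<forall>y\<in>N \<inter> U. f y = h y)})\<rparr>"

definition regular_map :: "'a fspace \<Rightarrow> 'b fspace \<Rightarrow> ('a \<Rightarrow> 'b) \<Rightarrow> bool" where
  "regular_map X Y f \<longleftrightarrow> continuous_map (ztop X) (ztop Y) f \<and>
     (\<forall>U h. openin (ztop Y) U \<and> h \<in> reg Y U \<longrightarrow>
        h \<circ> f \<in> reg X {x \<in> topspace (ztop X). f x \<in> U})"

definition isomorphic_fspace :: "'a fspace \<Rightarrow> 'b fspace \<Rightarrow> bool" where
  "isomorphic_fspace X Y \<longleftrightarrow> (\<exists>f g. regular_map X Y f \<and> regular_map Y X g \<and>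
     (\<forall>x\<in>topspace (ztop X). g (f x) = x) \<and> (\<forall>y\<in>topspace (ztop Y). f (g y) = y))"

text \<open>Affine algebraic sets of arbitrary dimension: the affine \<open>k\<close>-space is the set of sequences
  vanishing from index \<open>k\<close> on.\<close>

definition seq_space :: "(nat \<Rightarrow> complex) fspace" where
  "seq_space = aff_space (range (\<lambda>i x. x i))"

definition algebraic_set :: "(nat \<Rightarrow> complex) set \<Rightarrow> bool" where
  "algebraic_set S \<longleftrightarrow> closedin (ztop seq_space) S \<and> (\<exists>k. \<forall>x\<in>S. \<forall>i\<ge>k. x i = 0)"

definition affine_fspace :: "'a fspace \<Rightarrow> bool" where
  "affine_fspace X \<longleftrightarrow> (\<exists>S. algebraic_set S \<and> isomorphic_fspace X (induced seq_space S))"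

definition irreducible_top :: "'a topology \<Rightarrow> bool" where
  "irreducible_top T \<longleftrightarrow> topspace T \<noteq> {} \<and>
     (\<forall>A B. closedin T A \<and> closedin T B \<and> topspace T = A \<union> B \<longrightarrow> topspace T = A \<or> topspace T = B)"

definition function_sheaf :: "'a fspace \<Rightarrow> bool" where
  "function_sheaf X \<longleftrightarrow> (\<forall>U. openin (ztop X) U \<longrightarrow> reg X U = reg (induced X (topspace (ztop X))) U)"

text \<open>Separatedness is stated as closedness of equalizers of regular maps from affine sets.\<close>

definition separated :: "'a fspace \<Rightarrow> bool" where
  "separated X \<longleftrightarrow> (\<forall>S f g. algebraic_set S \<and> regular_map (induced seq_space S) X f \<and>
     regular_map (induced seq_space S) X g \<longrightarrow>
     closedin (ztop (induced seq_space S)) {x \<in> S. f x = g x})"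

definition variety :: "'a fspace \<Rightarrow> bool" where
  "variety X \<longleftrightarrow> irreducible_top (ztop X) \<and> function_sheaf X \<and>
     (\<exists>\<U>. finite \<U> \<and> \<Union>\<U> = topspace (ztop X) \<and>
        (\<forall>U\<in>\<U>. openin (ztop X) U \<and> affine_fspace (induced X U))) \<and>
     separated X"

section \<open>Function fields and rational maps\<close>

text \<open>For irreducible \<open>X\<close>, a rational function is a class of regular functions on nonempty open
  sets, two being identified when they agree on the intersection of their domains.\<close>

definition rat_pairs :: "'a fspace \<Rightarrow> ('a set \<times> ('a \<Rightarrow> complex)) set" where
  "rat_pairs X = {(U, f). openin (ztop X) U \<and> U \<noteq> {} \<and> f \<in> reg X U}"

definition rat_rel :: "'a fspace \<Rightarrow> (('a set \<times> ('a \<Rightarrow> complex)) \<times> ('a set \<times> ('a \<Rightarrow> complex))) set" where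
  "rat_rel X = {((U, f), (U', f')). (U, f) \<in> rat_pairs X \<and> (U', f') \<in> rat_pairs X \<and>
     (\<forall>x\<in>U \<inter> U'. f x = f' x)}"

type_synonym 'a ratfun = "('a set \<times> ('a \<Rightarrow> complex)) set"

definition function_field :: "'a fspace \<Rightarrow> 'a ratfun ring" where
  "function_field X = \<lparr>
     carrier = rat_pairs X // rat_rel X,
     mult = (\<lambda>\<phi> \<psi>. \<Union>(U, f)\<in>\<phi>. \<Union>(U', f')\<in>\<psi>. rat_rel X `` {(U \<inter> U', \<lambda>x. f x * f' x)}),
     one = rat_rel X `` {(topspace (ztop X), \<lambda>_. 1)},
     zero = rat_rel X `` {(topspace (ztop X), \<lambda>_. 0)},
     add = (\<lambda>\<phi> \<psi>. \<Union>(U, f)\<in>\<phi>. \<Union>(U', f')\<in>\<psi>. rat_rel X `` {(U \<inter> U', \<lambda>x. f x + f' x)})\<rparr>"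

text \<open>Pullback of a rational function \<open>\<phi>\<close> along a map \<open>a\<close> defined on the nonempty open subset \<open>A\<close>
  of \<open>X\<close>. It is meaningful iff some representative of \<open>\<phi>\<close> is defined at some point of \<open>a ` A\<close>
  (and is the empty set, hence no element of the function field, otherwise).\<close>

definition pullback_defined :: "'a set \<Rightarrow> ('a \<Rightarrow> 'b) \<Rightarrow> 'b ratfun \<Rightarrow> bool" where
  "pullback_defined A a \<phi> \<longleftrightarrow> (\<exists>(U, f)\<in>\<phi>. \<exists>x\<in>A. a x \<in> U)"

definition pullback :: "'a fspace \<Rightarrow> 'a set \<Rightarrow> ('a \<Rightarrow> 'b) \<Rightarrow> 'b ratfun \<Rightarrow> 'a ratfun" where
  "pullback X A a \<phi> = (\<Union>(U, f)\<in>{(U, f) \<in> \<phi>. \<exists>x\<in>A. a x \<in> U}.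
     rat_rel X `` {({x \<in> A. a x \<in> U}, f \<circ> a)})"

text \<open>A rational map is given by a representative \<open>a\<close> that is regular on a nonempty open \<open>A\<close>.\<close>

definition rational_map :: "'a fspace \<Rightarrow> 'b fspace \<Rightarrow> 'a set \<Rightarrow> ('a \<Rightarrow> 'b) \<Rightarrow> bool" where
  "rational_map X Y A a \<longleftrightarrow> openin (ztop X) A \<and> A \<noteq> {} \<and> regular_map (induced X A) Y a"

definition dominant :: "'b fspace \<Rightarrow> 'a set \<Rightarrow> ('a \<Rightarrow> 'b) \<Rightarrow> bool" where
  "dominant Y A a \<longleftrightarrow> ztop Y closure_of (a ` A) = topspace (ztop Y)"

text \<open>\<open>rational_comp_eq X A a B b C c\<close>: the composite \<open>b \<circ> a\<close> is defined as a rational map on \<open>X\<close>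
  and equals \<open>c\<close>.\<close>

definition rational_comp_eq ::
  "'a fspace \<Rightarrow> 'a set \<Rightarrow> ('a \<Rightarrow> 'b) \<Rightarrow> 'b set \<Rightarrow> ('b \<Rightarrow> 'c) \<Rightarrow> 'a set \<Rightarrow> ('a \<Rightarrow> 'c) \<Rightarrow> bool" where
  "rational_comp_eq X A a B b C c \<longleftrightarrow>
     (\<exists>N. openin (ztop X) N \<and> N \<noteq> {} \<and> N \<subseteq> A \<inter> C \<and> a ` N \<subseteq> B \<and> (\<forall>x\<in>N. b (a x) = c x))"

definition birational_automorphism :: "'a fspace \<Rightarrow> 'a set \<Rightarrow> ('a \<Rightarrow> 'a) \<Rightarrow> bool" where
  "birational_automorphism X A a \<longleftrightarrow> rational_map X X A a \<and>
     (\<exists>B b. rational_map X X B b \<and>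
        rational_comp_eq X A a B b (topspace (ztop X)) id \<and>
        rational_comp_eq X B b A a (topspace (ztop X)) id)"

text \<open>An action of \<open>W\<close> on \<open>X\<close> by birational automorphisms: \<open>w\<close> acts by the rational map represented
  by \<open>\<sigma> w\<close> on the open set \<open>E w\<close>. It is faithful if only \<open>\<one>\<close> acts as the identity.\<close>

definition birational_action ::
  "'w monoid \<Rightarrow> 'a fspace \<Rightarrow> ('w \<Rightarrow> 'a set) \<Rightarrow> ('w \<Rightarrow> 'a \<Rightarrow> 'a) \<Rightarrow> bool" where
  "birational_action W X E \<sigma> \<longleftrightarrow>
     (\<forall>w\<in>carrier W. birational_automorphism X (E w) (\<sigma> w)) \<and>
     (\<forall>x\<in>E \<one>\<^bsub>W\<^esub>. \<sigma> \<one>\<^bsub>W\<^esub> x = x) \<and>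
     (\<forall>w\<in>carrier W. \<forall>w'\<in>carrier W.
        rational_comp_eq X (E w') (\<sigma> w') (E w) (\<sigma> w) (E (w \<otimes>\<^bsub>W\<^esub> w')) (\<sigma> (w \<otimes>\<^bsub>W\<^esub> w')))"

definition faithful_birational_action ::
  "'w monoid \<Rightarrow> 'a fspace \<Rightarrow> ('w \<Rightarrow> 'a set) \<Rightarrow> ('w \<Rightarrow> 'a \<Rightarrow> 'a) \<Rightarrow> bool" where
  "faithful_birational_action W X E \<sigma> \<longleftrightarrow> birational_action W X E \<sigma> \<and>
     (\<forall>w\<in>carrier W. w \<noteq> \<one>\<^bsub>W\<^esub> \<longrightarrow> (\<exists>x\<in>E w. \<sigma> w x \<noteq> x))"

section \<open>Reductive groups and their representations\<close>

definition vec_space :: "(complex ^ 'n) fspace" where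
  "vec_space = aff_space (range (\<lambda>i v. v $ i))"

definition mat_space :: "(complex ^ 'm ^ 'm) fspace" where
  "mat_space = aff_space (range (\<lambda>(i, j) M. M $ i $ j))"

definition GL :: "(complex ^ 'm ^ 'm) set" where
  "GL = {M. invertible M}"

definition linear_algebraic_group :: "(complex ^ 'm ^ 'm) set \<Rightarrow> bool" where
  "linear_algebraic_group G \<longleftrightarrow> closedin (subtopology (ztop mat_space) GL) G \<and>
     mat 1 \<in> G \<and> (\<forall>g\<in>G. \<forall>h\<in>G. g ** h \<in> G) \<and> (\<forall>g\<in>G. matrix_inv g \<in> G)"

definition unipotent_matrix :: "complex ^ 'm ^ 'm \<Rightarrow> bool" where
  "unipotent_matrix g \<longleftrightarrow> (\<exists>k. (((**) (g - mat 1)) ^^ k) (mat 1) = 0)"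

text \<open>Reductive: trivial unipotent radical, i.e. every connected normal unipotent closed subgroup
  is trivial. The group itself need not be connected.\<close>

definition reductive_group :: "(complex ^ 'm ^ 'm) set \<Rightarrow> bool" where
  "reductive_group G \<longleftrightarrow> linear_algebraic_group G \<and>
     (\<forall>N. N \<subseteq> G \<and> linear_algebraic_group N \<and> connected_space (subtopology (ztop mat_space) N) \<and>
        (\<forall>g\<in>G. \<forall>h\<in>N. g ** h ** matrix_inv g \<in> N) \<and> (\<forall>h\<in>N. unipotent_matrix h)
        \<longrightarrow> N = {mat 1})"

definition representation ::
  "(complex ^ 'm ^ 'm) set \<Rightarrow> (complex ^ 'm ^ 'm \<Rightarrow> complex ^ 'n ^ 'n) \<Rightarrow> bool" where
  "representation G R \<longleftrightarrow> regular_map (induced mat_space G) mat_space R \<and>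
     R (mat 1) = mat 1 \<and> (\<forall>g\<in>G. \<forall>h\<in>G. R (g ** h) = R g ** R h)"

definition orbit ::
  "(complex ^ 'm ^ 'm) set \<Rightarrow> (complex ^ 'm ^ 'm \<Rightarrow> complex ^ 'n ^ 'n) \<Rightarrow> complex ^ 'n \<Rightarrow> (complex ^ 'n) set" where
  "orbit G R p = {R g *v p | g. g \<in> G}"

definition closed_subvariety :: "(complex ^ 'n) set \<Rightarrow> bool" where
  "closed_subvariety Y \<longleftrightarrow> closedin (ztop vec_space) Y \<and> irreducible_top (subtopology (ztop vec_space) Y)"

section \<open>Invariant fields, Galois restriction and rational quotients\<close>

definition invariant_field ::
  "(complex ^ 'm ^ 'm) set \<Rightarrow> (complex ^ 'm ^ 'm \<Rightarrow> complex ^ 'n ^ 'n) \<Rightarrow> (complex ^ 'n) ratfun ring" where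
  "invariant_field G R = (function_field vec_space)\<lparr>carrier :=
     {\<phi> \<in> carrier (function_field vec_space). \<forall>g\<in>G. pullback vec_space UNIV (\<lambda>v. R g *v v) \<phi> = \<phi>}\<rparr>"

definition birational_invariant_field ::
  "'w monoid \<Rightarrow> 'a fspace \<Rightarrow> ('w \<Rightarrow> 'a set) \<Rightarrow> ('w \<Rightarrow> 'a \<Rightarrow> 'a) \<Rightarrow> 'a ratfun ring" where
  "birational_invariant_field W X E \<sigma> = (function_field X)\<lparr>carrier :=
     {\<phi> \<in> carrier (function_field X). \<forall>w\<in>carrier W. pullback X (E w) (\<sigma> w) \<phi> = \<phi>}\<rparr>"

text \<open>Restriction to \<open>Y\<close> is the pullback along the inclusion of \<open>Y\<close>.\<close>

definition galois_restriction_property ::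
  "(complex ^ 'm ^ 'm) set \<Rightarrow> (complex ^ 'm ^ 'm \<Rightarrow> complex ^ 'n ^ 'n) \<Rightarrow> (complex ^ 'n) set \<Rightarrow>
   'w monoid \<Rightarrow> ('w \<Rightarrow> (complex ^ 'n) set) \<Rightarrow> ('w \<Rightarrow> complex ^ 'n \<Rightarrow> complex ^ 'n) \<Rightarrow> bool" where
  "galois_restriction_property G R Y W E \<sigma> \<longleftrightarrow>
     (\<forall>\<phi>\<in>carrier (invariant_field G R). pullback_defined Y id \<phi>) \<and>
     pullback (induced vec_space Y) Y id
       \<in> ring_iso (invariant_field G R) (birational_invariant_field W (induced vec_space Y) E \<sigma>)"

text \<open>\<open>D\<close> is a \<open>G\<close>-stable open set on which \<open>\<pi>\<close> is regular with \<open>G\<close>-orbits as fibers; values of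
  \<open>\<pi>\<close> outside \<open>D\<close> are irrelevant.\<close>

definition rational_quotient ::
  "(complex ^ 'm ^ 'm) set \<Rightarrow> (complex ^ 'm ^ 'm \<Rightarrow> complex ^ 'n ^ 'n) \<Rightarrow> 'z fspace \<Rightarrow>
   (complex ^ 'n) set \<Rightarrow> (complex ^ 'n \<Rightarrow> 'z) \<Rightarrow> bool" where
  "rational_quotient G R Z D \<pi> \<longleftrightarrow>
     variety Z \<and> rational_map vec_space Z D \<pi> \<and> dominant Z D \<pi> \<and>
     pullback vec_space D \<pi> \<in> ring_iso (function_field Z) (invariant_field G R) \<and>
     (\<forall>x\<in>D. orbit G R x \<subseteq> D) \<and>
     (\<forall>x\<in>D. {x' \<in> D. \<pi> x' = \<pi> x} = orbit G R x)"

section \<open>Holomorphic maps\<close>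

text \<open>Complex Frechet differentiability at every point of the open set \<open>S\<close>. A map into a
  subvariety of affine space is holomorphic iff it is so as a map into the affine space.\<close>

definition holomorphic_map_on ::
  "(complex ^ 'n \<Rightarrow> complex ^ 'k) \<Rightarrow> (complex ^ 'n) set \<Rightarrow> bool" where
  "holomorphic_map_on f S \<longleftrightarrow> open S \<and>
     (\<forall>x\<in>S. \<exists>A :: complex ^ 'n ^ 'k. (f has_derivative (\<lambda>h. A *v h)) (at x))"

end

(* In an affine chart of Z the quotient map is a tuple theta of invariant
   rational functions, and the Galois restriction property says that the W-invariant rational
   functions on Y are exactly the restrictions of rational expressions in theta.  Choose a polynomial
   t whose d = |W| conjugates on Y are generically distinct.  Lagrange interpolation writes every
   rational function u on Y as a polynomial of degree < d in t with W-invariant coefficients; lifting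
   the coefficients to V, the function t^d yields a monic equation P(x, T) = 0 and the coordinates of Y
   yield a map L(x, T).  A polynomial relation that holds on Y at all conjugates of t has coefficients
   vanishing after reduction modulo P, so it holds at every pair (x, root of P(x, T)) over an open set U.
   Hence L maps such a pair to a point of Y in the orbit of x, the roots are simple, and y = L(p, t(y))
   for every y in Y in the orbit of p.  Following the simple root t(y) analytically in x gives rho. *)
theory Submission
  imports Defs "HOL-Computational_Algebra.Fundamental_Theorem_Algebra"
begin

section \<open>Locally rational functions\<close>

text \<open>The obstacle is that \<open>W\<close> acts on \<open>Y\<close> only. Over a general
  point of \<open>V\<close> there are no conjugates of \<open>t\<close>, and a rational function on
  \<open>V\<close> need not be determined by its values on \<open>Y\<close>. Rational expressions in
  \<theta> are the exception: a polynomial in \<theta> that vanishes on a nonempty open part of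
  \<open>Y\<close> vanishes on the whole chart. So every assertion about a point x and a root over
  it has to become an equation between polynomials in the root whose coefficients are expressions in
  \<theta>. Inequalities take this form once inverses are lifted too: one lifted inverse keeps L(x,
  T) inside the domain of \<theta>, another makes the derivative of P nonzero at each root. For the
  same reason U is cut out of the chart domain by conditions on \<theta> alone; it then contains
  whole orbits, so that p and y share the same P and L. Finally, the image of \<rho> is open in
  \<open>Y\<close> because elements of \<open>G\<close> move a neighbourhood of each of its points
  back into the domain of \<rho>.\<close>

definition locrat :: "('a \<Rightarrow> complex) set \<Rightarrow> 'a set \<Rightarrow> ('a \<Rightarrow> complex) \<Rightarrow> bool" where
  "locrat C U f \<longleftrightarrow> (\<forall>x\<in>U. \<exists>p\<in>poly_funs C. \<exists>q\<in>poly_funs C. q x \<noteq> 0 \<and>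
     (\<forall>y\<in>U. q y \<noteq> 0 \<longrightarrow> f y = p y / q y))"

lemma poly_funs_uminus: "f \<in> poly_funs C \<Longrightarrow> (\<lambda>x. - f x) \<in> poly_funs C"
  using poly_funs.mult[OF poly_funs.const[of "-1"]] by force

lemma poly_funs_diff:
  "f \<in> poly_funs C \<Longrightarrow> g \<in> poly_funs C \<Longrightarrow> (\<lambda>x. f x - g x) \<in> poly_funs C"
  using poly_funs.add[OF _ poly_funs_uminus, of f C g] by simp

lemma poly_funs_prod:
  "(\<And>i. i \<in> I \<Longrightarrow> f i \<in> poly_funs C) \<Longrightarrow> (\<lambda>x. \<Prod>i\<in>I. f i x) \<in> poly_funs C"
  by (induction I rule: infinite_finite_induct) (auto intro: poly_funs.intros)

section \<open>The Zariski topology through basic open sets\<close>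

lemma openin_zariski_basic: "q \<in> poly_funs C \<Longrightarrow> openin (zariski C) {x. q x \<noteq> 0}"
  unfolding openin_zariski by (rule exI[of _ "{q}"]) auto

lemma openin_zariski_iff:
  "openin (zariski C) U \<longleftrightarrow> (\<forall>x\<in>U. \<exists>q\<in>poly_funs C. q x \<noteq> 0 \<and> {y. q y \<noteq> 0} \<subseteq> U)"
proof
  assume "openin (zariski C) U"
  then obtain F where F: "F \<subseteq> poly_funs C" "U = - {x. \<forall>f\<in>F. f x = 0}"
    unfolding openin_zariski by blast
  show "\<forall>x\<in>U. \<exists>q\<in>poly_funs C. q x \<noteq> 0 \<and> {y. q y \<noteq> 0} \<subseteq> U"
    using F by blast
next
  assume *: "\<forall>x\<in>U. \<exists>q\<in>poly_funs C. q x \<noteq> 0 \<and> {y. q y \<noteq> 0} \<subseteq> U"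
  show "openin (zariski C) U"
  proof (subst openin_subopen, intro ballI)
    fix x assume "x \<in> U"
    with * obtain q where "q \<in> poly_funs C" "q x \<noteq> 0" "{y. q y \<noteq> 0} \<subseteq> U"
      by blast
    then show "\<exists>T. openin (zariski C) T \<and> x \<in> T \<and> T \<subseteq> U"
      by (intro exI[of _ "{y. q y \<noteq> 0}"]) (simp add: openin_zariski_basic)
  qed
qed

lemma openin_subtopology_zariski_iff:
  "openin (subtopology (zariski C) S) U \<longleftrightarrow>
     U \<subseteq> S \<and> (\<forall>x\<in>U. \<exists>q\<in>poly_funs C. q x \<noteq> 0 \<and> (\<forall>y\<in>S. q y \<noteq> 0 \<longrightarrow> y \<in> U))"
proof
  assume "openin (subtopology (zariski C) S) U"
  then obtain T where T: "openin (zariski C) T" "U = T \<inter> S"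
    unfolding openin_subtopology by blast
  then show "U \<subseteq> S \<and> (\<forall>x\<in>U. \<exists>q\<in>poly_funs C. q x \<noteq> 0 \<and> (\<forall>y\<in>S. q y \<noteq> 0 \<longrightarrow> y \<in> U))"
    unfolding openin_zariski_iff by (simp add: subset_iff) blast
next
  assume *: "U \<subseteq> S \<and> (\<forall>x\<in>U. \<exists>q\<in>poly_funs C. q x \<noteq> 0 \<and> (\<forall>y\<in>S. q y \<noteq> 0 \<longrightarrow> y \<in> U))"
  show "openin (subtopology (zariski C) S) U"
  proof (subst openin_subopen, intro ballI)
    fix x assume x: "x \<in> U"
    with * obtain q where q: "q \<in> poly_funs C" "q x \<noteq> 0" "\<forall>y\<in>S. q y \<noteq> 0 \<longrightarrow> y \<in> U"
      by blast
    then have "openin (subtopology (zariski C) S) ({y. q y \<noteq> 0} \<inter> S)"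
      using openin_zariski_basic by (metis openin_subtopology)
    with q x * show "\<exists>T. openin (subtopology (zariski C) S) T \<and> x \<in> T \<and> T \<subseteq> U"
      by blast
  qed
qed

section \<open>Arithmetic of locally rational functions\<close>

lemma locratE:
  assumes "locrat C U f" "x \<in> U"
  obtains p q where "p \<in> poly_funs C" "q \<in> poly_funs C" "q x \<noteq> 0"
    "\<forall>y\<in>U. q y \<noteq> 0 \<longrightarrow> f y = p y / q y"
  using assms unfolding locrat_def by blast

lemma locrat_mono: "locrat C U f \<Longrightarrow> T \<subseteq> U \<Longrightarrow> locrat C T f"
  unfolding locrat_def by blast

lemma locrat_cong: "locrat C U f \<Longrightarrow> (\<And>x. x \<in> U \<Longrightarrow> f x = g x) \<Longrightarrow> locrat C U g"
  unfolding locrat_def by simp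

lemma locrat_poly: "f \<in> poly_funs C \<Longrightarrow> locrat C U f"
  unfolding locrat_def
  by (intro ballI bexI[of _ f] bexI[of _ "\<lambda>_. 1"]) (auto intro: poly_funs.const)

lemma locrat_add:
  assumes "locrat C U f" "locrat C U g"
  shows "locrat C U (\<lambda>x. f x + g x)"
  unfolding locrat_def
proof
  fix x assume x: "x \<in> U"
  obtain p q where 1: "p \<in> poly_funs C" "q \<in> poly_funs C" "q x \<noteq> 0"
    "\<forall>y\<in>U. q y \<noteq> 0 \<longrightarrow> f y = p y / q y"
    using locratE[OF assms(1) x] .
  obtain p' q' where 2: "p' \<in> poly_funs C" "q' \<in> poly_funs C" "q' x \<noteq> 0"
    "\<forall>y\<in>U. q' y \<noteq> 0 \<longrightarrow> g y = p' y / q' y"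
    using locratE[OF assms(2) x] .
  show "\<exists>p\<in>poly_funs C. \<exists>q\<in>poly_funs C. q x \<noteq> 0 \<and> (\<forall>y\<in>U. q y \<noteq> 0 \<longrightarrow> f y + g y = p y / q y)"
    by (rule bexI[of _ "\<lambda>y. p y * q' y + p' y * q y"], rule bexI[of _ "\<lambda>y. q y * q' y"])
      (use 1 2 in \<open>auto intro!: poly_funs.intros(3,4) simp: add_frac_eq\<close>)
qed

lemma locrat_mult:
  assumes "locrat C U f" "locrat C U g"
  shows "locrat C U (\<lambda>x. f x * g x)"
  unfolding locrat_def
proof
  fix x assume x: "x \<in> U"
  obtain p q where 1: "p \<in> poly_funs C" "q \<in> poly_funs C" "q x \<noteq> 0"
    "\<forall>y\<in>U. q y \<noteq> 0 \<longrightarrow> f y = p y / q y"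
    using locratE[OF assms(1) x] .
  obtain p' q' where 2: "p' \<in> poly_funs C" "q' \<in> poly_funs C" "q' x \<noteq> 0"
    "\<forall>y\<in>U. q' y \<noteq> 0 \<longrightarrow> g y = p' y / q' y"
    using locratE[OF assms(2) x] .
  show "\<exists>p\<in>poly_funs C. \<exists>q\<in>poly_funs C. q x \<noteq> 0 \<and> (\<forall>y\<in>U. q y \<noteq> 0 \<longrightarrow> f y * g y = p y / q y)"
    by (rule bexI[of _ "\<lambda>y. p y * p' y"], rule bexI[of _ "\<lambda>y. q y * q' y"])
      (use 1 2 in \<open>auto intro!: poly_funs.intros(3,4)\<close>)
qed

lemma locrat_inverse:
  assumes "locrat C U f" "\<And>x. x \<in> U \<Longrightarrow> f x \<noteq> 0"
  shows "locrat C U (\<lambda>x. inverse (f x))"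
  unfolding locrat_def
proof
  fix x assume x: "x \<in> U"
  obtain p q where 1: "p \<in> poly_funs C" "q \<in> poly_funs C" "q x \<noteq> 0"
    "\<forall>y\<in>U. q y \<noteq> 0 \<longrightarrow> f y = p y / q y"
    using locratE[OF assms(1) x] .
  have "p x \<noteq> 0" using 1(3,4) x assms(2)[OF x] by auto
  then show "\<exists>p\<in>poly_funs C. \<exists>q\<in>poly_funs C. q x \<noteq> 0 \<and> (\<forall>y\<in>U. q y \<noteq> 0 \<longrightarrow> inverse (f y) = p y / q y)"
    by (intro bexI[of _ "\<lambda>y. q y * q y"] bexI[of _ "\<lambda>y. q y * p y"])
      (use 1 in \<open>auto intro!: poly_funs.intros(3,4)\<close>)
qed

lemma locrat_const: "locrat C U (\<lambda>_. c)"
  by (intro locrat_poly poly_funs.const)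

lemma locrat_uminus: "locrat C U f \<Longrightarrow> locrat C U (\<lambda>x. - f x)"
  using locrat_mult[OF locrat_const[of C U "-1"]] by simp

lemma locrat_diff:
  "locrat C U f \<Longrightarrow> locrat C U g \<Longrightarrow> locrat C U (\<lambda>x. f x - g x)"
  using locrat_add[OF _ locrat_uminus, of C U f g] by simp

lemma locrat_divide:
  "locrat C U f \<Longrightarrow> locrat C U g \<Longrightarrow> (\<And>x. x \<in> U \<Longrightarrow> g x \<noteq> 0) \<Longrightarrow> locrat C U (\<lambda>x. f x / g x)"
  unfolding divide_inverse by (intro locrat_mult locrat_inverse)

lemma locrat_sum:
  "(\<And>i. i \<in> I \<Longrightarrow> locrat C U (f i)) \<Longrightarrow> locrat C U (\<lambda>x. \<Sum>i\<in>I. f i x)"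
  by (induction I rule: infinite_finite_induct) (auto intro: locrat_const locrat_add)

lemma locrat_prod:
  "(\<And>i. i \<in> I \<Longrightarrow> locrat C U (f i)) \<Longrightarrow> locrat C U (\<lambda>x. \<Prod>i\<in>I. f i x)"
  by (induction I rule: infinite_finite_induct) (auto intro: locrat_const locrat_mult)

lemma locrat_power: "locrat C U f \<Longrightarrow> locrat C U (\<lambda>x. f x ^ k)"
  by (induction k) (auto intro: locrat_const locrat_mult)

lemma openin_locrat_nonzero:
  assumes U: "openin (subtopology (zariski C) S) U" and f: "locrat C U f"
  shows "openin (subtopology (zariski C) S) {x \<in> U. f x \<noteq> 0}"
  unfolding openin_subtopology_zariski_iff
proof (intro conjI ballI)
  show "{x \<in> U. f x \<noteq> 0} \<subseteq> S"
    using U by (auto simp: openin_subtopology_zariski_iff)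
next
  fix x assume "x \<in> {x \<in> U. f x \<noteq> 0}"
  then have x: "x \<in> U" "f x \<noteq> 0" by auto
  obtain p q where 1: "p \<in> poly_funs C" "q \<in> poly_funs C" "q x \<noteq> 0"
    "\<forall>y\<in>U. q y \<noteq> 0 \<longrightarrow> f y = p y / q y"
    using locratE[OF f x(1)] .
  obtain r where r: "r \<in> poly_funs C" "r x \<noteq> 0" "\<forall>y\<in>S. r y \<noteq> 0 \<longrightarrow> y \<in> U"
    using U x(1) unfolding openin_subtopology_zariski_iff by blast
  show "\<exists>q\<in>poly_funs C. q x \<noteq> 0 \<and> (\<forall>y\<in>S. q y \<noteq> 0 \<longrightarrow> y \<in> {x \<in> U. f x \<noteq> 0})"
    \<comment> \<open>\<open>r\<close> places the point in \<open>U\<close>, \<open>q\<close> makes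
      the fraction valid there, and \<open>p\<close> makes its value nonzero.\<close>
    by (rule bexI[of _ "\<lambda>y. (q y * p y) * r y"])
      (use 1 r x in \<open>auto intro!: poly_funs.mult\<close>)
qed

section \<open>Irreducibility and the identity principle\<close>

lemma irreducible_top_inter:
  assumes "irreducible_top T" "openin T A" "A \<noteq> {}" "openin T B" "B \<noteq> {}"
  shows "A \<inter> B \<noteq> {}"
proof
  assume AB: "A \<inter> B = {}"
  let ?X = "topspace T"
  have sub: "A \<subseteq> ?X" "B \<subseteq> ?X"
    using assms(2,4) openin_subset by auto
  have "closedin T (?X - A)" "closedin T (?X - B)" "?X = (?X - A) \<union> (?X - B)"
    using assms(2,4) AB sub by auto
  then have "?X = ?X - A \<or> ?X = ?X - B"
    using assms(1) unfolding irreducible_top_def by blast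
  then show False using sub assms(3,5) by blast
qed

text \<open>Generic points subject to finitely many open conditions come from here. Intersecting
  with \<open>topspace T\<close> makes the empty family yield the space rather than the whole
  type.\<close>

lemma irreducible_top_Inter:
  assumes "irreducible_top T" "finite \<A>" "\<And>A. A \<in> \<A> \<Longrightarrow> openin T A \<and> A \<noteq> {}"
  shows "openin T (topspace T \<inter> \<Inter>\<A>) \<and> topspace T \<inter> \<Inter>\<A> \<noteq> {}"
  using assms(2,3)
proof (induction \<A>)
  case empty
  then show ?case using assms(1) by (simp add: irreducible_top_def)
next
  case (insert A \<A>)
  then have *: "openin T (topspace T \<inter> \<Inter>\<A>)" "topspace T \<inter> \<Inter>\<A> \<noteq> {}" "openin T A" "A \<noteq> {}"
    by auto
  have "topspace T \<inter> \<Inter>(insert A \<A>) = A \<inter> (topspace T \<inter> \<Inter>\<A>)" by auto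
  then show ?case
    using irreducible_top_inter[OF assms(1) *(3,4,1,2)] * by auto
qed

text \<open>The identity principle: if \<open>f\<close> were nonzero somewhere, the open locus where
  it is nonzero would meet \<open>N\<close> by irreducibility. \<open>N\<close> need not lie in
  \<open>U\<close>.\<close>

lemma locrat_zero_dense:
  assumes irr: "irreducible_top (subtopology (zariski C) S)"
    and U: "openin (subtopology (zariski C) S) U" and f: "locrat C U f"
    and N: "openin (subtopology (zariski C) S) N" "N \<noteq> {}"
    and z: "\<And>x. x \<in> N \<Longrightarrow> x \<in> U \<Longrightarrow> f x = 0"
    and x: "x \<in> U"
  shows "f x = 0"
proof (rule ccontr)
  assume "f x \<noteq> 0"
  then have "{x \<in> U. f x \<noteq> 0} \<inter> N \<noteq> {}"
    using x by (intro irreducible_top_inter[OF irr openin_locrat_nonzero[OF U f] _ N]) auto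
  with z show False by blast
qed

section \<open>Regular and rational functions on subsets of affine space\<close>

text \<open>The neighbourhood in the definition of regularity can be absorbed into the denominator:
  an extra factor that vanishes outside it removes all other points from the test
  \<open>q y \<noteq> 0\<close>.\<close>

lemma reg_aff_space: "f \<in> reg (aff_space C) U \<longleftrightarrow> locrat C U f"
proof
  assume f: "f \<in> reg (aff_space C) U"
  show "locrat C U f"
    unfolding locrat_def
  proof
    fix x assume x: "x \<in> U"
    with f obtain N p q where N: "openin (zariski C) N" "x \<in> N" "p \<in> poly_funs C" "q \<in> poly_funs C"
      "\<forall>y\<in>N \<inter> U. q y \<noteq> 0 \<and> f y = p y / q y"
      unfolding aff_space_def by fastforce
    obtain r where r: "r \<in> poly_funs C" "r x \<noteq> 0" "{y. r y \<noteq> 0} \<subseteq> N"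
      using N unfolding openin_zariski_iff by blast
    show "\<exists>p\<in>poly_funs C. \<exists>q\<in>poly_funs C. q x \<noteq> 0 \<and> (\<forall>y\<in>U. q y \<noteq> 0 \<longrightarrow> f y = p y / q y)"
      by (rule bexI[of _ "\<lambda>y. p y * r y"], rule bexI[of _ "\<lambda>y. q y * r y"])
        (use N r x in \<open>auto intro!: poly_funs.mult\<close>)
  qed
next
  assume f: "locrat C U f"
  have "\<exists>N p q. openin (zariski C) N \<and> x \<in> N \<and>
       p \<in> poly_funs C \<and> q \<in> poly_funs C \<and> (\<forall>y\<in>N \<inter> U. q y \<noteq> 0 \<and> f y = p y / q y)"
    if x: "x \<in> U" for x
  proof -
    obtain p q where "p \<in> poly_funs C" "q \<in> poly_funs C" "q x \<noteq> 0"
      "\<forall>y\<in>U. q y \<noteq> 0 \<longrightarrow> f y = p y / q y"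
      using locratE[OF f x] .
    then show ?thesis
      by (intro exI[of _ "{y. q y \<noteq> 0}"] exI[of _ p] exI[of _ q]) (auto simp: openin_zariski_basic)
  qed
  then show "f \<in> reg (aff_space C) U"
    unfolding aff_space_def by simp
qed

lemma ztop_aff_space [simp]: "ztop (aff_space C) = zariski C"
  by (simp add: aff_space_def)

lemma ztop_induced [simp]: "ztop (induced X S) = subtopology (ztop X) S"
  by (simp add: induced_def)

lemma reg_induced_iff:
  "f \<in> reg (induced X S) U \<longleftrightarrow> (\<forall>x\<in>U. \<exists>N h. openin (ztop X) N \<and> x \<in> N \<and> h \<in> reg X N \<and>
       (\<forall>y\<in>N \<inter> U. f y = h y))"
  by (simp add: induced_def)

text \<open>Stated for an abstract \<open>X\<close> so that it applies to affine space and then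
  again to a space already induced from it, as happens for the domains \<open>E w\<close> inside
  \<open>Y\<close>.\<close>

lemma reg_induced_locrat:
  assumes X: "\<And>N h. openin (ztop X) N \<Longrightarrow> h \<in> reg X N \<Longrightarrow> locrat C N h"
    and top: "ztop X = subtopology (zariski C) S"
    and U: "U \<subseteq> S" and f: "f \<in> reg (induced X T) U"
  shows "locrat C U f"
  unfolding locrat_def
proof
  fix x assume x: "x \<in> U"
  with f obtain N h where N: "openin (ztop X) N" "x \<in> N" "h \<in> reg X N" "\<forall>y\<in>N \<inter> U. f y = h y"
    unfolding reg_induced_iff by blast
  obtain p q where 1: "p \<in> poly_funs C" "q \<in> poly_funs C" "q x \<noteq> 0"
    "\<forall>y\<in>N. q y \<noteq> 0 \<longrightarrow> h y = p y / q y"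
    using locratE[OF X[OF N(1,3)] N(2)] .
  obtain r where r: "r \<in> poly_funs C" "r x \<noteq> 0" "\<forall>y\<in>S. r y \<noteq> 0 \<longrightarrow> y \<in> N"
    using N(1,2) unfolding top openin_subtopology_zariski_iff by blast
  show "\<exists>p\<in>poly_funs C. \<exists>q\<in>poly_funs C. q x \<noteq> 0 \<and> (\<forall>y\<in>U. q y \<noteq> 0 \<longrightarrow> f y = p y / q y)"
  proof (intro bexI conjI ballI impI)
    show "f y = p y * r y / (q y * r y)" if y: "y \<in> U" "q y * r y \<noteq> 0" for y
    proof -
      have "y \<in> N" using r(3) U y by auto
      then show ?thesis using 1(4) N(4) y by auto
    qed
  qed (use 1 r in \<open>auto intro!: poly_funs.mult\<close>)
qed

lemma reg_induced_aff_space: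
  assumes "U \<subseteq> S"
  shows "f \<in> reg (induced (aff_space C) S) U \<longleftrightarrow> locrat C U f"
proof
  assume "f \<in> reg (induced (aff_space C) S) U"
  then show "locrat C U f"
    using reg_induced_locrat[of "aff_space C" C UNIV U f S] by (simp add: reg_aff_space)
next
  assume f: "locrat C U f"
  show "f \<in> reg (induced (aff_space C) S) U"
    unfolding reg_induced_iff
  proof
    fix x assume x: "x \<in> U"
    obtain p q where 1: "p \<in> poly_funs C" "q \<in> poly_funs C" "q x \<noteq> 0"
      "\<forall>y\<in>U. q y \<noteq> 0 \<longrightarrow> f y = p y / q y"
      using locratE[OF f x] .
    then have "locrat C {y. q y \<noteq> 0} (\<lambda>y. p y / q y)"
      by (intro locrat_divide locrat_poly) auto
    then show "\<exists>N h. openin (ztop (aff_space C)) N \<and> x \<in> N \<and> h \<in> reg (aff_space C) N \<and>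
       (\<forall>y\<in>N \<inter> U. f y = h y)"
      using 1 by (intro exI[of _ "{y. q y \<noteq> 0}"] exI[of _ "\<lambda>y. p y / q y"])
        (auto simp: openin_zariski_basic reg_aff_space)
  qed
qed

lemma regular_map_comp:
  "regular_map X Y f \<Longrightarrow> openin (ztop Y) U \<Longrightarrow> h \<in> reg Y U \<Longrightarrow>
     h \<circ> f \<in> reg X {x \<in> topspace (ztop X). f x \<in> U}"
  unfolding regular_map_def by blast

lemma locrat_comp_regular_map:
  assumes a: "regular_map (induced (induced (aff_space C) S) A) (induced (aff_space C) S) a"
    and A: "A \<subseteq> S" and U: "openin (subtopology (zariski C) S) U" and f: "locrat C U f"
  shows "locrat C {x \<in> A. a x \<in> U} (\<lambda>x. f (a x))"
proof -
  have US: "U \<subseteq> S" using U by (simp add: openin_subtopology_zariski_iff)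
  have "f \<in> reg (induced (aff_space C) S) U"
    using f reg_induced_aff_space[OF US] by simp
  with a U have *: "f \<circ> a \<in> reg (induced (induced (aff_space C) S) A)
      {x \<in> topspace (ztop (induced (induced (aff_space C) S) A)). a x \<in> U}"
    unfolding regular_map_def by simp
  have "topspace (ztop (induced (induced (aff_space C) S) A)) = A"
    using A by auto
  then have *: "f \<circ> a \<in> reg (induced (induced (aff_space C) S) A) {x \<in> A. a x \<in> U}"
    using * by simp
  have "locrat C {x \<in> A. a x \<in> U} (f \<circ> a)"
  proof (rule reg_induced_locrat[OF _ _ _ *, of C S])
    show "locrat C N h" if "openin (ztop (induced (aff_space C) S)) N"
      "h \<in> reg (induced (aff_space C) S) N" for N h
      using that reg_induced_aff_space[of N S h C]
      by (simp add: openin_subtopology_zariski_iff)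
  qed (use A in auto)
  then show ?thesis by (simp add: comp_def)
qed

lemma openin_regular_map_preimage:
  assumes a: "regular_map (induced (induced (aff_space C) S) A) (induced (aff_space C) S) a"
    and A: "openin (subtopology (zariski C) S) A" and U: "openin (subtopology (zariski C) S) U"
  shows "openin (subtopology (zariski C) S) {x \<in> A. a x \<in> U}"
proof -
  have AS: "A \<subseteq> S" using A by (simp add: openin_subtopology_zariski_iff)
  have "continuous_map (subtopology (subtopology (zariski C) S) A) (subtopology (zariski C) S) a"
    using a unfolding regular_map_def by simp
  from openin_continuous_map_preimage[OF this U]
  have "openin (subtopology (subtopology (zariski C) S) A) {x \<in> A. a x \<in> U}"
    using AS by (simp add: Int_absorb1)
  then show ?thesis using A openin_trans_full by blast
qed

lemma rat_pairs_induced_aff_space: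
  "(U, f) \<in> rat_pairs (induced (aff_space C) S) \<longleftrightarrow>
     openin (subtopology (zariski C) S) U \<and> U \<noteq> {} \<and> locrat C U f"
proof (cases "openin (subtopology (zariski C) S) U")
  case True
  then have "U \<subseteq> S" by (simp add: openin_subtopology_zariski_iff)
  from reg_induced_aff_space[OF this] show ?thesis by (simp add: rat_pairs_def)
qed (simp add: rat_pairs_def)

lemma rat_pairs_aff_space:
  "(U, f) \<in> rat_pairs (aff_space C) \<longleftrightarrow> openin (zariski C) U \<and> U \<noteq> {} \<and> locrat C U f"
  unfolding rat_pairs_def using reg_aff_space by auto

lemma rat_rel_refl: "(U, f) \<in> rat_pairs X \<Longrightarrow> ((U, f), (U, f)) \<in> rat_rel X"
  by (simp add: rat_rel_def)

text \<open>The identity principle applied to the difference of the two functions lets one nonempty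
  open set decide equality of rational functions.\<close>

lemma rat_rel_generic:
  assumes irr: "irreducible_top (subtopology (zariski C) S)"
    and 1: "(U, f) \<in> rat_pairs (induced (aff_space C) S)"
    and 2: "(U', f') \<in> rat_pairs (induced (aff_space C) S)"
    and N: "openin (subtopology (zariski C) S) N" "N \<noteq> {}"
    and eq: "\<And>x. x \<in> N \<Longrightarrow> x \<in> U \<Longrightarrow> x \<in> U' \<Longrightarrow> f x = f' x"
  shows "((U, f), (U', f')) \<in> rat_rel (induced (aff_space C) S)"
proof -
  have U: "openin (subtopology (zariski C) S) (U \<inter> U')" "locrat C U f" "locrat C U' f'"
    using 1 2 by (auto simp: rat_pairs_induced_aff_space)
  have L: "locrat C (U \<inter> U') (\<lambda>x. f x - f' x)"
    by (intro locrat_diff locrat_mono[OF U(2)] locrat_mono[OF U(3)]) auto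
  have "f x - f' x = 0" if "x \<in> U \<inter> U'" for x
    by (rule locrat_zero_dense[OF irr U(1) L N]) (use eq that in auto)
  then show ?thesis using 1 2 by (auto simp: rat_rel_def)
qed

lemma equiv_rat_rel:
  assumes irr: "irreducible_top (subtopology (zariski C) S)"
  shows "equiv (rat_pairs (induced (aff_space C) S)) (rat_rel (induced (aff_space C) S))"
proof (rule equivI)
  let ?X = "induced (aff_space C) S"
  show "rat_rel ?X \<subseteq> rat_pairs ?X \<times> rat_pairs ?X"
    unfolding rat_rel_def by auto
  show "refl_on (rat_pairs ?X) (rat_rel ?X)"
    unfolding refl_on_def rat_rel_def by auto
  show "sym (rat_rel ?X)"
    unfolding sym_def rat_rel_def by auto
  show "trans (rat_rel ?X)"
  proof (rule transI)
    fix a b c assume "(a, b) \<in> rat_rel ?X" "(b, c) \<in> rat_rel ?X"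
    moreover obtain U f U' f' U'' f'' where [simp]: "a = (U, f)" "b = (U', f')" "c = (U'', f'')"
      by (metis surj_pair)
    ultimately have *: "(U, f) \<in> rat_pairs ?X" "(U', f') \<in> rat_pairs ?X" "(U'', f'') \<in> rat_pairs ?X"
      "\<forall>x\<in>U \<inter> U'. f x = f' x" "\<forall>x\<in>U' \<inter> U''. f' x = f'' x"
      unfolding rat_rel_def by auto
    \<comment> \<open>The two outer functions are compared on the middle domain \<open>U'\<close>;
      this is where irreducibility enters.\<close>
    show "(a, c) \<in> rat_rel ?X"
      unfolding \<open>a = (U, f)\<close> \<open>c = (U'', f'')\<close>
      by (rule rat_rel_generic[OF irr *(1,3), of U'])
        (use * in \<open>auto simp: rat_pairs_induced_aff_space\<close>)
  qed
qed

section \<open>Birational actions\<close>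

text \<open>A birational map is dominant: a point y of \<open>N\<close> in the locus where the
  inverse \<open>b\<close> is defined and inverts \<open>a\<close> has the preimage
  \<open>b y\<close>.\<close>

lemma birational_preimage_nonempty:
  assumes irr: "irreducible_top (ztop X)" and a: "birational_automorphism X A a"
    and N: "openin (ztop X) N" "N \<noteq> {}"
  shows "\<exists>x\<in>A. a x \<in> N"
proof -
  obtain B b where b: "rational_comp_eq X B b A a (topspace (ztop X)) id"
    using a unfolding birational_automorphism_def by blast
  then obtain M where M: "openin (ztop X) M" "M \<noteq> {}" "b ` M \<subseteq> A" "\<forall>x\<in>M. a (b x) = id x"
    unfolding rational_comp_eq_def by blast
  obtain y where "y \<in> M" "y \<in> N"
    using irreducible_top_inter[OF irr M(1,2) N] by blast
  then show ?thesis using M(3,4) by (intro bexI[of _ "b y"]) auto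
qed

text \<open>The laws of a birational action hold only generically, each on its own open set. As
  \<open>W\<close> is finite, they hold together on \<open>N0\<close>, but \<open>N0\<close> need
  not be stable. The points of \<open>N0\<close> all of whose translates stay in \<open>N0\<close>
  form a stable set, because a translate of a translate is again a translate.\<close>

lemma birational_action_stable_open:
  assumes irr: "irreducible_top (subtopology (zariski C) S)"
    and W: "group W" "finite (carrier W)"
    and act: "birational_action W (induced (aff_space C) S) E \<sigma>"
  obtains N where "openin (subtopology (zariski C) S) N" "N \<noteq> {}"
    "\<And>w. w \<in> carrier W \<Longrightarrow> N \<subseteq> E w"
    "\<And>w y. w \<in> carrier W \<Longrightarrow> y \<in> N \<Longrightarrow> \<sigma> w y \<in> N"
    "\<And>v w y. v \<in> carrier W \<Longrightarrow> w \<in> carrier W \<Longrightarrow> y \<in> N \<Longrightarrow> \<sigma> v (\<sigma> w y) = \<sigma> (v \<otimes>\<^bsub>W\<^esub> w) y"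
proof -
  interpret group W by fact
  let ?T = "subtopology (zariski C) S"
  let ?X = "induced (aff_space C) S"
  let ?W = "carrier W"
  have bir: "birational_automorphism ?X (E w) (\<sigma> w)" if "w \<in> ?W" for w
    using act that unfolding birational_action_def by blast
  have reg: "openin ?T (E w)" "regular_map (induced ?X (E w)) ?X (\<sigma> w)" if "w \<in> ?W" for w
    using bir[OF that] unfolding birational_automorphism_def rational_map_def by auto
  have "\<forall>p\<in>?W \<times> ?W. \<exists>M. openin ?T M \<and> M \<noteq> {} \<and> M \<subseteq> E (snd p) \<and>
      (\<forall>y\<in>M. \<sigma> (fst p) (\<sigma> (snd p) y) = \<sigma> (fst p \<otimes>\<^bsub>W\<^esub> snd p) y)"
  proof (intro ballI)
    fix p assume "p \<in> ?W \<times> ?W"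
    then have "rational_comp_eq ?X (E (snd p)) (\<sigma> (snd p)) (E (fst p)) (\<sigma> (fst p))
        (E (fst p \<otimes>\<^bsub>W\<^esub> snd p)) (\<sigma> (fst p \<otimes>\<^bsub>W\<^esub> snd p))"
      using act unfolding birational_action_def by (simp add: mem_Times_iff)
    then show "\<exists>M. openin ?T M \<and> M \<noteq> {} \<and> M \<subseteq> E (snd p) \<and>
        (\<forall>y\<in>M. \<sigma> (fst p) (\<sigma> (snd p) y) = \<sigma> (fst p \<otimes>\<^bsub>W\<^esub> snd p) y)"
      unfolding rational_comp_eq_def ztop_induced ztop_aff_space by blast
  qed
  then obtain M where "\<forall>p\<in>?W \<times> ?W. openin ?T (M p) \<and> M p \<noteq> {} \<and> M p \<subseteq> E (snd p) \<and>
      (\<forall>y\<in>M p. \<sigma> (fst p) (\<sigma> (snd p) y) = \<sigma> (fst p \<otimes>\<^bsub>W\<^esub> snd p) y)"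
    unfolding bchoice_iff by (elim exE)
  then have M: "\<And>v w. v \<in> ?W \<Longrightarrow> w \<in> ?W \<Longrightarrow> openin ?T (M (v, w)) \<and> M (v, w) \<noteq> {} \<and>
      M (v, w) \<subseteq> E w \<and> (\<forall>y\<in>M (v, w). \<sigma> v (\<sigma> w y) = \<sigma> (v \<otimes>\<^bsub>W\<^esub> w) y)"
    by simp
  define N0 where "N0 = topspace ?T \<inter> \<Inter>(M ` (?W \<times> ?W))"
  have "openin ?T N0 \<and> N0 \<noteq> {}"
    unfolding N0_def by (rule irreducible_top_Inter[OF irr]) (use M W(2) in auto)
  then have N0: "openin ?T N0" "N0 \<noteq> {}" by auto
  have N0M: "N0 \<subseteq> M (v, w)" if "v \<in> ?W" "w \<in> ?W" for v w
    unfolding N0_def using that by auto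
  define pre where "pre w = {x \<in> E w. \<sigma> w x \<in> N0}" for w
  have pre: "openin ?T (pre w)" "pre w \<noteq> {}" if "w \<in> ?W" for w
    using openin_regular_map_preimage[OF reg(2,1) N0(1), OF that that]
      birational_preimage_nonempty[OF _ bir[OF that], of N0] irr N0
    by (auto simp: pre_def)
  define P where "P = topspace ?T \<inter> \<Inter>(pre ` ?W)"
  have "openin ?T P \<and> P \<noteq> {}"
    unfolding P_def by (rule irreducible_top_Inter[OF irr]) (use pre W(2) in auto)
  then have P: "openin ?T P" "P \<noteq> {}" by auto
  show thesis
  proof (rule that[of "N0 \<inter> P"])
    show "openin ?T (N0 \<inter> P)" using N0 P by blast
    show "N0 \<inter> P \<noteq> {}" using irreducible_top_inter[OF irr N0 P] .
    show "N0 \<inter> P \<subseteq> E w" if "w \<in> ?W" for w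
      using that by (auto simp: P_def pre_def)
    show comp: "\<sigma> v (\<sigma> w y) = \<sigma> (v \<otimes>\<^bsub>W\<^esub> w) y"
      if "v \<in> ?W" "w \<in> ?W" "y \<in> N0 \<inter> P" for v w y
      using M[OF that(1,2)] N0M[OF that(1,2)] that(3) by auto
    show "\<sigma> w y \<in> N0 \<inter> P" if w: "w \<in> ?W" and y: "y \<in> N0 \<inter> P" for w y
    proof
      have N0w: "\<sigma> v y \<in> N0" if "v \<in> ?W" for v
        using that y by (auto simp: P_def pre_def)
      show 1: "\<sigma> w y \<in> N0" using N0w w .
      have "\<sigma> w y \<in> pre v" if v: "v \<in> ?W" for v
      proof -
        \<comment> \<open>\<open>N0\<close> lies in \<open>M (v, v)\<close> and hence in the domain
          \<open>E v\<close>.\<close>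
        have "\<sigma> w y \<in> E v"
          using M[OF w v] N0M[OF w v] M[OF v v] N0M[OF v v] 1 by auto
        moreover have "\<sigma> v (\<sigma> w y) \<in> N0"
          unfolding comp[OF v w y] using N0w v w by simp
        ultimately show ?thesis by (simp add: pre_def)
      qed
      then show "\<sigma> w y \<in> P"
        using 1 N0(1) openin_subset unfolding P_def by fastforce
    qed
  qed
qed

section \<open>Restriction along the rational quotient\<close>

lemma pullbackI:
  assumes "(U, f) \<in> \<phi>" "x \<in> A" "a x \<in> U" "({x \<in> A. a x \<in> U}, f \<circ> a) \<in> rat_pairs X"
  shows "({x \<in> A. a x \<in> U}, f \<circ> a) \<in> pullback X A a \<phi>"
  using assms rat_rel_refl[OF assms(4)] unfolding pullback_def by (fastforce simp: Image_iff)

lemma pullbackE: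
  assumes "(N, u) \<in> pullback X A a \<phi>"
  obtains U f where "(U, f) \<in> \<phi>" "(({x \<in> A. a x \<in> U}, f \<circ> a), (N, u)) \<in> rat_rel X"
  using assms unfolding pullback_def by auto

abbreviation vcoord :: "(complex ^ 'n \<Rightarrow> complex) set" where
  "vcoord \<equiv> range (\<lambda>i v. v $ i)"

abbreviation scoord :: "((nat \<Rightarrow> complex) \<Rightarrow> complex) set" where
  "scoord \<equiv> range (\<lambda>i x. x i)"

text \<open>\<open>Z1\<close> is an affine chart of the quotient, \<open>c\<close> its coordinates
  with inverse \<open>g\<close>, and \<open>S\<close> the chart realised in affine
  \<open>k\<close>-space. The assumption \<open>meets\<close> lets the coordinates be restricted to
  \<open>Y\<close>: it puts a point of \<open>Y\<close> over the chart.\<close>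

locale quotient_chart =
  fixes G :: "(complex ^ 'm::finite ^ 'm) set"
    and R :: "complex ^ 'm ^ 'm \<Rightarrow> complex ^ 'n::finite ^ 'n"
    and Y :: "(complex ^ 'n) set"
    and W :: "'w monoid"
    and E :: "'w \<Rightarrow> (complex ^ 'n) set"
    and \<sigma> :: "'w \<Rightarrow> complex ^ 'n \<Rightarrow> complex ^ 'n"
    and Z :: "'z fspace"
    and D :: "(complex ^ 'n) set"
    and \<pi> :: "complex ^ 'n \<Rightarrow> 'z"
    and Z1 :: "'z set" and S :: "(nat \<Rightarrow> complex) set" and k :: nat
    and c :: "'z \<Rightarrow> nat \<Rightarrow> complex" and g :: "(nat \<Rightarrow> complex) \<Rightarrow> 'z"
  assumes Y: "closed_subvariety Y"
    and groupW: "group W" and finiteW: "finite (carrier W)"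
    and action: "faithful_birational_action W (induced vec_space Y) E \<sigma>"
    and galois: "galois_restriction_property G R Y W E \<sigma>"
    and quotient: "rational_quotient G R Z D \<pi>"
    and Z1: "openin (ztop Z) Z1"
    and S0: "\<And>s i. s \<in> S \<Longrightarrow> k \<le> i \<Longrightarrow> s i = 0"
    and c: "regular_map (induced Z Z1) (induced seq_space S) c"
    and g: "regular_map (induced seq_space S) (induced Z Z1) g"
    and gc: "\<And>z. z \<in> Z1 \<Longrightarrow> g (c z) = z"
    and meets: "\<exists>y\<in>Y \<inter> D. \<pi> y \<in> Z1"
begin

definition "T = subtopology (zariski vcoord) Y"
definition "X = induced (aff_space vcoord) Y"
definition "D1 = {x \<in> D. \<pi> x \<in> Z1}"
definition "\<theta> x = c (\<pi> x)"

lemma vec_space_eq: "vec_space = aff_space vcoord"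
  by (simp add: vec_space_def)

lemma irrT: "irreducible_top T"
  using Y unfolding closed_subvariety_def T_def vec_space_eq by simp

lemmas irrY = irrT[unfolded T_def]

lemma equivX: "equiv (rat_pairs X) (rat_rel X)"
  unfolding X_def by (rule equiv_rat_rel[OF irrY])

lemma rat_pairs_X: "(U, f) \<in> rat_pairs X \<longleftrightarrow> openin T U \<and> U \<noteq> {} \<and> locrat vcoord U f"
  unfolding X_def T_def by (rule rat_pairs_induced_aff_space)

lemma irrZ: "irreducible_top (ztop Z)"
  using quotient unfolding rational_quotient_def variety_def by blast

lemma Z1_sub: "Z1 \<subseteq> topspace (ztop Z)"
  using Z1 openin_subset by blast

lemma Z1_nonempty: "Z1 \<noteq> {}"
  using meets by auto

lemma c_in: "z \<in> Z1 \<Longrightarrow> c z \<in> S"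
  using c Z1_sub unfolding regular_map_def continuous_map_def by (auto simp: seq_space_def)

lemma g_in: "s \<in> S \<Longrightarrow> g s \<in> Z1"
  using g Z1_sub unfolding regular_map_def continuous_map_def by (auto simp: seq_space_def)

text \<open>The regular functions of an induced space are described without reference to the subset,
  so the sheaf axiom for all of \<open>Z\<close> serves for the chart as well.\<close>

lemma reg_Z:
  assumes "openin (ztop Z) U"
  shows "f \<in> reg Z U \<longleftrightarrow> f \<in> reg (induced Z Z1) U"
proof -
  have "function_sheaf Z"
    using quotient unfolding rational_quotient_def variety_def by blast
  then have "reg Z U = reg (induced Z (topspace (ztop Z))) U"
    using assms unfolding function_sheaf_def by blast
  then show ?thesis by (simp add: induced_def)
qed

lemma poly_reg_Z1:
  assumes p: "p \<in> poly_funs scoord"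
  shows "(\<lambda>z. p (c z)) \<in> reg Z Z1"
proof -
  have "p \<in> reg (induced seq_space S) S"
    unfolding seq_space_def using reg_induced_aff_space locrat_poly[OF p] by blast
  moreover have "openin (ztop (induced seq_space S)) S"
    by (simp add: seq_space_def)
      (metis inf_top.left_neutral openin_subtopology openin_topspace topspace_zariski)
  ultimately have "p \<circ> c \<in> reg (induced Z Z1) {z \<in> topspace (ztop (induced Z Z1)). c z \<in> S}"
    using c unfolding regular_map_def by blast
  moreover have "{z \<in> topspace (ztop (induced Z Z1)). c z \<in> S} = Z1"
    using c_in Z1_sub by auto
  ultimately show ?thesis using reg_Z[OF Z1] by (simp add: comp_def)
qed

lemma quotient_regular_map: "regular_map (induced vec_space D) Z \<pi>"
  and openin_D: "openin (zariski vcoord) D"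
  using quotient unfolding rational_quotient_def rational_map_def vec_space_eq by auto

lemma openin_pre:
  assumes "openin (ztop Z) V"
  shows "openin (zariski vcoord) {x \<in> D. \<pi> x \<in> V}"
proof -
  have "continuous_map (subtopology (zariski vcoord) D) (ztop Z) \<pi>"
    using quotient_regular_map unfolding regular_map_def vec_space_eq by simp
  from openin_continuous_map_preimage[OF this assms]
  have "openin (subtopology (zariski vcoord) D) {x \<in> D. \<pi> x \<in> V}" by simp
  then show ?thesis using openin_D openin_trans_full by blast
qed

lemma locrat_pre:
  assumes V: "openin (ztop Z) V" and f: "f \<in> reg Z V"
  shows "locrat vcoord {x \<in> D. \<pi> x \<in> V} (f \<circ> \<pi>)"
proof -
  have "f \<circ> \<pi> \<in> reg (induced vec_space D) {x \<in> topspace (ztop (induced vec_space D)). \<pi> x \<in> V}"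
    using quotient_regular_map assms unfolding regular_map_def by blast
  moreover have "{x \<in> topspace (ztop (induced vec_space D)). \<pi> x \<in> V} = {x \<in> D. \<pi> x \<in> V}"
    by (auto simp: vec_space_eq)
  ultimately show ?thesis
    using reg_induced_aff_space[of "{x \<in> D. \<pi> x \<in> V}" D] unfolding vec_space_eq by auto
qed

lemma openin_T_inter: "openin (zariski vcoord) U \<Longrightarrow> openin T (Y \<inter> U)"
  unfolding T_def openin_subtopology by (metis inf_commute)

lemma openin_D1: "openin (zariski vcoord) D1"
  unfolding D1_def by (rule openin_pre[OF Z1])

lemma locrat_theta_poly:
  assumes p: "p \<in> poly_funs scoord"
  shows "locrat vcoord D1 (\<lambda>x. p (\<theta> x))"
  using locrat_pre[OF Z1 poly_reg_Z1[OF p]] by (simp add: D1_def \<theta>_def comp_def)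

section \<open>Pulling functions back from the quotient to \<open>V\<close> and then to
  \<open>Y\<close>\<close>

definition class_Z :: "'z set \<Rightarrow> ('z \<Rightarrow> complex) \<Rightarrow> 'z ratfun" where
  "class_Z V f = rat_rel Z `` {(V, f)}"

definition lift :: "'z ratfun \<Rightarrow> (complex ^ 'n) ratfun" where
  "lift \<psi> = pullback vec_space D \<pi> \<psi>"

definition restr :: "(complex ^ 'n) ratfun \<Rightarrow> (complex ^ 'n) ratfun" where
  "restr \<phi> = pullback X Y id \<phi>"

lemma bij_lift:
  "bij_betw lift (carrier (function_field Z)) (carrier (invariant_field G R))"
  using quotient unfolding rational_quotient_def ring_iso_def lift_def[abs_def] by blast

lemma bij_restr:
  "bij_betw restr (carrier (invariant_field G R)) (carrier (birational_invariant_field W X E \<sigma>))"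
  using galois unfolding galois_restriction_property_def ring_iso_def restr_def[abs_def] X_def vec_space_eq
  by blast

lemma class_Z_carrier:
  "openin (ztop Z) V \<Longrightarrow> V \<noteq> {} \<Longrightarrow> f \<in> reg Z V \<Longrightarrow> class_Z V f \<in> carrier (function_field Z)"
  unfolding class_Z_def function_field_def rat_pairs_def by (simp add: quotientI)

lemma restr_lift_carrier:
  "\<psi> \<in> carrier (function_field Z) \<Longrightarrow> restr (lift \<psi>) \<in> carrier (birational_invariant_field W X E \<sigma>)"
  using bij_lift bij_restr unfolding bij_betw_def by blast

lemma bir_carrier:
  "\<kappa> \<in> carrier (birational_invariant_field W X E \<sigma>) \<longleftrightarrow>
     \<kappa> \<in> rat_pairs X // rat_rel X \<and> (\<forall>w\<in>carrier W. pullback X (E w) (\<sigma> w) \<kappa> = \<kappa>)"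
  by (simp add: birational_invariant_field_def function_field_def)

text \<open>The point \<open>y\<close> witnesses that both pullbacks are defined, the one along
  \<pi> and the one along the inclusion of \<open>Y\<close>, so an explicit representative survives
  both.\<close>

lemma mem_restr_lift:
  assumes V: "openin (ztop Z) V" and f: "f \<in> reg Z V" and y: "y \<in> Y" "y \<in> D" "\<pi> y \<in> V"
  shows "(Y \<inter> {x \<in> D. \<pi> x \<in> V}, f \<circ> \<pi>) \<in> restr (lift (class_Z V f))"
proof -
  let ?U = "{x \<in> D. \<pi> x \<in> V}"
  have "(V, f) \<in> class_Z V f"
    unfolding class_Z_def using V f y(3) by (auto simp: rat_rel_def rat_pairs_def)
  then have L: "(?U, f \<circ> \<pi>) \<in> lift (class_Z V f)"
    unfolding lift_def using y openin_pre[OF V] locrat_pre[OF V f]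
    by (intro pullbackI) (auto simp: vec_space_eq rat_pairs_aff_space)
  have "({x \<in> Y. id x \<in> ?U}, (f \<circ> \<pi>) \<circ> id) \<in> restr (lift (class_Z V f))"
    unfolding restr_def
  proof (rule pullbackI[OF L y(1)])
    have eq: "{x \<in> Y. id x \<in> ?U} = Y \<inter> ?U" by auto
    show "({x \<in> Y. id x \<in> ?U}, (f \<circ> \<pi>) \<circ> id) \<in> rat_pairs X"
      unfolding eq rat_pairs_X
      using openin_T_inter[OF openin_pre[OF V]] y locrat_mono[OF locrat_pre[OF V f], of "Y \<inter> ?U"]
      by auto
  qed (use y in simp)
  moreover have "{x \<in> Y. id x \<in> ?U} = Y \<inter> ?U" by auto
  ultimately show ?thesis by simp
qed

text \<open>Injectivity of the two pullbacks gives the density of the image of \<open>Y\<close> in \<open>Z\<close>.\<close>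

lemma theta_vanish:
  assumes p: "p \<in> poly_funs scoord" and N: "openin T N" "N \<noteq> {}"
    and z: "\<And>y. y \<in> N \<Longrightarrow> y \<in> D1 \<Longrightarrow> p (\<theta> y) = 0"
    and x: "x \<in> Z1"
  shows "p (c x) = 0"
proof -
  obtain y where y: "y \<in> Y" "y \<in> D" "\<pi> y \<in> Z1" using meets by blast
  let ?f = "\<lambda>z. p (c z)" and ?o = "\<lambda>z::'z. 0 :: complex"
  have o: "?o \<in> reg Z Z1" using poly_reg_Z1[OF poly_funs.const] .
  have f: "?f \<in> reg Z Z1" using poly_reg_Z1[OF p] .
  have car: "class_Z Z1 ?f \<in> carrier (function_field Z)" "class_Z Z1 ?o \<in> carrier (function_field Z)"
    using class_Z_carrier[OF Z1 Z1_nonempty] f o by auto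
  have m: "(Y \<inter> D1, ?f \<circ> \<pi>) \<in> restr (lift (class_Z Z1 ?f))"
    "(Y \<inter> D1, ?o \<circ> \<pi>) \<in> restr (lift (class_Z Z1 ?o))"
    using mem_restr_lift[OF Z1 f y] mem_restr_lift[OF Z1 o y] unfolding D1_def .
  have q: "restr (lift (class_Z Z1 ?f)) \<in> rat_pairs X // rat_rel X"
    "restr (lift (class_Z Z1 ?o)) \<in> rat_pairs X // rat_rel X"
    using restr_lift_carrier car unfolding bir_carrier by blast+
  have "((Y \<inter> D1, ?f \<circ> \<pi>), (Y \<inter> D1, ?o \<circ> \<pi>)) \<in> rat_rel X"
    unfolding X_def
  proof (rule rat_rel_generic[OF irrY _ _ N[unfolded T_def]])
    have "A \<subseteq> rat_pairs X" if "A \<in> rat_pairs X // rat_rel X" for A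
      using that equivX in_quotient_imp_subset by blast
    then show "(Y \<inter> D1, ?f \<circ> \<pi>) \<in> rat_pairs (induced (aff_space vcoord) Y)"
      "(Y \<inter> D1, ?o \<circ> \<pi>) \<in> rat_pairs (induced (aff_space vcoord) Y)"
      using m q unfolding X_def by blast+
  qed (use z in \<open>auto simp: \<theta>_def\<close>)
  then have "restr (lift (class_Z Z1 ?f)) = restr (lift (class_Z Z1 ?o))"
    using quotient_eqI[OF equivX q m] by simp
  then have "class_Z Z1 ?f = class_Z Z1 ?o"
    using inj_onD[OF comp_inj_on[of lift _ restr]] car bij_lift bij_restr
    unfolding bij_betw_def by (metis comp_apply)
  moreover have "(Z1, ?f) \<in> class_Z Z1 ?f"
    unfolding class_Z_def using Z1 f Z1_nonempty by (auto simp: rat_rel_def rat_pairs_def)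
  \<comment> \<open>Representatives of one class agree on their whole common domain, here all of
    \<open>Z1\<close>. This turns a generic statement into one about every point of the
    chart.\<close>
  ultimately have "((Z1, ?o), (Z1, ?f)) \<in> rat_rel Z" unfolding class_Z_def by auto
  then show ?thesis using x by (auto simp: rat_rel_def)
qed

text \<open>Each coordinate of \<theta> comes from a function on \<open>Z\<close>, so its
  restriction to \<open>Y\<close> is a class fixed by \<open>W\<close>. The original and the
  translated representative lie in the same class and therefore agree wherever both are
  defined.\<close>

lemma theta_invariant:
  assumes w: "w \<in> carrier W" and y: "y \<in> Y \<inter> D1" "y \<in> E w" "\<sigma> w y \<in> Y \<inter> D1"
  shows "\<theta> (\<sigma> w y) = \<theta> y"
proof
  fix i
  let ?f = "\<lambda>z. c z i"
  have f: "?f \<in> reg Z Z1" using poly_reg_Z1[OF poly_funs.coord[of "\<lambda>x. x i"]] by auto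
  let ?\<kappa> = "restr (lift (class_Z Z1 ?f))"
  have \<kappa>: "?\<kappa> \<in> rat_pairs X // rat_rel X" "pullback X (E w) (\<sigma> w) ?\<kappa> = ?\<kappa>"
    using restr_lift_carrier[OF class_Z_carrier[OF Z1 Z1_nonempty f]] w unfolding bir_carrier by auto
  have m: "(Y \<inter> D1, ?f \<circ> \<pi>) \<in> ?\<kappa>"
    using mem_restr_lift[OF Z1 f, of y] y(1) unfolding D1_def by auto
  have rp: "(Y \<inter> D1, ?f \<circ> \<pi>) \<in> rat_pairs X"
    using m \<kappa>(1) equivX in_quotient_imp_subset by blast
  have "birational_automorphism X (E w) (\<sigma> w)"
    using action w unfolding faithful_birational_action_def birational_action_def X_def vec_space_eq by blast
  then have reg: "openin T (E w)"
      "regular_map (induced (induced (aff_space vcoord) Y) (E w)) (induced (aff_space vcoord) Y) (\<sigma> w)"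
    unfolding birational_automorphism_def rational_map_def T_def X_def by auto
  have EY: "E w \<subseteq> Y" using reg(1) unfolding T_def openin_subtopology_zariski_iff by blast
  have O: "openin (subtopology (zariski vcoord) Y) (Y \<inter> D1)"
    using openin_T_inter[OF openin_D1] unfolding T_def .
  let ?P = "{x \<in> E w. \<sigma> w x \<in> Y \<inter> D1}"
  have "(?P, (?f \<circ> \<pi>) \<circ> \<sigma> w) \<in> rat_pairs X"
    unfolding rat_pairs_X T_def
    using openin_regular_map_preimage[OF reg(2,1)[unfolded T_def] O]
      locrat_comp_regular_map[OF reg(2) EY O] rp y
    by (auto simp: rat_pairs_X comp_def)
  then have "(?P, (?f \<circ> \<pi>) \<circ> \<sigma> w) \<in> pullback X (E w) (\<sigma> w) ?\<kappa>"
    by (rule pullbackI[OF m y(2), where a="\<sigma> w", OF y(3)])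
  then have "(?P, (?f \<circ> \<pi>) \<circ> \<sigma> w) \<in> ?\<kappa>"
    unfolding \<kappa>(2) .
  then have "((?P, (?f \<circ> \<pi>) \<circ> \<sigma> w), (Y \<inter> D1, ?f \<circ> \<pi>)) \<in> rat_rel X"
    using m \<kappa>(1) quotient_eq_iff[OF equivX \<kappa>(1) \<kappa>(1)] by blast
  then show "\<theta> (\<sigma> w y) i = \<theta> y i"
    using y by (auto simp: rat_rel_def \<theta>_def)
qed

text \<open>The pullback of a class is a union over all representatives that can be pulled back, so
  each has to be compared with \<open>u\<close>. On the stable set \<open>N\<close> such a
  representative, composed with \<open>\<sigma> w\<close>, equals \<open>u\<close> where defined,
  and this determines its class.\<close>

lemma invariant_class:
  assumes N: "openin T N" "N \<noteq> {}" and u: "locrat vcoord N u"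
    and E: "\<And>w. w \<in> carrier W \<Longrightarrow> N \<subseteq> E w"
    and st: "\<And>w y. w \<in> carrier W \<Longrightarrow> y \<in> N \<Longrightarrow> \<sigma> w y \<in> N"
    and inv: "\<And>w y. w \<in> carrier W \<Longrightarrow> y \<in> N \<Longrightarrow> u (\<sigma> w y) = u y"
  shows "rat_rel X `` {(N, u)} \<in> carrier (birational_invariant_field W X E \<sigma>)"
  unfolding bir_carrier
proof (intro conjI ballI)
  let ?C = "rat_rel X `` {(N, u)}"
  have rp: "(N, u) \<in> rat_pairs X" using N u by (simp add: rat_pairs_X)
  show "?C \<in> rat_pairs X // rat_rel X" using rp by (rule quotientI)
  fix w assume w: "w \<in> carrier W"
  have bir: "birational_automorphism X (E w) (\<sigma> w)"
    using action w unfolding faithful_birational_action_def birational_action_def X_def vec_space_eq by blast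
  then have reg: "openin (subtopology (zariski vcoord) Y) (E w)"
      "regular_map (induced (induced (aff_space vcoord) Y) (E w)) (induced (aff_space vcoord) Y) (\<sigma> w)"
    unfolding birational_automorphism_def rational_map_def X_def by auto
  have EY: "E w \<subseteq> Y" using reg(1) unfolding openin_subtopology_zariski_iff by blast
  have eq: "rat_rel X `` {({x \<in> E w. \<sigma> w x \<in> U}, f \<circ> \<sigma> w)} = ?C" if Uf: "(U, f) \<in> ?C" for U f
  proof -
    have r: "(U, f) \<in> rat_pairs X" "\<And>x. x \<in> N \<Longrightarrow> x \<in> U \<Longrightarrow> u x = f x"
      using Uf by (auto simp: rat_rel_def)
    have U: "openin (subtopology (zariski vcoord) Y) U" "U \<noteq> {}" "locrat vcoord U f"
      using r(1) by (auto simp: rat_pairs_X T_def)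
    have ne: "\<exists>x\<in>E w. \<sigma> w x \<in> U"
      using birational_preimage_nonempty[OF _ bir, of U] irrY U by (simp add: X_def)
    have rp': "({x \<in> E w. \<sigma> w x \<in> U}, f \<circ> \<sigma> w) \<in> rat_pairs X"
      unfolding rat_pairs_X T_def
      using openin_regular_map_preimage[OF reg(2,1) U(1)]
        locrat_comp_regular_map[OF reg(2) EY U(1,3)] ne by (auto simp: comp_def)
    have "((N, u), ({x \<in> E w. \<sigma> w x \<in> U}, f \<circ> \<sigma> w)) \<in> rat_rel X"
      unfolding X_def
    proof (rule rat_rel_generic[OF irrY _ _ N[unfolded T_def]])
      fix x assume x: "x \<in> N" "x \<in> {x \<in> E w. \<sigma> w x \<in> U}"
      show "u x = (f \<circ> \<sigma> w) x"
        using r(2)[of "\<sigma> w x"] st[OF w x(1)] inv[OF w x(1)] x by simp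
    qed (use rp rp' in \<open>auto simp: X_def\<close>)
    from equiv_class_eq[OF equivX this] show ?thesis by (rule sym)
  qed
  have "(N, u) \<in> ?C" using rat_rel_refl[OF rp] by auto
  moreover have "\<exists>x\<in>E w. \<sigma> w x \<in> N" using E[OF w] st[OF w] N(2) by blast
  ultimately show "pullback X (E w) (\<sigma> w) ?C = ?C"
    unfolding pullback_def by (intro equalityI subsetI) (use eq in \<open>fastforce+\<close>)
qed

text \<open>This is the surjectivity of the two pullbacks.\<close>

lemma theta_surj:
  assumes N: "openin T N" "N \<noteq> {}" and u: "locrat vcoord N u"
    and E: "\<And>w. w \<in> carrier W \<Longrightarrow> N \<subseteq> E w"
    and st: "\<And>w y. w \<in> carrier W \<Longrightarrow> y \<in> N \<Longrightarrow> \<sigma> w y \<in> N"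
    and inv: "\<And>w y. w \<in> carrier W \<Longrightarrow> y \<in> N \<Longrightarrow> u (\<sigma> w y) = u y"
  obtains p q N' where "p \<in> poly_funs scoord" "q \<in> poly_funs scoord"
    "openin T N'" "N' \<noteq> {}" "N' \<subseteq> N" "N' \<subseteq> D1"
    "\<And>y. y \<in> N' \<Longrightarrow> q (\<theta> y) \<noteq> 0 \<and> u y * q (\<theta> y) = p (\<theta> y)"
proof -
  have "rat_rel X `` {(N, u)} \<in> carrier (birational_invariant_field W X E \<sigma>)"
    by (rule invariant_class) (fact assms)+
  then have "rat_rel X `` {(N, u)} \<in> restr ` carrier (invariant_field G R)"
    using bij_restr by (simp add: bij_betw_def)
  then obtain \<phi> where \<phi>: "\<phi> \<in> carrier (invariant_field G R)" "restr \<phi> = rat_rel X `` {(N, u)}"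
    by auto
  then have "\<phi> \<in> lift ` carrier (function_field Z)"
    using bij_lift by (simp add: bij_betw_def)
  then obtain \<psi> where \<psi>: "\<psi> \<in> carrier (function_field Z)" "lift \<psi> = \<phi>"
    by auto
  have "(N, u) \<in> rat_pairs X" using N u by (simp add: rat_pairs_X)
  then have "(N, u) \<in> restr \<phi>" using rat_rel_refl unfolding \<phi>(2) by blast
  then obtain U f where U: "(U, f) \<in> \<phi>" "(({x \<in> Y. id x \<in> U}, f \<circ> id), (N, u)) \<in> rat_rel X"
    unfolding restr_def by (rule pullbackE)
  obtain V h where V: "(V, h) \<in> \<psi>" "(({x \<in> D. \<pi> x \<in> V}, h \<circ> \<pi>), (U, f)) \<in> rat_rel vec_space"
    using U(1) unfolding \<psi>(2)[symmetric] lift_def by (rule pullbackE)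
  have V': "openin (ztop Z) V" "V \<noteq> {}" "h \<in> reg Z V"
    using \<psi>(1) V(1) unfolding function_field_def quotient_def rat_rel_def rat_pairs_def by auto
  obtain z where z: "z \<in> V" "z \<in> Z1"
    using irreducible_top_inter[OF irrZ V'(1,2) Z1 Z1_nonempty] by blast
  \<comment> \<open>The function on \<open>Z\<close> is carried by the inverse chart
    \<open>g\<close> to the affine set \<open>S\<close>; near the point \<open>c z\<close> it is a
    fraction of polynomials there, which become polynomials in \<theta> on \<open>V\<close>.\<close>
  have hg: "h \<circ> g \<in> reg (induced seq_space S) {s \<in> topspace (ztop (induced seq_space S)). g s \<in> V \<inter> Z1}"
    and og: "openin (ztop (induced seq_space S)) {s \<in> topspace (ztop (induced seq_space S)). g s \<in> V \<inter> Z1}"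
  proof -
    have o: "openin (ztop Z) (V \<inter> Z1)" using V' Z1 by blast
    then have o': "openin (ztop (induced Z Z1)) (V \<inter> Z1)"
      unfolding ztop_induced openin_subtopology by blast
    have "h \<in> reg (induced Z Z1) (V \<inter> Z1)"
      unfolding reg_induced_iff using V' by (intro ballI exI[of _ V] exI[of _ h]) auto
    then show "h \<circ> g \<in> reg (induced seq_space S) {s \<in> topspace (ztop (induced seq_space S)). g s \<in> V \<inter> Z1}"
      by (rule regular_map_comp[OF g o'])
    show "openin (ztop (induced seq_space S)) {s \<in> topspace (ztop (induced seq_space S)). g s \<in> V \<inter> Z1}"
      using g unfolding regular_map_def by (intro openin_continuous_map_preimage[OF _ o']) simp
  qed
  let ?A = "{s \<in> S. g s \<in> V}"
  have A: "{s \<in> topspace (ztop (induced seq_space S)). g s \<in> V \<inter> Z1} = ?A"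
    using g_in by (auto simp: seq_space_def)
  have og: "openin (subtopology (zariski scoord) S) ?A"
    using og unfolding A by (simp add: seq_space_def)
  have hg: "locrat scoord ?A (\<lambda>s. h (g s))"
    using hg unfolding A seq_space_def comp_def
    by (subst (asm) reg_induced_aff_space) (auto elim!: locrat_mono intro: g_in)
  have cz: "c z \<in> ?A" using c_in gc z by simp
  obtain p q where pq: "p \<in> poly_funs scoord" "q \<in> poly_funs scoord" "q (c z) \<noteq> 0"
    "\<forall>s\<in>?A. q s \<noteq> 0 \<longrightarrow> h (g s) = p s / q s"
    using locratE[OF hg cz] .
  obtain r where r: "r \<in> poly_funs scoord" "r (c z) \<noteq> 0" "\<forall>s\<in>S. r s \<noteq> 0 \<longrightarrow> s \<in> ?A"
    using og cz unfolding openin_subtopology_zariski_iff by blast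
  \<comment> \<open>The factor \<open>r\<close> forces \<open>\<theta> y\<close> into
    \<open>?A\<close>, that is, \<open>\<pi> y\<close> into the domain \<open>V\<close> of
    \<open>h\<close>.\<close>
  let ?q = "\<lambda>s. q s * r s"
  have q: "?q \<in> poly_funs scoord" using pq r by (intro poly_funs.mult)
  have oYD: "openin (subtopology (zariski vcoord) Y) (Y \<inter> D1)"
    using openin_T_inter[OF openin_D1] unfolding T_def .
  let ?M = "{y \<in> Y \<inter> D1. ?q (\<theta> y) \<noteq> 0}"
  have M: "openin T ?M"
    unfolding T_def
    by (rule openin_locrat_nonzero[OF oYD locrat_mono[OF locrat_theta_poly[OF q]]]) auto
  \<comment> \<open>A denominator vanishing on all of \<open>Y \<inter> D1\<close> would vanish on
    the whole chart, in particular at \<open>c z\<close>.\<close>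
  have M': "?M \<noteq> {}"
  proof
    assume e: "?M = {}"
    have "?q (c z) = 0"
    proof (rule theta_vanish[OF q])
      show "openin T (Y \<inter> D1)" using oYD unfolding T_def .
      show "Y \<inter> D1 \<noteq> {}" using meets unfolding D1_def by blast
    qed (use e z in auto)
    then show False using pq r by simp
  qed
  have UY: "{x \<in> Y. id x \<in> U} = Y \<inter> U" by auto
  have O1: "openin T (Y \<inter> U)" "Y \<inter> U \<noteq> {}"
    using U(2) unfolding UY by (auto simp: rat_rel_def rat_pairs_X)
  have O2: "openin T (N \<inter> (Y \<inter> U))" "N \<inter> (Y \<inter> U) \<noteq> {}"
    using irreducible_top_inter[OF irrT N O1] N O1 by auto
  show thesis
  proof (rule that[of "\<lambda>s. p s * r s" ?q "?M \<inter> (N \<inter> (Y \<inter> U))"])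
    show "openin T (?M \<inter> (N \<inter> (Y \<inter> U)))" using M O2(1) by blast
    show "?M \<inter> (N \<inter> (Y \<inter> U)) \<noteq> {}" by (rule irreducible_top_inter[OF irrT M M' O2])
    fix y assume y: "y \<in> ?M \<inter> (N \<inter> (Y \<inter> U))"
    then have *: "y \<in> D" "\<pi> y \<in> Z1" "q (\<theta> y) \<noteq> 0" "r (\<theta> y) \<noteq> 0" "y \<in> Y" "y \<in> U" "y \<in> N"
      by (auto simp: D1_def)
    have \<theta>: "\<theta> y \<in> ?A" using r(3) * c_in[OF *(2)] unfolding \<theta>_def by blast
    then have "\<pi> y \<in> V" using gc[OF *(2)] unfolding \<theta>_def by simp
    then have "f y = h (\<pi> y)" using V(2) * by (auto simp: rat_rel_def)
    also have "\<dots> = h (g (\<theta> y))" unfolding \<theta>_def using gc[OF *(2)] by simp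
    also have "\<dots> = p (\<theta> y) / q (\<theta> y)" using pq(4) \<theta> * by blast
    finally have "f y = p (\<theta> y) / q (\<theta> y)" .
    moreover have "f y = u y" using U(2) * by (auto simp: rat_rel_def)
    ultimately show "?q (\<theta> y) \<noteq> 0 \<and> u y * ?q (\<theta> y) = p (\<theta> y) * r (\<theta> y)"
      using * by simp
  qed (use pq r q in \<open>auto intro: poly_funs.mult\<close>)
qed

end

section \<open>Lagrange interpolation and simple roots\<close>

definition lagrange :: "'i set \<Rightarrow> ('i \<Rightarrow> complex) \<Rightarrow> ('i \<Rightarrow> complex) \<Rightarrow> complex poly" where
  "lagrange I a b = (\<Sum>w\<in>I. smult (b w / (\<Prod>v\<in>I - {w}. a w - a v)) (\<Prod>v\<in>I - {w}. [:- a v, 1:]))"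

lemma poly_lagrange:
  assumes "finite I" "inj_on a I" "w \<in> I"
  shows "poly (lagrange I a b) (a w) = b w"
proof -
  have nz: "(\<Prod>v\<in>I - {w}. a w - a v) \<noteq> 0"
    using assms by (auto simp: inj_on_def)
  have "poly (lagrange I a b) (a w) =
      (\<Sum>u\<in>I. b u / (\<Prod>v\<in>I - {u}. a u - a v) * (\<Prod>v\<in>I - {u}. a w - a v))"
    unfolding lagrange_def by (simp add: poly_sum poly_prod)
  also have "\<dots> = (\<Sum>u\<in>I. if u = w then b w else 0)"
  proof (rule sum.cong)
    fix u assume u: "u \<in> I"
    show "b u / (\<Prod>v\<in>I - {u}. a u - a v) * (\<Prod>v\<in>I - {u}. a w - a v) = (if u = w then b w else 0)"
    proof (cases "u = w")
      case True
      then show ?thesis using nz by simp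
    next
      case False
      then have "(\<Prod>v\<in>I - {u}. a w - a v) = 0"
        using assms u by (intro prod_zero) auto
      then show ?thesis using False by simp
    qed
  qed simp
  also have "\<dots> = b w" using assms by simp
  finally show ?thesis .
qed

lemma degree_lagrange:
  assumes "finite I" "I \<noteq> {}"
  shows "degree (lagrange I a b) < card I"
proof -
  have "degree (smult (b w / (\<Prod>v\<in>I - {w}. a w - a v)) (\<Prod>v\<in>I - {w}. [:- a v, 1:])) \<le> card I - 1"
    if "w \<in> I" for w
  proof -
    have "degree (\<Prod>v\<in>I - {w}. [:- a v, 1:]) \<le> sum (degree \<circ> (\<lambda>v. [:- a v, 1:])) (I - {w})"
      using assms by (intro degree_prod_sum_le) auto
    also have "\<dots> = card I - 1" using assms that by (simp add: card_Diff_singleton)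
    finally show ?thesis using degree_smult_le le_trans by blast
  qed
  then have "degree (lagrange I a b) \<le> card I - 1"
    unfolding lagrange_def by (intro degree_sum_le assms)
  moreover have "card I > 0" using assms by (simp add: card_gt_0_iff)
  ultimately show ?thesis by linarith
qed

lemma poly_as_sum:
  fixes p :: "complex poly"
  assumes "degree p < d"
  shows "poly p x = (\<Sum>i<d. coeff p i * x ^ i)"
proof -
  have "poly p x = (\<Sum>i\<le>degree p. coeff p i * x ^ i)" by (rule poly_altdef)
  also have "\<dots> = (\<Sum>i<d. coeff p i * x ^ i)"
    using assms by (intro sum.mono_neutral_left) (auto simp: coeff_eq_0)
  finally show ?thesis .
qed

text \<open>Interpolation sees only the set of pairs of node and value, not their labels. With
  \<open>f\<close> a translation of \<open>W\<close> this makes the coefficients of interpolants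
  invariant under \<open>W\<close>.\<close>

lemma lagrange_reindex:
  assumes f: "bij_betw f I I"
  shows "lagrange I (\<lambda>w. a (f w)) (\<lambda>w. b (f w)) = lagrange I a b"
proof -
  have inj: "inj_on f I" using f by (rule bij_betw_imp_inj_on)
  have D: "bij_betw f (I - {w}) (I - {f w})" if "w \<in> I" for w
    using f that by (auto simp: bij_betw_def inj_on_def)
  have "lagrange I (\<lambda>w. a (f w)) (\<lambda>w. b (f w)) =
     (\<Sum>w\<in>I. (\<lambda>w. smult (b w / (\<Prod>v\<in>I - {w}. a w - a v)) (\<Prod>v\<in>I - {w}. [:- a v, 1:])) (f w))"
    unfolding lagrange_def
  proof (rule sum.cong)
    fix w assume w: "w \<in> I"
    have "(\<Prod>v\<in>I - {w}. a (f w) - a (f v)) = (\<Prod>v\<in>I - {f w}. a (f w) - a v)"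
      by (rule prod.reindex_bij_betw[OF D[OF w], of "\<lambda>v. a (f w) - a v"])
    moreover have "(\<Prod>v\<in>I - {w}. [:- a (f v), 1:]) = (\<Prod>v\<in>I - {f w}. [:- a v, 1:])"
      by (rule prod.reindex_bij_betw[OF D[OF w], of "\<lambda>v. [:- a v, 1:]"])
    ultimately show "smult (b (f w) / (\<Prod>v\<in>I - {w}. a (f w) - a (f v))) (\<Prod>v\<in>I - {w}. [:- a (f v), 1:]) =
      (\<lambda>w. smult (b w / (\<Prod>v\<in>I - {w}. a w - a v)) (\<Prod>v\<in>I - {w}. [:- a v, 1:])) (f w)" by simp
  qed simp
  also have "\<dots> = lagrange I a b"
    unfolding lagrange_def by (rule sum.reindex_bij_betw[OF f])
  finally show ?thesis .
qed

lemma lagrange_cong: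
  assumes "\<And>w. w \<in> I \<Longrightarrow> a w = a' w" "\<And>w. w \<in> I \<Longrightarrow> b w = b' w"
  shows "lagrange I a b = lagrange I a' b'"
  unfolding lagrange_def using assms by (intro sum.cong arg_cong2[of _ _ _ _ smult] arg_cong2[of _ _ _ _ "(/)"] prod.cong) auto

lemma locrat_coeff_prod:
  assumes "finite J" "\<And>v. v \<in> J \<Longrightarrow> locrat C U (\<lambda>y. a v y)"
  shows "locrat C U (\<lambda>y. coeff (\<Prod>v\<in>J. [:- a v y, 1:]) i)"
  using assms
proof (induction J arbitrary: i)
  case empty
  show ?case by (simp add: locrat_const)
next
  case (insert v J)
  have 1: "locrat C U (\<lambda>y. - a v y * coeff (\<Prod>v\<in>J. [:- a v y, 1:]) i)" for i
    using insert by (intro locrat_mult locrat_uminus) auto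
  have 2: "locrat C U (\<lambda>y. coeff (pCons 0 (\<Prod>v\<in>J. [:- a v y, 1:])) i)"
    using insert.IH insert.prems by (cases i) (auto simp: locrat_const)
  from locrat_add[OF 1[of i] 2] show ?case using insert.hyps by simp
qed

lemma locrat_coeff_lagrange:
  assumes I: "finite I" and a: "\<And>v. v \<in> I \<Longrightarrow> locrat C U (\<lambda>y. a v y)"
    and b: "\<And>v. v \<in> I \<Longrightarrow> locrat C U (\<lambda>y. b v y)"
    and inj: "\<And>y. y \<in> U \<Longrightarrow> inj_on (\<lambda>v. a v y) I"
  shows "locrat C U (\<lambda>y. coeff (lagrange I (\<lambda>v. a v y) (\<lambda>v. b v y)) i)"
proof -
  have "locrat C U (\<lambda>y. \<Sum>w\<in>I. b w y / (\<Prod>v\<in>I - {w}. a w y - a v y) *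
      coeff (\<Prod>v\<in>I - {w}. [:- a v y, 1:]) i)"
  proof (intro locrat_sum locrat_mult locrat_divide locrat_coeff_prod locrat_prod locrat_diff)
    fix w y assume "w \<in> I" "y \<in> U"
    then show "(\<Prod>v\<in>I - {w}. a w y - a v y) \<noteq> 0"
      using I inj by (auto simp: inj_on_def)
  qed (use I a b in auto)
  then show ?thesis unfolding lagrange_def by (simp add: coeff_sum)
qed

text \<open>Invertibility of the Vandermonde matrix, obtained by counting roots: a nonzero
  polynomial of degree below \<open>card I\<close> cannot have \<open>card I\<close> distinct
  roots.\<close>

lemma distinct_roots_coeffs_zero:
  fixes c :: "nat \<Rightarrow> complex"
  assumes I: "finite I" "inj_on a I"
    and z: "\<And>w. w \<in> I \<Longrightarrow> (\<Sum>i<card I. c i * a w ^ i) = 0" and i: "i < card I"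
  shows "c i = 0"
proof -
  let ?p = "\<Sum>i<card I. monom (c i) i"
  have co: "coeff ?p j = (if j < card I then c j else 0)" for j
    by (simp add: coeff_sum sum.If_cases)
  have "?p = 0"
  proof (rule ccontr)
    assume p: "?p \<noteq> 0"
    have "a ` I \<subseteq> {x. poly ?p x = 0}"
      using z by (auto simp: poly_sum poly_monom)
    then have "card (a ` I) \<le> card {x. poly ?p x = 0}"
      by (rule card_mono[OF poly_roots_finite[OF p]])
    also have "\<dots> \<le> degree ?p"
      using card_poly_roots_bound[OF p] .
    also have "\<dots> \<le> card I - 1"
      by (rule degree_le) (use co in auto)
    finally show False using i card_image[OF I(2)] by linarith
  qed
  then show ?thesis using co[of i] i by simp
qed

text \<open>The derivative of the polynomial \<open>T ^ d - (\<Sum>i<d. a i * T ^ i)\<close>.\<close>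

definition dchar :: "nat \<Rightarrow> (nat \<Rightarrow> complex) \<Rightarrow> complex \<Rightarrow> complex" where
  "dchar d a \<tau> = of_nat d * \<tau> ^ (d - 1) - (\<Sum>i<d. of_nat i * a i * \<tau> ^ (i - 1))"

text \<open>A monic polynomial of degree \<open>card I\<close> with \<open>card I\<close> distinct
  roots has no double root: dividing by the linear factor of a double root would leave a nonzero
  polynomial of smaller degree that still vanishes at all of them.\<close>

lemma dchar_nonzero:
  assumes I: "finite I" "inj_on t I"
    and r: "\<And>w. w \<in> I \<Longrightarrow> t w ^ card I = (\<Sum>i<card I. a i * t w ^ i)" and w: "w \<in> I"
  shows "dchar (card I) a (t w) \<noteq> 0"
proof
  assume z: "dchar (card I) a (t w) = 0"
  let ?d = "card I"
  have d: "?d > 0" using w I by (auto simp: card_gt_0_iff)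
  let ?s = "\<Sum>i<?d. monom (a i) i"
  let ?p = "monom 1 ?d - ?s"
  have pr: "poly ?p (t v) = 0" if "v \<in> I" for v
    using r[OF that] by (simp add: poly_sum poly_monom)
  have pd: "poly (pderiv ?p) (t w) = 0"
    using z by (simp add: dchar_def pderiv_diff higher_pderiv_sum[of 1, simplified] pderiv_monom poly_sum poly_monom mult.commute)
  have "coeff ?p ?d = 1"
    by (simp add: coeff_sum)
  then have p0: "?p \<noteq> 0" by (metis coeff_0 zero_neq_one)
  have dp: "degree ?p \<le> ?d"
    by (rule degree_le) (auto simp: coeff_sum)
  obtain q where q: "?p = [:- t w, 1:] * q"
    using pr[OF w] unfolding poly_eq_0_iff_dvd by (elim dvdE)
  have q0: "q \<noteq> 0" using p0 q by auto
  have dq: "degree q < ?d"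
    using dp q0 unfolding q by (subst (asm) degree_mult_eq) auto
  have "poly q (t w) = 0"
    using pd unfolding q pderiv_mult by (simp add: pderiv_pCons)
  moreover have "poly q (t v) = 0" if "v \<in> I" "v \<noteq> w" for v
  proof -
    have "t v - t w \<noteq> 0" using that w I(2) by (auto simp: inj_on_def)
    then show ?thesis using pr[OF that(1)] unfolding q by simp
  qed
  ultimately have "t ` I \<subseteq> {x. poly q x = 0}" by auto
  then have "card (t ` I) \<le> card {x. poly q x = 0}"
    by (rule card_mono[OF poly_roots_finite[OF q0]])
  also have "\<dots> \<le> degree q" by (rule card_poly_roots_bound[OF q0])
  finally show False using dq card_image[OF I(2)] by simp
qed

text \<open>A root over each point of U is what produces a point of \<open>Y\<close> on its orbit;
  this is the only source of such points.\<close>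

lemma monic_root_exists:
  assumes "0 < d"
  shows "\<exists>\<tau>::complex. \<tau> ^ d = (\<Sum>i<d. a i * \<tau> ^ i)"
proof -
  let ?p = "monom 1 d - (\<Sum>i<d. monom (a i) i)"
  have c: "coeff ?p d = 1" by (simp add: coeff_sum)
  then have "d \<le> degree ?p" by (intro le_degree) simp
  then have "degree ?p \<noteq> 0" using assms by simp
  then have "\<not> constant (poly ?p)" by (simp add: constant_degree)
  then obtain \<tau> where "poly ?p \<tau> = 0" using fundamental_theorem_of_algebra by blast
  then show ?thesis by (intro exI[of _ \<tau>]) (simp add: poly_sum poly_monom)
qed

text \<open>To include a further point \<open>x\<close>, add a multiple of a polynomial
  \<open>s\<close> that vanishes on \<open>F\<close> but not at \<open>x\<close>. Values on
  \<open>F\<close> stay as they are, and only finitely many multiples let the value at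
  \<open>x\<close> collide with one of them.\<close>

lemma separating_poly:
  fixes F :: "(complex ^ 'n::finite) set"
  assumes "finite F"
  shows "\<exists>t\<in>poly_funs vcoord. inj_on t F"
  using assms
proof induction
  case empty
  show ?case using poly_funs.const by auto
next
  case (insert x F)
  then obtain t where t: "t \<in> poly_funs vcoord" "inj_on t F" by blast
  have "\<exists>j. x $ j \<noteq> y $ j" if "y \<in> F" for y
    using that insert.hyps by (metis vec_eq_iff)
  then obtain j where j: "\<And>y. y \<in> F \<Longrightarrow> x $ j y \<noteq> y $ j y" by metis
  define s where "s = (\<lambda>z. \<Prod>y\<in>F. z $ j y - y $ j y)"
  have s: "s \<in> poly_funs vcoord"
    unfolding s_def
    by (intro poly_funs_prod poly_funs_diff poly_funs.const poly_funs.coord) auto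
  have s0: "s y = 0" if "y \<in> F" for y
    unfolding s_def using that insert.hyps by (intro prod_zero) auto
  have sx: "s x \<noteq> 0" unfolding s_def using j insert.hyps by auto
  have "finite ((\<lambda>y. (t y - t x) / s x) ` F)" using insert.hyps by simp
  then obtain l where l: "l \<notin> (\<lambda>y. (t y - t x) / s x) ` F"
    using ex_new_if_finite[OF infinite_UNIV_char_0] by blast
  let ?t = "\<lambda>z. t z + l * s z"
  have "?t \<in> poly_funs vcoord" using t s by (intro poly_funs.add poly_funs.mult poly_funs.const)
  moreover have "?t x \<noteq> ?t y" if "y \<in> F" for y
  proof
    assume "?t x = ?t y"
    then have "l = (t y - t x) / s x" using s0[OF that] sx by (simp add: field_simps)
    then show False using l that by blast
  qed
  moreover have "inj_on ?t F \<longleftrightarrow> inj_on t F"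
    by (rule inj_on_cong) (simp add: s0)
  ultimately have "?t \<in> poly_funs vcoord" "inj_on ?t (insert x F)"
    using t(2) by auto
  then show ?case by blast
qed

section \<open>Functions on the roots of a monic polynomial\<close>

text \<open>\<open>A\<close> is the algebra of admissible coefficients, later the fractions in
  \<theta> on \<open>U\<close>. Keeping it abstract separates the reduction modulo the monic
  equation from the geometry.\<close>

locale monic_family =
  fixes A :: "('a \<Rightarrow> complex) set" and U :: "'a set" and d :: nat and a :: "nat \<Rightarrow> 'a \<Rightarrow> complex"
  assumes A_const: "(\<lambda>_. c) \<in> A"
    and A_add: "f \<in> A \<Longrightarrow> g \<in> A \<Longrightarrow> (\<lambda>x. f x + g x) \<in> A"
    and A_mult: "f \<in> A \<Longrightarrow> g \<in> A \<Longrightarrow> (\<lambda>x. f x * g x) \<in> A"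
    and d: "0 < d"
    and a: "i < d \<Longrightarrow> a i \<in> A"
begin

definition fam_root :: "'a \<Rightarrow> complex \<Rightarrow> bool" where
  "fam_root x \<tau> \<longleftrightarrow> \<tau> ^ d = (\<Sum>i<d. a i x * \<tau> ^ i)"

text \<open>Modulo the monic equation every polynomial in \<open>\<tau>\<close> over \<open>A\<close> reduces to degree \<open>< d\<close>.\<close>

definition B :: "('a \<Rightarrow> complex \<Rightarrow> complex) set" where
  "B = {F. \<exists>c. (\<forall>i<d. c i \<in> A) \<and> (\<forall>x\<in>U. \<forall>\<tau>. fam_root x \<tau> \<longrightarrow> F x \<tau> = (\<Sum>i<d. c i x * \<tau> ^ i))}"

lemma BI:
  "(\<And>i. i < d \<Longrightarrow> c i \<in> A) \<Longrightarrow>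
   (\<And>x \<tau>. x \<in> U \<Longrightarrow> fam_root x \<tau> \<Longrightarrow> F x \<tau> = (\<Sum>i<d. c i x * \<tau> ^ i)) \<Longrightarrow> F \<in> B"
  unfolding B_def by blast

lemma BE:
  assumes "F \<in> B"
  obtains c where "\<And>i. i < d \<Longrightarrow> c i \<in> A"
    "\<And>x \<tau>. x \<in> U \<Longrightarrow> fam_root x \<tau> \<Longrightarrow> F x \<tau> = (\<Sum>i<d. c i x * \<tau> ^ i)"
  using assms unfolding B_def by blast

lemma B_add:
  assumes "F \<in> B" "H \<in> B"
  shows "(\<lambda>x \<tau>. F x \<tau> + H x \<tau>) \<in> B"
proof -
  obtain c where c: "\<And>i. i < d \<Longrightarrow> c i \<in> A"
    "\<And>x \<tau>. x \<in> U \<Longrightarrow> fam_root x \<tau> \<Longrightarrow> F x \<tau> = (\<Sum>i<d. c i x * \<tau> ^ i)" using BE[OF assms(1)] by metis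
  obtain c' where c': "\<And>i. i < d \<Longrightarrow> c' i \<in> A"
    "\<And>x \<tau>. x \<in> U \<Longrightarrow> fam_root x \<tau> \<Longrightarrow> H x \<tau> = (\<Sum>i<d. c' i x * \<tau> ^ i)" using BE[OF assms(2)] by metis
  show ?thesis
    by (rule BI[of "\<lambda>i x. c i x + c' i x"]) (simp_all add: A_add c c' sum.distrib algebra_simps)
qed

lemma B_scale:
  assumes "f \<in> A" "F \<in> B"
  shows "(\<lambda>x \<tau>. f x * F x \<tau>) \<in> B"
proof -
  obtain c where c: "\<And>i. i < d \<Longrightarrow> c i \<in> A"
    "\<And>x \<tau>. x \<in> U \<Longrightarrow> fam_root x \<tau> \<Longrightarrow> F x \<tau> = (\<Sum>i<d. c i x * \<tau> ^ i)" using BE[OF assms(2)] by metis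
  show ?thesis
    by (rule BI[of "\<lambda>i x. f x * c i x"]) (simp_all add: A_mult assms c sum_distrib_left mult.assoc)
qed

lemma B_shift:
  assumes "F \<in> B"
  shows "(\<lambda>x \<tau>. \<tau> * F x \<tau>) \<in> B"
proof -
  obtain c where c: "\<And>i. i < d \<Longrightarrow> c i \<in> A"
    "\<And>x \<tau>. x \<in> U \<Longrightarrow> fam_root x \<tau> \<Longrightarrow> F x \<tau> = (\<Sum>i<d. c i x * \<tau> ^ i)" using BE[OF assms] by metis
  obtain m where m: "d = Suc m" using d gr0_implies_Suc by blast
  \<comment> \<open>Multiplication by \<tau> shifts the coefficients up by one; the top term
    \<open>c m x * \<tau> ^ d\<close>, where \<open>m\<close> is \<open>d - 1\<close>, overflows and
    is replaced by means of the monic equation.\<close>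
  let ?c = "\<lambda>i x. (if i = 0 then 0 else c (i - 1) x) + c m x * a i x"
  show ?thesis
  proof (rule BI[of ?c])
    fix i assume i: "i < d"
    have "(\<lambda>x. if i = 0 then 0 else c (i - 1) x) \<in> A"
      using i c(1)[of "i - 1"] A_const[of 0] by (cases i) auto
    then show "?c i \<in> A"
      using c(1)[of m] m a[OF i] by (intro A_add A_mult) auto
  next
    fix x \<tau> assume x: "x \<in> U" "fam_root x \<tau>"
    have "\<tau> * F x \<tau> = (\<Sum>i<m. c i x * \<tau> ^ Suc i) + c m x * \<tau> ^ d"
      unfolding c(2)[OF x] m by (simp add: sum_distrib_left algebra_simps)
    also have "(\<Sum>i<m. c i x * \<tau> ^ Suc i) = (\<Sum>i<d. (if i = 0 then 0 else c (i - 1) x) * \<tau> ^ i)"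
      unfolding m by (subst sum.lessThan_Suc_shift) simp
    also have "\<tau> ^ d = (\<Sum>i<d. a i x * \<tau> ^ i)" using x(2) by (simp add: fam_root_def)
    finally show "\<tau> * F x \<tau> = (\<Sum>i<d. ?c i x * \<tau> ^ i)"
      by (simp add: sum.distrib sum_distrib_left algebra_simps)
  qed
qed

lemma B_const: "(\<lambda>_ _. z) \<in> B"
proof (rule BI[of "\<lambda>i x. if i = 0 then z else 0"])
  fix i :: nat show "(\<lambda>x::'a. if i = 0 then z else 0) \<in> A" using A_const by simp
next
  fix x \<tau>
  have "(\<Sum>i<d. (if i = 0 then z else 0) * \<tau> ^ i) = (\<Sum>i<d. if i = 0 then z else 0)"
    by (rule sum.cong) auto
  then show "z = (\<Sum>i<d. (if i = 0 then z else 0) * \<tau> ^ i)" using d by simp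
qed

lemma B_coeff: "f \<in> A \<Longrightarrow> (\<lambda>x _. f x) \<in> B"
  using B_scale[OF _ B_const[of 1]] by simp

lemma B_power: "F \<in> B \<Longrightarrow> (\<lambda>x \<tau>. \<tau> ^ k * F x \<tau>) \<in> B"
  by (induction k) (use B_shift in \<open>auto simp: mult.assoc\<close>)

lemma B_sum: "(\<And>i. i \<in> I \<Longrightarrow> F i \<in> B) \<Longrightarrow> (\<lambda>x \<tau>. \<Sum>i\<in>I. F i x \<tau>) \<in> B"
  by (induction I rule: infinite_finite_induct) (auto intro: B_const B_add)

lemma B_cong: "F \<in> B \<Longrightarrow> (\<And>x \<tau>. x \<in> U \<Longrightarrow> fam_root x \<tau> \<Longrightarrow> F x \<tau> = H x \<tau>) \<Longrightarrow> H \<in> B"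
  unfolding B_def by auto

lemma B_mult:
  assumes "F \<in> B" "H \<in> B"
  shows "(\<lambda>x \<tau>. F x \<tau> * H x \<tau>) \<in> B"
proof -
  obtain c where c: "\<And>i. i < d \<Longrightarrow> c i \<in> A"
    "\<And>x \<tau>. x \<in> U \<Longrightarrow> fam_root x \<tau> \<Longrightarrow> F x \<tau> = (\<Sum>i<d. c i x * \<tau> ^ i)" using BE[OF assms(1)] by metis
  have "(\<lambda>x \<tau>. \<Sum>i<d. c i x * (\<tau> ^ i * H x \<tau>)) \<in> B"
    by (intro B_sum B_scale B_power assms c(1)) auto
  then show ?thesis
    by (rule B_cong) (simp add: c(2) sum_distrib_right mult.assoc)
qed

lemma B_diff: "F \<in> B \<Longrightarrow> H \<in> B \<Longrightarrow> (\<lambda>x \<tau>. F x \<tau> - H x \<tau>) \<in> B"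
  using B_add[of F "\<lambda>x \<tau>. - 1 * H x \<tau>"] B_scale[OF A_const[of "-1"], of H] by simp

lemma B_root: "(\<lambda>_ \<tau>. \<tau>) \<in> B"
  using B_shift[OF B_const[of 1]] by simp

lemma B_expand: "(\<And>i. i < d \<Longrightarrow> c i \<in> A) \<Longrightarrow> (\<lambda>x \<tau>. \<Sum>i<d. c i x * \<tau> ^ i) \<in> B"
  by (rule BI[of c]) auto

lemma B_dchar: "(\<lambda>x \<tau>. dchar d (\<lambda>i. a i x) \<tau>) \<in> B"
proof -
  have p: "(\<lambda>x \<tau>. \<tau> ^ k) \<in> B" for k using B_power[OF B_const[of 1]] by simp
  show ?thesis
    unfolding dchar_def
    by (intro B_diff B_sum B_mult p B_const B_coeff a) auto
qed

lemma B_poly_funs: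
  assumes "h \<in> poly_funs C" "\<And>f. f \<in> C \<Longrightarrow> (\<lambda>x \<tau>. f (L x \<tau>)) \<in> B"
  shows "(\<lambda>x \<tau>. h (L x \<tau>)) \<in> B"
  using assms(1) by induction (auto intro: assms(2) B_const B_add B_mult)

text \<open>Here information passes from \<open>Y\<close> to \<open>V\<close>. Over \<open>N\<close>
  the \<open>d\<close> distinct known roots make the reduced coefficients vanish. The coefficients
  belong to \<open>A\<close>, and for such functions \<open>dense\<close> spreads vanishing from
  \<open>N\<close> to all of \<open>U\<close>, including points with no distinguished roots.\<close>

lemma B_vanish:
  assumes F: "F \<in> B"
    and N: "N \<subseteq> U" and I: "finite I" "card I = d"
    and inj: "\<And>y. y \<in> N \<Longrightarrow> inj_on (\<lambda>w. t w y) I"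
    and r: "\<And>w y. w \<in> I \<Longrightarrow> y \<in> N \<Longrightarrow> fam_root y (t w y)"
    and z: "\<And>w y. w \<in> I \<Longrightarrow> y \<in> N \<Longrightarrow> F y (t w y) = 0"
    and dense: "\<And>f x. f \<in> A \<Longrightarrow> (\<And>y. y \<in> N \<Longrightarrow> f y = 0) \<Longrightarrow> x \<in> U \<Longrightarrow> f x = 0"
    and x: "x \<in> U" "fam_root x \<tau>"
  shows "F x \<tau> = 0"
proof -
  obtain c where c: "\<And>i. i < d \<Longrightarrow> c i \<in> A"
    "\<And>x \<tau>. x \<in> U \<Longrightarrow> fam_root x \<tau> \<Longrightarrow> F x \<tau> = (\<Sum>i<d. c i x * \<tau> ^ i)" using BE[OF F] by metis
  have "c i x = 0" if i: "i < d" for i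
  proof (rule dense[OF c(1)[OF i] _ x(1)])
    fix y assume y: "y \<in> N"
    show "c i y = 0"
    proof (rule distinct_roots_coeffs_zero[OF I(1) inj[OF y]])
      fix w assume w: "w \<in> I"
      show "(\<Sum>i<card I. c i y * t w y ^ i) = 0"
        using c(2)[of y "t w y"] N y r[OF w y] z[OF w y] I(2) by auto
    qed (use i I in simp)
  qed
  then show ?thesis using c(2)[OF x] by simp
qed

end

section \<open>The quotient map restricted to a Galois slice\<close>

text \<open>All that the construction of P and L takes from the Galois restriction property:
  \<open>theta_sigma\<close> says that restrictions are invariant, \<open>theta_vanish\<close> is
  injectivity and \<open>theta_surj\<close> surjectivity. Neither \<open>G\<close> nor the quotient
  variety occurs any more. By \<open>theta_0\<close> only finitely many coordinates of \<theta> have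
  to be compared.\<close>

locale galois_slice =
  fixes Y :: "(complex ^ 'n::finite) set" and W :: "'w monoid"
    and \<sigma> :: "'w \<Rightarrow> complex ^ 'n \<Rightarrow> complex ^ 'n"
    and Y0 D1 :: "(complex ^ 'n) set" and \<theta> :: "complex ^ 'n \<Rightarrow> nat \<Rightarrow> complex" and k :: nat
    and T :: "(complex ^ 'n) topology"
  defines "T \<equiv> subtopology (zariski vcoord) Y"
  assumes closedY: "closedin (zariski vcoord) Y" and irrT: "irreducible_top T"
    and groupW: "group W" and finiteW: "finite (carrier W)"
    and Y0: "openin T Y0" "Y0 \<noteq> {}"
    and stable: "w \<in> carrier W \<Longrightarrow> y \<in> Y0 \<Longrightarrow> \<sigma> w y \<in> Y0"
    and comp: "v \<in> carrier W \<Longrightarrow> w \<in> carrier W \<Longrightarrow> y \<in> Y0 \<Longrightarrow> \<sigma> v (\<sigma> w y) = \<sigma> (v \<otimes>\<^bsub>W\<^esub> w) y"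
    and one: "y \<in> Y0 \<Longrightarrow> \<sigma> \<one>\<^bsub>W\<^esub> y = y"
    and faithful: "w \<in> carrier W \<Longrightarrow> w \<noteq> \<one>\<^bsub>W\<^esub> \<Longrightarrow> \<exists>y\<in>Y0. \<sigma> w y \<noteq> y"
    and locrat_sigma: "w \<in> carrier W \<Longrightarrow> openin T U \<Longrightarrow> locrat vcoord U f \<Longrightarrow>
      locrat vcoord {y \<in> Y0. \<sigma> w y \<in> U} (\<lambda>y. f (\<sigma> w y))"
    and open_sigma: "w \<in> carrier W \<Longrightarrow> openin T U \<Longrightarrow> openin T {y \<in> Y0. \<sigma> w y \<in> U}"
    and D1: "openin (zariski vcoord) D1" "Y \<inter> D1 \<noteq> {}"
    and locrat_theta: "p \<in> poly_funs scoord \<Longrightarrow> locrat vcoord D1 (\<lambda>x. p (\<theta> x))"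
    and theta_0: "x \<in> D1 \<Longrightarrow> k \<le> i \<Longrightarrow> \<theta> x i = 0"
    and theta_vanish: "p \<in> poly_funs scoord \<Longrightarrow> openin T N \<Longrightarrow> N \<noteq> {} \<Longrightarrow>
      (\<And>y. y \<in> N \<Longrightarrow> y \<in> D1 \<Longrightarrow> p (\<theta> y) = 0) \<Longrightarrow> x \<in> D1 \<Longrightarrow> p (\<theta> x) = 0"
    and theta_sigma: "w \<in> carrier W \<Longrightarrow> y \<in> Y0 \<Longrightarrow> y \<in> D1 \<Longrightarrow> \<sigma> w y \<in> D1 \<Longrightarrow> \<theta> (\<sigma> w y) = \<theta> y"
    and theta_surj: "openin T N \<Longrightarrow> N \<noteq> {} \<Longrightarrow> N \<subseteq> Y0 \<Longrightarrow> locrat vcoord N u \<Longrightarrow>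
      (\<And>w y. w \<in> carrier W \<Longrightarrow> y \<in> N \<Longrightarrow> \<sigma> w y \<in> N) \<Longrightarrow>
      (\<And>w y. w \<in> carrier W \<Longrightarrow> y \<in> N \<Longrightarrow> u (\<sigma> w y) = u y) \<Longrightarrow>
      \<exists>p\<in>poly_funs scoord. \<exists>q\<in>poly_funs scoord. \<exists>N'. openin T N' \<and> N' \<noteq> {} \<and> N' \<subseteq> N \<and> N' \<subseteq> D1 \<and>
        (\<forall>y\<in>N'. q (\<theta> y) \<noteq> 0 \<and> u y * q (\<theta> y) = p (\<theta> y))"
begin

sublocale group W by (rule groupW)

lemma openin_T_nonzero:
  "openin T U \<Longrightarrow> locrat vcoord U f \<Longrightarrow> openin T {x \<in> U. f x \<noteq> 0}"
  unfolding T_def by (rule openin_locrat_nonzero)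

lemma openin_T_inter: "openin (zariski vcoord) U \<Longrightarrow> openin T (Y \<inter> U)"
  unfolding T_def openin_subtopology by (metis inf_commute)

lemma Y0_sub: "Y0 \<subseteq> Y"
  using Y0(1) unfolding T_def openin_subtopology_zariski_iff by blast

lemma locrat_poly_sigma:
  assumes w: "w \<in> carrier W" and f: "f \<in> poly_funs vcoord"
  shows "locrat vcoord Y0 (\<lambda>y. f (\<sigma> w y))"
proof -
  have "{y \<in> Y0. \<sigma> w y \<in> Y0} = Y0" using stable[OF w] by blast
  then show ?thesis using locrat_sigma[OF w Y0(1) locrat_poly[OF f]] by simp
qed

section \<open>Stable open sets, a primitive element and invariant interpolation\<close>

definition stab :: "(complex ^ 'n) set \<Rightarrow> (complex ^ 'n) set" where
  "stab M = {y \<in> Y0. \<forall>w\<in>carrier W. \<sigma> w y \<in> M}"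

lemma stab_sub: "stab M \<subseteq> M"
  unfolding stab_def using one by force

lemma stab_stable: "w \<in> carrier W \<Longrightarrow> y \<in> stab M \<Longrightarrow> \<sigma> w y \<in> stab M"
  unfolding stab_def using stable comp by auto

text \<open>\<open>stab M\<close> is a finite intersection of \<open>Y0\<close> with preimages of
  \<open>M\<close>. Each preimage is nonempty because \<open>w\<close> acts bijectively on
  \<open>Y0\<close>, so irreducibility keeps the intersection nonempty.\<close>

lemma stab_open:
  assumes M: "openin T M" "M \<noteq> {}"
  shows "openin T (stab M)" "stab M \<noteq> {}"
proof -
  let ?p = "\<lambda>w. {y \<in> Y0. \<sigma> w y \<in> M}"
  have "openin T (topspace T \<inter> \<Inter>(insert Y0 (?p ` carrier W))) \<and>
      topspace T \<inter> \<Inter>(insert Y0 (?p ` carrier W)) \<noteq> {}"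
  proof (rule irreducible_top_Inter[OF irrT])
    fix A assume "A \<in> insert Y0 (?p ` carrier W)"
    then consider "A = Y0" | w where "w \<in> carrier W" "A = ?p w" by blast
    then show "openin T A \<and> A \<noteq> {}"
    proof cases
      case 2
      obtain y where y: "y \<in> M" "y \<in> Y0" using irreducible_top_inter[OF irrT M Y0] by blast
      have "\<sigma> (inv\<^bsub>W\<^esub> w) y \<in> ?p w"
        using stable[of "inv\<^bsub>W\<^esub> w" y] comp[of w "inv\<^bsub>W\<^esub> w" y] one[of y] y 2(1) by simp
      then show ?thesis using open_sigma[OF 2(1) M(1)] 2(2) by blast
    qed (use Y0 in simp)
  qed (use finiteW in simp)
  moreover have "topspace T \<inter> \<Inter>(insert Y0 (?p ` carrier W)) = stab M"
    using openin_subset[OF Y0(1)] by (auto simp: stab_def)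
  ultimately show "openin T (stab M)" "stab M \<noteq> {}" by auto
qed

text \<open>For a pair \<open>v \<noteq> w\<close>, faithfulness gives a point moved by
  \<open>inv v\<close> times \<open>w\<close>, so its translates by \<open>v\<close> and
  \<open>w\<close> differ. Irreducibility merges these finitely many open conditions into one
  point.\<close>

lemma separating_point:
  obtains y where "y \<in> Y0" "inj_on (\<lambda>w. \<sigma> w y) (carrier W)"
proof -
  let ?P = "{(v, w) \<in> carrier W \<times> carrier W. v \<noteq> w}"
  let ?M = "\<lambda>(v, w). {y \<in> Y0. \<sigma> v y \<noteq> \<sigma> w y}"
  have "openin T (topspace T \<inter> \<Inter>(insert Y0 (?M ` ?P))) \<and> topspace T \<inter> \<Inter>(insert Y0 (?M ` ?P)) \<noteq> {}"
  proof (rule irreducible_top_Inter[OF irrT])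
    have "finite ?P" by (rule finite_subset[of _ "carrier W \<times> carrier W"]) (use finiteW in auto)
    then show "finite (insert Y0 (?M ` ?P))" by simp
    fix A assume "A \<in> insert Y0 (?M ` ?P)"
    then consider "A = Y0" | v w where "v \<in> carrier W" "w \<in> carrier W" "v \<noteq> w" "A = ?M (v, w)" by blast
    then show "openin T A \<and> A \<noteq> {}"
    proof cases
      case 2
      have "A = (\<Union>j. {y \<in> Y0. \<sigma> v y $ j - \<sigma> w y $ j \<noteq> 0})"
        unfolding 2(4) by (auto simp: vec_eq_iff)
      moreover have "openin T {y \<in> Y0. \<sigma> v y $ j - \<sigma> w y $ j \<noteq> 0}" for j
        by (intro openin_T_nonzero Y0 locrat_diff locrat_poly_sigma[of _ "\<lambda>v. v $ j"] poly_funs.coord 2) auto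
      ultimately have "openin T A" by auto
      moreover have "inv\<^bsub>W\<^esub> v \<otimes>\<^bsub>W\<^esub> w \<noteq> \<one>\<^bsub>W\<^esub>"
        using 2 by (metis inv_closed inv_equality inv_inv)
      then obtain y where y: "y \<in> Y0" "\<sigma> (inv\<^bsub>W\<^esub> v \<otimes>\<^bsub>W\<^esub> w) y \<noteq> y"
        using faithful[of "inv\<^bsub>W\<^esub> v \<otimes>\<^bsub>W\<^esub> w"] 2 by auto
      have "\<sigma> v y \<noteq> \<sigma> w y"
      proof
        assume "\<sigma> v y = \<sigma> w y"
        then have "\<sigma> (inv\<^bsub>W\<^esub> v \<otimes>\<^bsub>W\<^esub> v) y = \<sigma> (inv\<^bsub>W\<^esub> v \<otimes>\<^bsub>W\<^esub> w) y"
          using comp[of "inv\<^bsub>W\<^esub> v" v y] comp[of "inv\<^bsub>W\<^esub> v" w y] 2 y(1) by simp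
        then show False using y one 2 by simp
      qed
      then have "A \<noteq> {}" using y 2 by auto
      ultimately show ?thesis by blast
    qed (use Y0 in simp)
  qed
  then obtain y where "y \<in> Y0" "\<And>v w. v \<in> carrier W \<Longrightarrow> w \<in> carrier W \<Longrightarrow> v \<noteq> w \<Longrightarrow> \<sigma> v y \<noteq> \<sigma> w y"
    by fastforce
  then show thesis by (intro that[of y]) (auto simp: inj_on_def)
qed

text \<open>It suffices to separate the translates of a single point \<open>z\<close>. Separation of
  translates is the nonvanishing of \<open>?d\<close>, up to sign the discriminant of the conjugates
  of \<open>t\<close>, and so holds on an open set.\<close>

lemma primitive_element:
  obtains t M where "t \<in> poly_funs vcoord" "openin T M" "M \<noteq> {}" "M \<subseteq> Y0"
    "\<And>y. y \<in> M \<Longrightarrow> inj_on (\<lambda>w. t (\<sigma> w y)) (carrier W)"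
proof -
  obtain z where z: "z \<in> Y0" "inj_on (\<lambda>w. \<sigma> w z) (carrier W)" using separating_point .
  obtain t where t: "t \<in> poly_funs vcoord" "inj_on t ((\<lambda>w. \<sigma> w z) ` carrier W)"
    using separating_poly[of "(\<lambda>w. \<sigma> w z) ` carrier W"] finiteW by blast
  let ?P = "{(v, w) \<in> carrier W \<times> carrier W. v \<noteq> w}"
  have fP: "finite ?P" by (rule finite_subset[of _ "carrier W \<times> carrier W"]) (use finiteW in auto)
  let ?d = "\<lambda>y. \<Prod>p\<in>?P. t (\<sigma> (fst p) y) - t (\<sigma> (snd p) y)"
  have d: "?d y \<noteq> 0 \<longleftrightarrow> inj_on (\<lambda>w. t (\<sigma> w y)) (carrier W)" for y
    using fP by (auto simp: inj_on_def)
  have "openin T {y \<in> Y0. ?d y \<noteq> 0}"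
    by (intro openin_T_nonzero Y0 locrat_prod locrat_diff locrat_poly_sigma t) auto
  moreover have "inj_on (\<lambda>w. t (\<sigma> w z)) (carrier W)"
    using comp_inj_on[OF z(2) t(2)] by (simp add: comp_def)
  then have "z \<in> {y \<in> Y0. ?d y \<noteq> 0}" using z(1) d by blast
  ultimately show thesis
    by (intro that[of t "{y \<in> Y0. ?d y \<noteq> 0}"] t) (use d in auto)
qed

text \<open>At \<open>y\<close>, the values of \<open>u\<close> at all translates of
  \<open>y\<close> are interpolated at the nodes \<open>t (\<sigma> w y)\<close>. Replacing
  \<open>y\<close> by a translate multiplies the labels by a fixed group element on the right, which
  merely permutes the nodes together with their values.\<close>

lemma galois_interpolation:
  assumes N: "N \<subseteq> Y0" and st: "\<And>w y. w \<in> carrier W \<Longrightarrow> y \<in> N \<Longrightarrow> \<sigma> w y \<in> N"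
    and oN: "openin T N"
    and t: "t \<in> poly_funs vcoord" and inj: "\<And>y. y \<in> N \<Longrightarrow> inj_on (\<lambda>w. t (\<sigma> w y)) (carrier W)"
    and u: "locrat vcoord N u"
  obtains c :: "nat \<Rightarrow> complex ^ 'n \<Rightarrow> complex" where "\<And>i. locrat vcoord N (c i)"
    "\<And>i w y. w \<in> carrier W \<Longrightarrow> y \<in> N \<Longrightarrow> c i (\<sigma> w y) = c i y"
    "\<And>w y. w \<in> carrier W \<Longrightarrow> y \<in> N \<Longrightarrow>
       (\<Sum>i<order W. c i y * t (\<sigma> w y) ^ i) = u (\<sigma> w y)"
proof -
  let ?p = "\<lambda>y. lagrange (carrier W) (\<lambda>w. t (\<sigma> w y)) (\<lambda>w. u (\<sigma> w y))"
  have W0: "carrier W \<noteq> {}" by auto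
  have lt: "locrat vcoord N (\<lambda>y. t (\<sigma> w y))" if "w \<in> carrier W" for w
    using locrat_mono[OF locrat_poly_sigma[OF that t] N] .
  have lu: "locrat vcoord N (\<lambda>y. u (\<sigma> w y))" if w: "w \<in> carrier W" for w
    using locrat_mono[OF locrat_sigma[OF w oN u], of N] N st[OF w] by blast
  show thesis
  proof (rule that[of "\<lambda>i y. coeff (?p y) i"])
    show "locrat vcoord N (\<lambda>y. coeff (?p y) i)" for i
      by (rule locrat_coeff_lagrange[OF finiteW lt lu inj])
  next
    fix i v y assume v: "v \<in> carrier W" and y: "y \<in> N"
    have y0: "y \<in> Y0" using y N by blast
    have "?p (\<sigma> v y) = lagrange (carrier W) (\<lambda>w. t (\<sigma> (w \<otimes>\<^bsub>W\<^esub> v) y)) (\<lambda>w. u (\<sigma> (w \<otimes>\<^bsub>W\<^esub> v) y))"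
      by (rule lagrange_cong) (simp_all add: comp[OF _ v y0])
    also have "\<dots> = ?p y"
    proof (rule lagrange_reindex[of "\<lambda>w. w \<otimes>\<^bsub>W\<^esub> v" "carrier W" "\<lambda>w. t (\<sigma> w y)" "\<lambda>w. u (\<sigma> w y)"])
      show "bij_betw (\<lambda>w. w \<otimes>\<^bsub>W\<^esub> v) (carrier W) (carrier W)"
        by (rule bij_betw_byWitness[of _ "\<lambda>w. w \<otimes>\<^bsub>W\<^esub> inv\<^bsub>W\<^esub> v"]) (use v in \<open>auto simp: m_assoc\<close>)
    qed
    finally show "coeff (?p (\<sigma> v y)) i = coeff (?p y) i" by simp
  next
    fix w y assume w: "w \<in> carrier W" and y: "y \<in> N"
    show "(\<Sum>i<order W. coeff (?p y) i * t (\<sigma> w y) ^ i) = u (\<sigma> w y)"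
      using poly_lagrange[OF finiteW inj[OF y] w, of "\<lambda>w. u (\<sigma> w y)"]
        poly_as_sum[OF degree_lagrange[OF finiteW W0], of "\<lambda>w. t (\<sigma> w y)" "\<lambda>w. u (\<sigma> w y)" "t (\<sigma> w y)"]
      unfolding order_def by simp
  qed
qed

text \<open>One fraction in \<theta> has to serve on all of \<open>U\<close>, with a denominator
  that has no zero there. Vanishing of its numerator, a polynomial in \<theta>, then controls
  \<open>f\<close> on the whole of \<open>U\<close> at once.\<close>

definition quot_alg :: "(complex ^ 'n) set \<Rightarrow> (complex ^ 'n \<Rightarrow> complex) set" where
  "quot_alg U = {f. \<exists>p\<in>poly_funs scoord. \<exists>e\<in>poly_funs scoord.
     \<forall>x\<in>U. e (\<theta> x) \<noteq> 0 \<and> f x * e (\<theta> x) = p (\<theta> x)}"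

lemma quot_algI:
  "p \<in> poly_funs scoord \<Longrightarrow> e \<in> poly_funs scoord \<Longrightarrow>
   (\<And>x. x \<in> U \<Longrightarrow> e (\<theta> x) \<noteq> 0) \<Longrightarrow> (\<And>x. x \<in> U \<Longrightarrow> f x * e (\<theta> x) = p (\<theta> x)) \<Longrightarrow> f \<in> quot_alg U"
  unfolding quot_alg_def by blast

lemma quot_algE:
  assumes "f \<in> quot_alg U"
  obtains p e where "p \<in> poly_funs scoord" "e \<in> poly_funs scoord"
    "\<forall>x\<in>U. e (\<theta> x) \<noteq> 0 \<and> f x * e (\<theta> x) = p (\<theta> x)"
  using assms unfolding quot_alg_def by blast

lemma quot_alg_mono: "f \<in> quot_alg U \<Longrightarrow> V \<subseteq> U \<Longrightarrow> f \<in> quot_alg V"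
  unfolding quot_alg_def by blast

lemma quot_alg_poly: "p \<in> poly_funs scoord \<Longrightarrow> (\<lambda>x. p (\<theta> x)) \<in> quot_alg U"
  by (rule quot_algI[of p "\<lambda>_. 1"]) (auto intro: poly_funs.const)

lemma quot_alg_const: "(\<lambda>_. z) \<in> quot_alg U"
  using quot_alg_poly[OF poly_funs.const] .

lemma quot_alg_add:
  assumes "f \<in> quot_alg U" "g \<in> quot_alg U"
  shows "(\<lambda>x. f x + g x) \<in> quot_alg U"
proof -
  obtain p e where 1: "p \<in> poly_funs scoord" "e \<in> poly_funs scoord"
    "\<forall>x\<in>U. e (\<theta> x) \<noteq> 0 \<and> f x * e (\<theta> x) = p (\<theta> x)" using quot_algE[OF assms(1)] .
  obtain p' e' where 2: "p' \<in> poly_funs scoord" "e' \<in> poly_funs scoord"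
    "\<forall>x\<in>U. e' (\<theta> x) \<noteq> 0 \<and> g x * e' (\<theta> x) = p' (\<theta> x)" using quot_algE[OF assms(2)] .
  show ?thesis
  proof (rule quot_algI[of "\<lambda>s. p s * e' s + p' s * e s" "\<lambda>s. e s * e' s"])
    fix x assume x: "x \<in> U"
    have *: "f x * e (\<theta> x) = p (\<theta> x)" "g x * e' (\<theta> x) = p' (\<theta> x)" using 1 2 x by auto
    then show "(f x + g x) * (e (\<theta> x) * e' (\<theta> x)) = p (\<theta> x) * e' (\<theta> x) + p' (\<theta> x) * e (\<theta> x)"
      by (simp add: algebra_simps flip: *)
  qed (use 1 2 in \<open>auto intro!: poly_funs.add poly_funs.mult\<close>)
qed

lemma quot_alg_mult:
  assumes "f \<in> quot_alg U" "g \<in> quot_alg U"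
  shows "(\<lambda>x. f x * g x) \<in> quot_alg U"
proof -
  obtain p e where 1: "p \<in> poly_funs scoord" "e \<in> poly_funs scoord"
    "\<forall>x\<in>U. e (\<theta> x) \<noteq> 0 \<and> f x * e (\<theta> x) = p (\<theta> x)" using quot_algE[OF assms(1)] .
  obtain p' e' where 2: "p' \<in> poly_funs scoord" "e' \<in> poly_funs scoord"
    "\<forall>x\<in>U. e' (\<theta> x) \<noteq> 0 \<and> g x * e' (\<theta> x) = p' (\<theta> x)" using quot_algE[OF assms(2)] .
  show ?thesis
  proof (rule quot_algI[of "\<lambda>s. p s * p' s" "\<lambda>s. e s * e' s"])
    fix x assume x: "x \<in> U"
    have *: "f x * e (\<theta> x) = p (\<theta> x)" "g x * e' (\<theta> x) = p' (\<theta> x)" using 1 2 x by auto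
    then show "(f x * g x) * (e (\<theta> x) * e' (\<theta> x)) = p (\<theta> x) * p' (\<theta> x)"
      by (simp add: algebra_simps flip: *)
  qed (use 1 2 in \<open>auto intro!: poly_funs.mult\<close>)
qed

lemma quot_alg_eq:
  assumes "f \<in> quot_alg U" "x \<in> U" "x' \<in> U" "\<theta> x = \<theta> x'"
  shows "f x = f x'"
proof -
  obtain p e where "p \<in> poly_funs scoord" "e \<in> poly_funs scoord"
    "\<forall>x\<in>U. e (\<theta> x) \<noteq> 0 \<and> f x * e (\<theta> x) = p (\<theta> x)" using quot_algE[OF assms(1)] .
  then have "f x * e (\<theta> x) = f x' * e (\<theta> x)" "e (\<theta> x) \<noteq> 0" using assms(2-4) by auto
  then show ?thesis by simp
qed

lemma quot_alg_locrat:
  assumes "f \<in> quot_alg U" "U \<subseteq> D1"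
  shows "locrat vcoord U f"
proof -
  obtain p e where 1: "p \<in> poly_funs scoord" "e \<in> poly_funs scoord"
    "\<forall>x\<in>U. e (\<theta> x) \<noteq> 0 \<and> f x * e (\<theta> x) = p (\<theta> x)" using quot_algE[OF assms(1)] .
  have "locrat vcoord U (\<lambda>x. p (\<theta> x) / e (\<theta> x))"
    by (intro locrat_divide locrat_mono[OF locrat_theta] assms(2)) (use 1 in auto)
  then show ?thesis
    by (rule locrat_cong) (use 1 in \<open>auto simp: divide_eq_eq\<close>)
qed

text \<open>This supplies the assumption \<open>dense\<close> of \<open>B_vanish\<close>: although
  \<open>N\<close> lies in \<open>Y\<close>, the conclusion reaches every point of \<open>U\<close>,
  since the numerator falls under \<open>theta_vanish\<close>.\<close>

lemma quot_alg_vanish: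
  assumes "f \<in> quot_alg U" "U \<subseteq> D1" "openin T N" "N \<noteq> {}" "N \<subseteq> U" "\<And>y. y \<in> N \<Longrightarrow> f y = 0" "x \<in> U"
  shows "f x = 0"
proof -
  obtain p e where 1: "p \<in> poly_funs scoord" "e \<in> poly_funs scoord"
    "\<forall>x\<in>U. e (\<theta> x) \<noteq> 0 \<and> f x * e (\<theta> x) = p (\<theta> x)" using quot_algE[OF assms(1)] .
  have "p (\<theta> y) = 0" if "y \<in> N" for y
    using 1(3) assms(5,6) that by force
  then have "p (\<theta> x) = 0" using theta_vanish[OF 1(1) assms(3,4)] assms(2,7) by blast
  then show ?thesis using 1(3) assms(7) by fastforce
qed

text \<open>The denominators of the finitely many lifts are inverted on \<open>U\<close>.\<close>

lemma lift_invariants: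
  assumes N: "openin T N" "N \<noteq> {}" "N \<subseteq> Y0" and st: "\<And>w y. w \<in> carrier W \<Longrightarrow> y \<in> N \<Longrightarrow> \<sigma> w y \<in> N"
    and fin: "finite \<F>"
    and F: "\<forall>f\<in>\<F>. locrat vcoord N f \<and> (\<forall>w\<in>carrier W. \<forall>y\<in>N. f (\<sigma> w y) = f y)"
  shows "\<exists>U N'. openin (zariski vcoord) U \<and> U \<subseteq> D1 \<and> openin T N' \<and> N' \<noteq> {} \<and> N' \<subseteq> N \<inter> U \<and>
    (\<forall>x\<in>U. \<forall>x'\<in>D1. \<theta> x' = \<theta> x \<longrightarrow> x' \<in> U) \<and>
    (\<forall>f\<in>\<F>. \<exists>g\<in>quot_alg U. \<forall>y\<in>N'. g y = f y)"
  using fin F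
proof (induction \<F>)
  case empty
  have o: "openin T (Y \<inter> D1)" by (rule openin_T_inter[OF D1(1)])
  have "openin T (N \<inter> (Y \<inter> D1))" "N \<inter> (Y \<inter> D1) \<noteq> {}"
    using N o irreducible_top_inter[OF irrT N(1,2) o D1(2)] by auto
  then show ?case using D1(1)
    by - (rule exI[of _ D1], rule exI[of _ "N \<inter> (Y \<inter> D1)"], auto)
next
  case (insert f \<F>)
  have "\<forall>g\<in>\<F>. locrat vcoord N g \<and> (\<forall>w\<in>carrier W. \<forall>y\<in>N. g (\<sigma> w y) = g y)"
    using insert.prems by blast
  from insert.IH[OF this] obtain U N' where U: "openin (zariski vcoord) U" "U \<subseteq> D1" "openin T N'" "N' \<noteq> {}" "N' \<subseteq> N \<inter> U"
    "\<forall>x\<in>U. \<forall>x'\<in>D1. \<theta> x' = \<theta> x \<longrightarrow> x' \<in> U" "\<forall>f\<in>\<F>. \<exists>g\<in>quot_alg U. \<forall>y\<in>N'. g y = f y"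
    by (elim exE conjE) (rule that)
  have "\<exists>p\<in>poly_funs scoord. \<exists>q\<in>poly_funs scoord. \<exists>N'. openin T N' \<and> N' \<noteq> {} \<and> N' \<subseteq> N \<and> N' \<subseteq> D1 \<and>
      (\<forall>y\<in>N'. q (\<theta> y) \<noteq> 0 \<and> f y * q (\<theta> y) = p (\<theta> y))"
    by (rule theta_surj[OF N]) (use st insert.prems in auto)
  then obtain p q M where M: "p \<in> poly_funs scoord" "q \<in> poly_funs scoord" "openin T M" "M \<noteq> {}" "M \<subseteq> N" "M \<subseteq> D1"
    "\<forall>y\<in>M. q (\<theta> y) \<noteq> 0 \<and> f y * q (\<theta> y) = p (\<theta> y)"
    by (elim bexE exE conjE) (rule that)
  \<comment> \<open>Shrinking by a condition on \<theta> alone keeps the set saturated, a union of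
    full fibres of \<theta> in \<open>D1\<close>.\<close>
  let ?V = "{x \<in> U. q (\<theta> x) \<noteq> 0}"
  have "openin (subtopology (zariski vcoord) UNIV) ?V"
    by (rule openin_locrat_nonzero) (use U locrat_mono[OF locrat_theta[OF M(2)]] in auto)
  then have V: "openin (zariski vcoord) ?V" by simp
  show ?case
  proof (rule exI[of _ ?V], rule exI[of _ "N' \<inter> M"], intro conjI V)
    show "openin T (N' \<inter> M)" "N' \<inter> M \<noteq> {}"
      using U M irreducible_top_inter[OF irrT U(3,4) M(3,4)] by auto
    show "\<forall>f\<in>insert f \<F>. \<exists>g\<in>quot_alg ?V. \<forall>y\<in>N' \<inter> M. g y = f y"
    proof
      fix h assume "h \<in> insert f \<F>"
      then consider "h = f" | "h \<in> \<F>" by blast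
      then show "\<exists>g\<in>quot_alg ?V. \<forall>y\<in>N' \<inter> M. g y = h y"
      proof cases
        case 1
        have "(\<lambda>x. p (\<theta> x) / q (\<theta> x)) \<in> quot_alg ?V"
          by (rule quot_algI[OF M(1,2)]) auto
        then show ?thesis unfolding 1
          by (rule bexI[rotated]) (use M(7) in \<open>auto simp: divide_eq_eq\<close>)
      next
        case 2
        then obtain g where "g \<in> quot_alg U" "\<forall>y\<in>N'. g y = h y" using U(7) by blast
        then show ?thesis
          by (intro bexI[of _ g]) (auto elim!: quot_alg_mono)
      qed
    qed
  qed (use U M in auto)
qed

text \<open>\<theta> will be evaluated at L(x, T), but only polynomials can be composed with L
  inside \<open>B\<close>. Hence \<theta> is written with polynomial numerators and denominators,
  all valid where a single polynomial \<open>b\<close> is nonzero.\<close>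

lemma theta_local:
  obtains b a e where "b \<in> poly_funs vcoord" "\<exists>y\<in>Y. b y \<noteq> 0" "\<And>x. b x \<noteq> 0 \<Longrightarrow> x \<in> D1"
    "\<And>i. i < k \<Longrightarrow> a i \<in> poly_funs vcoord" "\<And>i. i < k \<Longrightarrow> e i \<in> poly_funs vcoord"
    "\<And>i x. i < k \<Longrightarrow> b x \<noteq> 0 \<Longrightarrow> e i x \<noteq> 0 \<and> \<theta> x i * e i x = a i x"
proof -
  obtain z where z: "z \<in> Y" "z \<in> D1" using D1(2) by blast
  obtain r where r: "r \<in> poly_funs vcoord" "r z \<noteq> 0" "{y. r y \<noteq> 0} \<subseteq> D1"
    using D1(1) z(2) unfolding openin_zariski_iff by blast
  have "\<exists>p q. p \<in> poly_funs vcoord \<and> q \<in> poly_funs vcoord \<and> q z \<noteq> 0 \<and> (\<forall>y\<in>D1. q y \<noteq> 0 \<longrightarrow> \<theta> y i = p y / q y)" for i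
  proof -
    have "locrat vcoord D1 (\<lambda>x. \<theta> x i)" using locrat_theta[OF poly_funs.coord[of "\<lambda>x. x i"]] by auto
    from locratE[OF this z(2)] show ?thesis by metis
  qed
  then obtain a e where ae: "\<And>i. a i \<in> poly_funs vcoord" "\<And>i. e i \<in> poly_funs vcoord" "\<And>i. e i z \<noteq> 0"
    "\<And>i y. y \<in> D1 \<Longrightarrow> e i y \<noteq> 0 \<Longrightarrow> \<theta> y i = a i y / e i y" by metis
  show thesis
  proof (rule that[of "\<lambda>x. r x * (\<Prod>i<k. e i x)" a e])
    show "(\<lambda>x. r x * (\<Prod>i<k. e i x)) \<in> poly_funs vcoord"
      by (intro poly_funs.mult poly_funs_prod r ae)
    show "\<exists>y\<in>Y. r y * (\<Prod>i<k. e i y) \<noteq> 0" using z r ae by (intro bexI[of _ z]) auto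
  next
    fix i x assume "i < k" "r x * (\<Prod>i<k. e i x) \<noteq> 0"
    then have "x \<in> D1" "e i x \<noteq> 0" using r by auto
    then show "e i x \<noteq> 0 \<and> \<theta> x i * e i x = a i x" using ae(4) by simp
  qed (use r ae in auto)
qed

text \<open>Membership in \<open>Y\<close>, the value of \<theta> and the value of \<open>t\<close>
  at L(x, T) are equations and can be tested on \<open>Y\<close>. The conditions of lying in
  \<open>D1\<close> and of being a simple root are inequalities; each is turned into an equation by
  lifting an interpolant of an inverse as well.\<close>

theorem root_cover:
  obtains U d t and a :: "nat \<Rightarrow> complex ^ 'n \<Rightarrow> complex" and l :: "'n \<Rightarrow> nat \<Rightarrow> complex ^ 'n \<Rightarrow> complex"
  where "openin (zariski vcoord) U" "U \<subseteq> D1" "U \<noteq> {}"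
    "\<And>x x'. x \<in> U \<Longrightarrow> x' \<in> D1 \<Longrightarrow> \<theta> x' = \<theta> x \<Longrightarrow> x' \<in> U"
    "0 < d" "t \<in> poly_funs vcoord"
    "\<And>i. i < d \<Longrightarrow> locrat vcoord U (a i)" "\<And>j i. i < d \<Longrightarrow> locrat vcoord U (l j i)"
    "\<And>i x x'. i < d \<Longrightarrow> x \<in> U \<Longrightarrow> x' \<in> U \<Longrightarrow> \<theta> x = \<theta> x' \<Longrightarrow> a i x = a i x'"
    "\<And>j i x x'. i < d \<Longrightarrow> x \<in> U \<Longrightarrow> x' \<in> U \<Longrightarrow> \<theta> x = \<theta> x' \<Longrightarrow> l j i x = l j i x'"
    "\<And>x \<tau>. x \<in> U \<Longrightarrow> \<tau> ^ d = (\<Sum>i<d. a i x * \<tau> ^ i) \<Longrightarrow> dchar d (\<lambda>i. a i x) \<tau> \<noteq> 0"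
    "\<And>x \<tau> y. x \<in> U \<Longrightarrow> \<tau> ^ d = (\<Sum>i<d. a i x * \<tau> ^ i) \<Longrightarrow> y = (\<chi> j. \<Sum>i<d. l j i x * \<tau> ^ i) \<Longrightarrow>
       y \<in> Y \<and> y \<in> D1 \<and> \<theta> y = \<theta> x \<and> t y = \<tau>"
    "\<And>y. y \<in> Y \<Longrightarrow> y \<in> U \<Longrightarrow> t y ^ d = (\<Sum>i<d. a i y * t y ^ i) \<and> (\<chi> j. \<Sum>i<d. l j i y * t y ^ i) = y"
proof -
  let ?I = "carrier W"
  define d where "d = order W"
  have dI: "card ?I = d" by (simp add: d_def order_def)
  have d0: "0 < d" using finiteW by (auto simp: dI[symmetric] card_gt_0_iff)
  obtain t M where t: "t \<in> poly_funs vcoord" "openin T M" "M \<noteq> {}" "M \<subseteq> Y0"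
    "\<And>y. y \<in> M \<Longrightarrow> inj_on (\<lambda>w. t (\<sigma> w y)) ?I"
    by (rule primitive_element) (rule that)
  obtain b n e where b: "b \<in> poly_funs vcoord" "\<exists>y\<in>Y. b y \<noteq> 0" "\<And>x. b x \<noteq> 0 \<Longrightarrow> x \<in> D1"
    and ne: "\<And>i. i < k \<Longrightarrow> n i \<in> poly_funs vcoord" "\<And>i. i < k \<Longrightarrow> e i \<in> poly_funs vcoord"
    "\<And>i x. i < k \<Longrightarrow> b x \<noteq> 0 \<Longrightarrow> e i x \<noteq> 0 \<and> \<theta> x i * e i x = n i x"
    by (rule theta_local) (rule that)
  define M' where "M' = {y \<in> M. b y \<noteq> 0}"
  have M': "openin T M'" unfolding M'_def by (intro openin_T_nonzero t locrat_poly b)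
  have oY: "openin T Y" unfolding T_def openin_subtopology_zariski_iff
    by (auto intro!: bexI[of _ "\<lambda>_. 1"] poly_funs.const)
  have "M \<inter> {y \<in> Y. b y \<noteq> 0} \<noteq> {}"
    using b(2) by (intro irreducible_top_inter[OF irrT t(2,3)] openin_T_nonzero oY locrat_poly b) auto
  then have M'0: "M' \<noteq> {}" unfolding M'_def by auto
  \<comment> \<open>Stability gives \<open>b \<noteq> 0\<close> and separation by \<open>t\<close>
    at all translates of a point simultaneously.\<close>
  define N where "N = stab M'"
  have N: "openin T N" "N \<noteq> {}" using stab_open[OF M' M'0] by (auto simp: N_def)
  have NM: "N \<subseteq> M'" using stab_sub by (simp add: N_def)
  then have NY0: "N \<subseteq> Y0" using t(4) by (auto simp: M'_def)
  have st: "\<sigma> w y \<in> N" if "w \<in> ?I" "y \<in> N" for w y using stab_stable that by (simp add: N_def)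
  have inj: "inj_on (\<lambda>w. t (\<sigma> w y)) ?I" if "y \<in> N" for y
    using that NM t(5) by (auto simp: M'_def)
  have bN: "b y \<noteq> 0" if "y \<in> N" for y using that NM by (auto simp: M'_def)
  have interp: "\<exists>c. (\<forall>i. locrat vcoord N (c i)) \<and> (\<forall>i. \<forall>w\<in>?I. \<forall>y\<in>N. c i (\<sigma> w y) = c i y) \<and>
      (\<forall>w\<in>?I. \<forall>y\<in>N. (\<Sum>i<d. c i y * t (\<sigma> w y) ^ i) = u (\<sigma> w y))" if u: "locrat vcoord N u" for u
  proof -
    obtain c where "\<And>i. locrat vcoord N (c i)"
      "\<And>i w y. w \<in> ?I \<Longrightarrow> y \<in> N \<Longrightarrow> c i (\<sigma> w y) = c i y"
      "\<And>w y. w \<in> ?I \<Longrightarrow> y \<in> N \<Longrightarrow> (\<Sum>i<order W. c i y * t (\<sigma> w y) ^ i) = u (\<sigma> w y)"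
      by (rule galois_interpolation[OF NY0 st N(1) t(1) inj u]) auto
    then show ?thesis unfolding d_def by blast
  qed
  obtain ca where ca: "\<forall>i. locrat vcoord N (ca i)" "\<forall>i. \<forall>w\<in>?I. \<forall>y\<in>N. ca i (\<sigma> w y) = ca i y"
      "\<forall>w\<in>?I. \<forall>y\<in>N. (\<Sum>i<d. ca i y * t (\<sigma> w y) ^ i) = t (\<sigma> w y) ^ d"
    using interp[of "\<lambda>y. t y ^ d"] locrat_power[OF locrat_poly[OF t(1)]] by blast
  have "\<forall>j. \<exists>c. (\<forall>i. locrat vcoord N (c i)) \<and> (\<forall>i. \<forall>w\<in>?I. \<forall>y\<in>N. c i (\<sigma> w y) = c i y) \<and>
      (\<forall>w\<in>?I. \<forall>y\<in>N. (\<Sum>i<d. c i y * t (\<sigma> w y) ^ i) = \<sigma> w y $ j)"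
    by (intro allI interp locrat_poly poly_funs.coord) auto
  then obtain cl where cl: "\<forall>j. (\<forall>i. locrat vcoord N (cl j i)) \<and> (\<forall>i. \<forall>w\<in>?I. \<forall>y\<in>N. cl j i (\<sigma> w y) = cl j i y) \<and>
      (\<forall>w\<in>?I. \<forall>y\<in>N. (\<Sum>i<d. cl j i y * t (\<sigma> w y) ^ i) = \<sigma> w y $ j)"
    unfolding choice_iff by (elim exE)
  \<comment> \<open>An interpolant of \<open>1 / b\<close>: the relation that its product with
    \<open>b\<close> is 1 will keep L(x, T) where \<open>b\<close> is nonzero, hence in
    \<open>D1\<close>.\<close>
  obtain cb where cb: "\<forall>i. locrat vcoord N (cb i)" "\<forall>i. \<forall>w\<in>?I. \<forall>y\<in>N. cb i (\<sigma> w y) = cb i y"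
      "\<forall>w\<in>?I. \<forall>y\<in>N. (\<Sum>i<d. cb i y * t (\<sigma> w y) ^ i) = inverse (b (\<sigma> w y))"
    using interp[of "\<lambda>y. inverse (b y)"] locrat_inverse[OF locrat_poly[OF b(1)] bN] by blast
  have dca: "dchar d (\<lambda>i. ca i y) (t y) \<noteq> 0" if y: "y \<in> N" for y
  proof -
    have "dchar (card ?I) (\<lambda>i. ca i y) (t (\<sigma> \<one>\<^bsub>W\<^esub> y)) \<noteq> 0"
      by (rule dchar_nonzero[OF finiteW inj[OF y]]) (use ca(3) y dI in auto)
    then show ?thesis using one[of y] NY0 y dI by auto
  qed
  have ldca: "locrat vcoord N (\<lambda>y. dchar d (\<lambda>i. ca i y) (t y))"
    unfolding dchar_def
    by (intro locrat_diff locrat_sum locrat_mult locrat_power locrat_const locrat_poly[OF t(1)] ca(1)[rule_format])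
  \<comment> \<open>An interpolant of the inverse derivative, which will show all roots over
    \<open>U\<close> to be simple.\<close>
  obtain cs where cs: "\<forall>i. locrat vcoord N (cs i)" "\<forall>i. \<forall>w\<in>?I. \<forall>y\<in>N. cs i (\<sigma> w y) = cs i y"
      "\<forall>w\<in>?I. \<forall>y\<in>N. (\<Sum>i<d. cs i y * t (\<sigma> w y) ^ i) =
         inverse (dchar d (\<lambda>i. ca i (\<sigma> w y)) (t (\<sigma> w y)))"
    using interp[of "\<lambda>y. inverse (dchar d (\<lambda>i. ca i y) (t y))"] locrat_inverse[OF ldca dca] by blast
  define \<F> where "\<F> = ca ` {..<d} \<union> (\<Union>j. cl j ` {..<d}) \<union> cb ` {..<d} \<union> cs ` {..<d}"
  have "\<exists>U N'. openin (zariski vcoord) U \<and> U \<subseteq> D1 \<and> openin T N' \<and> N' \<noteq> {} \<and> N' \<subseteq> N \<inter> U \<and>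
    (\<forall>x\<in>U. \<forall>x'\<in>D1. \<theta> x' = \<theta> x \<longrightarrow> x' \<in> U) \<and>
    (\<forall>f\<in>\<F>. \<exists>g\<in>quot_alg U. \<forall>y\<in>N'. g y = f y)"
  proof (rule lift_invariants[OF N NY0 st])
    show "finite \<F>" by (simp add: \<F>_def)
    show "\<forall>f\<in>\<F>. locrat vcoord N f \<and> (\<forall>w\<in>?I. \<forall>y\<in>N. f (\<sigma> w y) = f y)"
      unfolding \<F>_def using ca(1,2) cl cb(1,2) cs(1,2) by auto
  qed
  then obtain U N' where U: "openin (zariski vcoord) U" "U \<subseteq> D1"
    and N': "openin T N'" "N' \<noteq> {}" "N' \<subseteq> N \<inter> U"
    and satU: "\<forall>x\<in>U. \<forall>x'\<in>D1. \<theta> x' = \<theta> x \<longrightarrow> x' \<in> U"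
    and lift: "\<forall>f\<in>\<F>. \<exists>g\<in>quot_alg U. \<forall>y\<in>N'. g y = f y"
    by (elim exE conjE) (rule that)
  obtain g where g: "\<forall>f\<in>\<F>. g f \<in> quot_alg U \<and> (\<forall>y\<in>N'. g f y = f y)"
    using lift unfolding Bex_def bchoice_iff by (elim exE conjE) (rule that)
  define a where "a i = g (ca i)" for i
  define l where "l j i = g (cl j i)" for j i
  define m where "m i = g (cb i)" for i
  define s where "s i = g (cs i)" for i
  have A: "a i \<in> quot_alg U" "l j i \<in> quot_alg U" "m i \<in> quot_alg U" "s i \<in> quot_alg U" if "i < d" for i j
    using g that unfolding \<F>_def a_def l_def m_def s_def by auto
  have eq: "a i y = ca i y" "l j i y = cl j i y" "m i y = cb i y" "s i y = cs i y"
    if "i < d" "y \<in> N'" for i j y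
    using g that unfolding \<F>_def a_def l_def m_def s_def by auto
  have yN: "y \<in> N" "y \<in> U" if "y \<in> N'" for y using that N'(3) by auto
  interpret monic_family "quot_alg U" U d a
    by unfold_locales (auto intro: quot_alg_const quot_alg_add quot_alg_mult d0 A)
  have sums: "(\<Sum>i<d. a i y * t (\<sigma> w y) ^ i) = t (\<sigma> w y) ^ d"
    "(\<Sum>i<d. l j i y * t (\<sigma> w y) ^ i) = \<sigma> w y $ j"
    "(\<Sum>i<d. m i y * t (\<sigma> w y) ^ i) = inverse (b (\<sigma> w y))"
    "(\<Sum>i<d. s i y * t (\<sigma> w y) ^ i) = inverse (dchar d (\<lambda>i. ca i (\<sigma> w y)) (t (\<sigma> w y)))"
    if "w \<in> ?I" "y \<in> N'" for w y j
    using ca(3) cl cb(3) cs(3) that yN[OF that(2)] eq by simp_all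
  \<comment> \<open>A relation in \<open>B\<close> only has to be checked over \<open>N'\<close> at
    the roots \<open>t (\<sigma> w y)\<close>, and there the map \<open>L\<close> defined below
    returns the translate \<open>\<sigma> w y\<close>.\<close>
  have vanish: "F x \<tau> = 0"
    if F: "F \<in> B" and z: "\<And>w y. w \<in> ?I \<Longrightarrow> y \<in> N' \<Longrightarrow> F y (t (\<sigma> w y)) = 0"
      and x: "x \<in> U" "fam_root x \<tau>" for F x \<tau>
  proof (rule B_vanish[OF F, of N' ?I "\<lambda>w y. t (\<sigma> w y)"])
    show "f x = 0" if "f \<in> quot_alg U" "\<And>y. y \<in> N' \<Longrightarrow> f y = 0" "x \<in> U" for f x
      by (rule quot_alg_vanish[OF that(1) U(2) N'(1,2) _ that(2,3)]) (use N'(3) in auto)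
    show "inj_on (\<lambda>w. t (\<sigma> w y)) ?I" if "y \<in> N'" for y using inj yN that by blast
    show "fam_root y (t (\<sigma> w y))" if "w \<in> ?I" "y \<in> N'" for w y
      using sums(1)[OF that] by (simp add: fam_root_def)
  qed (use N'(3) finiteW dI z x in auto)
  define L where "L x \<tau> = (\<chi> j. \<Sum>i<d. l j i x * \<tau> ^ i)" for x \<tau>
  have LN: "L y (t (\<sigma> w y)) = \<sigma> w y" if "w \<in> ?I" "y \<in> N'" for w y
    unfolding L_def using sums(2)[OF that] by (simp add: vec_eq_iff)
  have hL: "(\<lambda>x \<tau>. h (L x \<tau>)) \<in> B" if "h \<in> poly_funs vcoord" for h
  proof (rule B_poly_funs[OF that])
    fix f :: "complex ^ 'n \<Rightarrow> complex" assume "f \<in> vcoord"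
    then obtain j where "f = (\<lambda>v. v $ j)" by auto
    then show "(\<lambda>x \<tau>. f (L x \<tau>)) \<in> B" using B_expand[of "l j", OF A(2)] by (simp add: L_def)
  qed
  have sN: "\<sigma> w y \<in> N" if "w \<in> ?I" "y \<in> N'" for w y using st yN that by blast
  obtain H where H: "H \<subseteq> poly_funs vcoord" "Y = {x. \<forall>f\<in>H. f x = 0}"
    using closedY unfolding closedin_zariski by blast
  have YL: "L x \<tau> \<in> Y" if x: "x \<in> U" "fam_root x \<tau>" for x \<tau>
    unfolding H(2)
  proof (intro CollectI ballI)
    fix h assume h: "h \<in> H"
    show "h (L x \<tau>) = 0"
    proof (rule vanish[of "\<lambda>x \<tau>. h (L x \<tau>)", OF _ _ x])
      show "(\<lambda>x \<tau>. h (L x \<tau>)) \<in> B" using hL h H(1) by blast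
      fix w y assume wy: "w \<in> ?I" "y \<in> N'"
      have "\<sigma> w y \<in> Y" using sN[OF wy] NY0 Y0_sub by blast
      then show "h (L y (t (\<sigma> w y))) = 0" unfolding LN[OF wy] using h unfolding H(2) by blast
    qed
  qed
  have bL: "b (L x \<tau>) \<noteq> 0" if x: "x \<in> U" "fam_root x \<tau>" for x \<tau>
  proof -
    \<comment> \<open>Over \<open>N'\<close> the sum is \<open>inverse (b (\<sigma> w y))\<close>,
      so the product is 1 at the tested roots and thus at every root.\<close>
    have "b (L x \<tau>) * (\<Sum>i<d. m i x * \<tau> ^ i) - 1 = 0"
    proof (rule vanish[of "\<lambda>x \<tau>. b (L x \<tau>) * (\<Sum>i<d. m i x * \<tau> ^ i) - 1", OF _ _ x])
      show "(\<lambda>x \<tau>. b (L x \<tau>) * (\<Sum>i<d. m i x * \<tau> ^ i) - 1) \<in> B"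
        by (intro B_diff B_mult hL b(1) B_expand A(3) B_const)
      show "b (L y (t (\<sigma> w y))) * (\<Sum>i<d. m i y * t (\<sigma> w y) ^ i) - 1 = 0"
        if wy: "w \<in> ?I" "y \<in> N'" for w y
        unfolding LN[OF wy] sums(3)[OF wy] using bN[OF sN[OF wy]] by simp
    qed
    then show ?thesis by auto
  qed
  have \<theta>L: "\<theta> (L x \<tau>) = \<theta> x" if x: "x \<in> U" "fam_root x \<tau>" for x \<tau>
  proof
    fix i
    show "\<theta> (L x \<tau>) i = \<theta> x i"
    proof (cases "i < k")
      case True
      \<comment> \<open>The equation for \<theta> with its denominator cleared: polynomials are
        evaluated at \<open>L x \<tau>\<close>, while \<open>\<theta> x i\<close> is a coefficient.
        At a translate of a point of \<open>N'\<close> it holds because \<theta> is invariant under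
        \<open>W\<close>.\<close>
      have "n i (L x \<tau>) - \<theta> x i * e i (L x \<tau>) = 0"
      proof (rule vanish[of "\<lambda>x \<tau>. n i (L x \<tau>) - \<theta> x i * e i (L x \<tau>)", OF _ _ x])
        have "(\<lambda>x. \<theta> x i) \<in> quot_alg U"
          using quot_alg_poly[OF poly_funs.coord[of "\<lambda>x. x i"]] by auto
        then show "(\<lambda>x \<tau>. n i (L x \<tau>) - \<theta> x i * e i (L x \<tau>)) \<in> B"
          by (intro B_diff B_mult hL ne True B_coeff)
        fix w y assume wy: "w \<in> ?I" "y \<in> N'"
        have "\<theta> (\<sigma> w y) = \<theta> y"
          by (rule theta_sigma[OF wy(1)]) (use yN[OF wy(2)] sN[OF wy] NY0 b(3) bN in auto)
        then show "n i (L y (t (\<sigma> w y))) - \<theta> y i * e i (L y (t (\<sigma> w y))) = 0"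
          unfolding LN[OF wy] using ne(3)[OF True bN[OF sN[OF wy]]] by simp
      qed
      then show ?thesis using ne(3)[OF True bL[OF x]] by auto
    next
      \<comment> \<open>Both points lie in \<open>D1\<close>, where the coordinates from
        \<open>k\<close> on are zero.\<close>
      case False
      then show ?thesis using theta_0[of "L x \<tau>" i] theta_0[of x i] b(3)[OF bL[OF x]] x U(2) by auto
    qed
  qed
  have tL: "t (L x \<tau>) = \<tau>" if x: "x \<in> U" "fam_root x \<tau>" for x \<tau>
  proof -
    have "t (L x \<tau>) - \<tau> = 0"
      by (rule vanish[of "\<lambda>x \<tau>. t (L x \<tau>) - \<tau>", OF _ _ x])
        (simp_all add: B_diff[OF hL[OF t(1)] B_root] LN)
    then show ?thesis by simp
  qed
  have dL: "dchar d (\<lambda>i. a i x) \<tau> \<noteq> 0" if x: "x \<in> U" "fam_root x \<tau>" for x \<tau>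
  proof -
    have "dchar d (\<lambda>i. a i x) \<tau> * (\<Sum>i<d. s i x * \<tau> ^ i) - 1 = 0"
    proof (rule vanish[of "\<lambda>x \<tau>. dchar d (\<lambda>i. a i x) \<tau> * (\<Sum>i<d. s i x * \<tau> ^ i) - 1", OF _ _ x])
      show "(\<lambda>x \<tau>. dchar d (\<lambda>i. a i x) \<tau> * (\<Sum>i<d. s i x * \<tau> ^ i) - 1) \<in> B"
        by (intro B_diff B_mult B_dchar B_expand A(4) B_const)
      fix w y assume wy: "w \<in> ?I" "y \<in> N'"
      have "ca i (\<sigma> w y) = a i y" if "i < d" for i
        using ca(2) wy yN[OF wy(2)] eq(1)[OF that wy(2)] by simp
      then have "dchar d (\<lambda>i. ca i (\<sigma> w y)) (t (\<sigma> w y)) = dchar d (\<lambda>i. a i y) (t (\<sigma> w y))"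
        unfolding dchar_def by simp
      then show "dchar d (\<lambda>i. a i y) (t (\<sigma> w y)) * (\<Sum>i<d. s i y * t (\<sigma> w y) ^ i) - 1 = 0"
        unfolding sums(4)[OF wy] using dca[OF sN[OF wy]] by simp
    qed
    then show ?thesis by auto
  qed
  have oYU: "openin (subtopology (zariski vcoord) Y) (Y \<inter> U)"
    using openin_T_inter[OF U(1)] unfolding T_def .
  have lYU: "locrat vcoord (Y \<inter> U) f" if "f \<in> quot_alg U" for f
    using locrat_mono[OF quot_alg_locrat[OF that U(2)], of "Y \<inter> U"] by auto
  \<comment> \<open>The converse direction concerns points of \<open>Y\<close> themselves, with
    \<open>t y\<close> as the root. No transfer to \<open>V\<close> is needed there, and the
    identity principle on the irreducible \<open>Y\<close> replaces the reduction to
    coefficients.\<close>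
  have dense: "f y = 0" if "locrat vcoord (Y \<inter> U) f" "\<And>y. y \<in> N' \<Longrightarrow> f y = 0" "y \<in> Y" "y \<in> U" for f y
    by (rule locrat_zero_dense[OF irrT[unfolded T_def] oYU that(1) N'(1,2)[unfolded T_def]]) (use that in auto)
  have one': "\<sigma> \<one>\<^bsub>W\<^esub> y = y" if "y \<in> N'" for y
    using one yN[OF that] NY0 by blast
  have rY: "t y ^ d = (\<Sum>i<d. a i y * t y ^ i)" if y: "y \<in> Y" "y \<in> U" for y
  proof -
    have "t y ^ d - (\<Sum>i<d. a i y * t y ^ i) = 0"
    proof (rule dense[of "\<lambda>y. t y ^ d - (\<Sum>i<d. a i y * t y ^ i)", OF _ _ y])
      show "locrat vcoord (Y \<inter> U) (\<lambda>y. t y ^ d - (\<Sum>i<d. a i y * t y ^ i))"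
        by (intro locrat_diff locrat_sum locrat_mult locrat_power locrat_poly[OF t(1)] lYU A) auto
      show "t y ^ d - (\<Sum>i<d. a i y * t y ^ i) = 0" if "y \<in> N'" for y
        using sums(1)[OF one_closed that] one'[OF that] by simp
    qed
    then show ?thesis by simp
  qed
  have LY: "(\<chi> j. \<Sum>i<d. l j i y * t y ^ i) = y" if y: "y \<in> Y" "y \<in> U" for y
  proof -
    have "(\<Sum>i<d. l j i y * t y ^ i) - y $ j = 0" for j
    proof (rule dense[of "\<lambda>y. (\<Sum>i<d. l j i y * t y ^ i) - y $ j", OF _ _ y])
      show "locrat vcoord (Y \<inter> U) (\<lambda>y. (\<Sum>i<d. l j i y * t y ^ i) - y $ j)"
        by (intro locrat_diff locrat_sum locrat_mult locrat_power locrat_poly[OF t(1)] locrat_poly[OF poly_funs.coord] lYU A) auto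
      show "(\<Sum>i<d. l j i y * t y ^ i) - y $ j = 0" if "y \<in> N'" for y
        using sums(2)[OF one_closed that] one'[OF that] by simp
    qed
    then show ?thesis by (simp add: vec_eq_iff)
  qed
  show thesis
  proof (rule that[of U d t a l, OF U _ _ d0 t(1)])
    show "U \<noteq> {}" using N' by blast
    show "x' \<in> U" if "x \<in> U" "x' \<in> D1" "\<theta> x' = \<theta> x" for x x' using satU that by blast
    show "locrat vcoord U (a i)" "locrat vcoord U (l j i)" if "i < d" for i j
      using quot_alg_locrat[OF _ U(2)] A that by auto
    show "a i x = a i x'" "l j i x = l j i x'" if "i < d" "x \<in> U" "x' \<in> U" "\<theta> x = \<theta> x'" for i j x x'
      using quot_alg_eq[OF _ that(2-4)] A that(1) by auto
    show "dchar d (\<lambda>i. a i x) \<tau> \<noteq> 0" if "x \<in> U" "\<tau> ^ d = (\<Sum>i<d. a i x * \<tau> ^ i)" for x \<tau>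
      using dL that by (simp add: fam_root_def)
    show "y \<in> Y \<and> y \<in> D1 \<and> \<theta> y = \<theta> x \<and> t y = \<tau>"
      if "x \<in> U" "\<tau> ^ d = (\<Sum>i<d. a i x * \<tau> ^ i)" "y = (\<chi> j. \<Sum>i<d. l j i x * \<tau> ^ i)" for x \<tau> y
      using YL[of x \<tau>] b(3)[OF bL[of x \<tau>]] \<theta>L[of x \<tau>] tL[of x \<tau>] that
      by (simp add: fam_root_def L_def)
    show "t y ^ d = (\<Sum>i<d. a i y * t y ^ i) \<and> (\<chi> j. \<Sum>i<d. l j i y * t y ^ i) = y"
      if "y \<in> Y" "y \<in> U" for y using rY[OF that] LY[OF that] by simp
  qed
qed

end

section \<open>Simple roots depend holomorphically on the coefficients\<close>

text \<open>\<open>has_derivative\<close> provides a real-linear map; homogeneity under complex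
  scalars \<open>*s\<close> makes it complex-linear. This is the scalar form of holomorphy at a
  point.\<close>

definition cdiff :: "(complex ^ 'n::finite \<Rightarrow> complex) \<Rightarrow> complex ^ 'n \<Rightarrow> bool" where
  "cdiff f x \<longleftrightarrow> (\<exists>f'. (f has_derivative f') (at x) \<and> (\<forall>c h. f' (c *s h) = c * f' h))"

lemma cdiff_const: "cdiff (\<lambda>_. c) x"
  unfolding cdiff_def by (rule exI[of _ "\<lambda>_. 0"]) simp

lemma cdiff_coord: "cdiff (\<lambda>v. v $ j) x"
  unfolding cdiff_def
  by (rule exI[of _ "\<lambda>v. v $ j"]) (auto intro: bounded_linear_imp_has_derivative)

lemma cdiff_add:
  assumes "cdiff f x" "cdiff g x"
  shows "cdiff (\<lambda>y. f y + g y) x"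
proof -
  obtain f' g' where d: "(f has_derivative f') (at x)" "(g has_derivative g') (at x)"
    and l: "\<forall>c h. f' (c *s h) = c * f' h" "\<forall>c h. g' (c *s h) = c * g' h"
    using assms unfolding cdiff_def by blast
  show ?thesis unfolding cdiff_def
    by (intro exI conjI, rule has_derivative_add[OF d]) (simp add: l algebra_simps)
qed

lemma cdiff_mult:
  assumes "cdiff f x" "cdiff g x"
  shows "cdiff (\<lambda>y. f y * g y) x"
proof -
  obtain f' g' where d: "(f has_derivative f') (at x)" "(g has_derivative g') (at x)"
    and l: "\<forall>c h. f' (c *s h) = c * f' h" "\<forall>c h. g' (c *s h) = c * g' h"
    using assms unfolding cdiff_def by blast
  show ?thesis unfolding cdiff_def
    by (intro exI conjI, rule has_derivative_mult[OF d]) (simp add: l algebra_simps)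
qed

lemma cdiff_divide:
  assumes "cdiff f x" "cdiff g x" "g x \<noteq> 0"
  shows "cdiff (\<lambda>y. f y / g y) x"
proof -
  obtain f' g' where d: "(f has_derivative f') (at x)" "(g has_derivative g') (at x)"
    and l: "\<forall>c h. f' (c *s h) = c * f' h" "\<forall>c h. g' (c *s h) = c * g' h"
    using assms(1,2) unfolding cdiff_def by blast
  show ?thesis unfolding cdiff_def
    by (intro exI conjI, rule has_derivative_divide'[OF d assms(3)]) (simp add: l algebra_simps)
qed

lemma cdiff_sum: "(\<And>i. i \<in> I \<Longrightarrow> cdiff (f i) x) \<Longrightarrow> cdiff (\<lambda>y. \<Sum>i\<in>I. f i y) x"
  by (induction I rule: infinite_finite_induct) (auto intro: cdiff_const cdiff_add)

lemma cdiff_power: "cdiff f x \<Longrightarrow> cdiff (\<lambda>y. f y ^ k) x"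
  by (induction k) (auto intro: cdiff_const cdiff_mult)

lemma cdiff_poly_funs: "f \<in> poly_funs vcoord \<Longrightarrow> cdiff f x"
  by (induction rule: poly_funs.induct) (auto intro: cdiff_const cdiff_coord cdiff_add cdiff_mult)

lemma cdiff_cong_open:
  assumes "cdiff f x" "open S" "x \<in> S" "\<And>y. y \<in> S \<Longrightarrow> f y = g y"
  shows "cdiff g x"
  using assms has_derivative_transform_within_open[of f _ x UNIV S g]
  unfolding cdiff_def by blast

lemma cdiff_isCont: "cdiff f x \<Longrightarrow> isCont f x"
  unfolding cdiff_def using has_derivative_continuous by blast

lemma continuous_poly_funs: "f \<in> poly_funs vcoord \<Longrightarrow> continuous_on UNIV f"
  by (intro continuous_at_imp_continuous_on ballI cdiff_isCont cdiff_poly_funs)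

lemma open_nonzero_poly_funs: "f \<in> poly_funs vcoord \<Longrightarrow> open {x. f x \<noteq> 0}"
  using open_Collect_neq[OF continuous_poly_funs, of f "\<lambda>_. 0"] by simp

lemma zariski_open_imp_open:
  assumes "openin (zariski vcoord) U"
  shows "open U"
proof (subst open_subopen, intro ballI)
  fix x assume "x \<in> U"
  then obtain q where "q \<in> poly_funs vcoord" "q x \<noteq> 0" "{y. q y \<noteq> 0} \<subseteq> U"
    using assms unfolding openin_zariski_iff by blast
  then show "\<exists>T. open T \<and> x \<in> T \<and> T \<subseteq> U"
    using open_nonzero_poly_funs by (intro exI[of _ "{y. q y \<noteq> 0}"]) auto
qed

lemma locrat_cdiff:
  assumes "open U" "locrat vcoord U f" "x \<in> U"
  shows "cdiff f x"
proof -
  obtain p q where pq: "p \<in> poly_funs vcoord" "q \<in> poly_funs vcoord" "q x \<noteq> 0"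
    "\<forall>y\<in>U. q y \<noteq> 0 \<longrightarrow> f y = p y / q y" using locratE[OF assms(2,3)] .
  show ?thesis
  proof (rule cdiff_cong_open)
    show "cdiff (\<lambda>y. p y / q y) x" by (intro cdiff_divide cdiff_poly_funs pq)
    show "open (U \<inter> {y. q y \<noteq> 0})" using assms(1) open_nonzero_poly_funs[OF pq(2)] by blast
  qed (use pq assms in auto)
qed

text \<open>Here \<open>g\<close> is merely continuous: this lets the root \<open>\<tau>\<close> below occur in its own difference
  quotient before it is known to be differentiable.\<close>

lemma cdiff_mult_vanishing:
  assumes f: "cdiff f x" and f0: "f x = 0" and g: "isCont g x"
  shows "cdiff (\<lambda>y. f y * g y) x"
proof -
  obtain f' where f': "(f has_derivative f') (at x)" "\<forall>c h. f' (c *s h) = c * f' h"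
    using f unfolding cdiff_def by blast
  then obtain K where K: "0 < K" "\<And>h. norm (f' h) \<le> norm h * K"
    using bounded_linear.pos_bounded[OF has_derivative_bounded_linear] by blast
  obtain r where r: "0 < r" "\<And>y. norm (y - x) < r \<Longrightarrow> norm (f y - f x - f' (y - x)) \<le> 1 * norm (y - x)"
    using f'(1) unfolding has_derivative_at_alt by (meson zero_less_one)
  have lip: "norm (f y) \<le> (1 + K) * norm (y - x)" if "norm (y - x) < r" for y
  proof -
    have "norm (f y) \<le> norm (f y - f x - f' (y - x)) + norm (f' (y - x))"
      using norm_triangle_sub[of "f y" "f' (y - x)"] f0 by simp
    also have "\<dots> \<le> 1 * norm (y - x) + norm (y - x) * K"
      by (intro add_mono r(2) that K(2))
    finally show ?thesis by (simp add: algebra_simps)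
  qed
  \<comment> \<open>The product is split as \<open>f y * (g y - g x) + f y * g x\<close>. In the
    first summand \<open>f\<close> is bounded by a multiple of \<open>norm (y - x)\<close> and the
    other factor tends to 0, so its derivative is 0; the choice of \<open>e'\<close> cancels the
    factor \<open>1 + K\<close>.\<close>
  have "((\<lambda>y. f y * (g y - g x)) has_derivative (\<lambda>_. 0)) (at x)"
    unfolding has_derivative_at_alt
  proof (intro conjI allI impI)
    fix e :: real assume e: "0 < e"
    define e' where "e' = e / (1 + K)"
    have e': "0 < e'" using e K by (simp add: e'_def)
    obtain s where s: "0 < s" "\<And>y. dist y x < s \<Longrightarrow> dist (g y) (g x) < e'"
      using g e' unfolding continuous_at_eps_delta by blast
    show "\<exists>d>0. \<forall>y. norm (y - x) < d \<longrightarrow>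
        norm (f y * (g y - g x) - f x * (g x - g x) - 0) \<le> e * norm (y - x)"
    proof (intro exI[of _ "min r s"] conjI allI impI)
      fix y assume y: "norm (y - x) < min r s"
      have "norm (f y * (g y - g x)) \<le> ((1 + K) * norm (y - x)) * e'"
        unfolding norm_mult
        using lip[of y] s(2)[of y] y K(1) by (intro mult_mono) (auto simp: dist_norm)
      also have "\<dots> = e * norm (y - x)" using K(1) by (simp add: e'_def)
      finally show "norm (f y * (g y - g x) - f x * (g x - g x) - 0) \<le> e * norm (y - x)" by simp
    qed (use r s in simp)
  qed simp
  then have "cdiff (\<lambda>y. f y * (g y - g x)) x"
    unfolding cdiff_def by (intro exI[of _ "\<lambda>_. 0"]) simp
  from cdiff_add[OF this cdiff_mult[OF f cdiff_const[of "g x"]]]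
  show ?thesis by (simp add: algebra_simps)
qed

lemma holomorphic_map_onI:
  fixes f :: "complex ^ 'n::finite \<Rightarrow> complex ^ 'k::finite"
  assumes S: "open S" and f: "\<And>j x. x \<in> S \<Longrightarrow> cdiff (\<lambda>y. f y $ j) x"
  shows "holomorphic_map_on f S"
  unfolding holomorphic_map_on_def
proof (intro conjI ballI S)
  fix x assume x: "x \<in> S"
  have "\<forall>j. \<exists>f'. ((\<lambda>y. f y $ j) has_derivative f') (at x) \<and> (\<forall>c h. f' (c *s h) = c * f' h)"
    using f[OF x] unfolding cdiff_def by blast
  then obtain f' where f': "\<And>j. ((\<lambda>y. f y $ j) has_derivative f' j) (at x)"
    "\<And>j c h. f' j (c *s h) = c * f' j h" by metis
  \<comment> \<open>The columns are the derivatives along the coordinate axes; complex homogeneity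
    lets them determine the derivative in all directions.\<close>
  define A :: "complex ^ 'n ^ 'k" where "A = (\<chi> j i. f' j (axis i 1))"
  have lin: "linear (f' j)" for j
    using f'(1) has_derivative_bounded_linear bounded_linear.linear by blast
  have A: "(A *v h) $ j = f' j h" for h j
  proof -
    have "f' j h = f' j (\<Sum>i\<in>UNIV. (h $ i) *s axis i 1)" by (simp only: basis_expansion)
    also have "\<dots> = (\<Sum>i\<in>UNIV. h $ i * f' j (axis i 1))"
      by (simp add: linear_sum[OF lin] f'(2))
    finally show ?thesis by (simp add: A_def matrix_vector_mult_def mult.commute)
  qed
  have "linear (\<lambda>h. A *v h)"
    by (rule linearI) (simp_all add: vec_eq_iff A linear_add[OF lin] linear_cmul[OF lin])
  then have bl: "bounded_linear (\<lambda>h. A *v h)" by (simp add: linear_conv_bounded_linear)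
  have "(f has_derivative (\<lambda>h. A *v h)) (at x)"
    unfolding has_derivative_def
  proof (intro conjI bl vec_tendstoI)
    fix j
    have "((\<lambda>y. ((f y $ j - f (Lim (at x) (\<lambda>x. x)) $ j) - f' j (y - Lim (at x) (\<lambda>x. x))) /\<^sub>R
        norm (y - Lim (at x) (\<lambda>x. x))) \<longlongrightarrow> 0) (at x)"
      using f'(1)[of j] unfolding has_derivative_def by simp
    then show "((\<lambda>y. (((f y - f (Lim (at x) (\<lambda>x. x))) - A *v (y - Lim (at x) (\<lambda>x. x))) /\<^sub>R
        norm (y - Lim (at x) (\<lambda>x. x))) $ j) \<longlongrightarrow> 0 $ j) (at x)"
      by (simp add: A)
  qed
  then show "\<exists>A. (f has_derivative (\<lambda>h. A *v h)) (at x)" by blast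
qed

section \<open>Continuity and differentiability of simple roots\<close>

definition monic_val :: "nat \<Rightarrow> (nat \<Rightarrow> complex) \<Rightarrow> complex \<Rightarrow> complex" where
  "monic_val d a z = z ^ d - (\<Sum>i<d. a i * z ^ i)"

text \<open>The absolute value of a monic polynomial at \<open>z\<close> is the product of the
  distances from \<open>z\<close> to its \<open>d\<close> roots, hence at least \<open>e ^ d\<close>
  if no root is closer than \<open>e\<close>. This gives existence of nearby roots directly, without
  complex integration.\<close>

lemma monic_root_near:
  assumes d: "0 < d" and e: "0 < e" and small: "norm (monic_val d a z) < e ^ d"
  shows "\<exists>w. monic_val d a w = 0 \<and> norm (w - z) < e"
proof (rule ccontr)
  assume no: "\<not> ?thesis"
  let ?p = "monom 1 d - (\<Sum>i<d. monom (a i) i)"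
  have val: "poly ?p w = monic_val d a w" for w
    by (simp add: monic_val_def poly_sum poly_monom)
  have c: "coeff ?p d = 1" by (simp add: coeff_sum)
  have "degree ?p \<le> d" by (rule degree_le) (auto simp: coeff_sum)
  moreover have "d \<le> degree ?p" using c by (intro le_degree) simp
  ultimately have deg: "degree ?p = d" by simp
  then have "?p \<noteq> 0" using d by auto
  then obtain A where A: "size A = d" "?p = (\<Prod>x\<in>#A. [:- x, 1:])"
    using alg_closed_imp_factorization[of ?p] c deg by auto
  have far: "e \<le> norm (z - x)" if "x \<in># A" for x
  proof -
    have "poly ?p x = 0" unfolding A(2) using that by (auto simp: poly_prod_mset)
    then show ?thesis using no unfolding val by (metis norm_minus_commute not_less)
  qed
  have "e ^ size B \<le> norm (poly (\<Prod>x\<in>#B. [:- x, 1:]) z)" if "B \<subseteq># A" for B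
    using that
  proof (induction B)
    case (add x B)
    have "x \<in># A" "B \<subseteq># A"
      using mset_subset_eq_insertD[OF add.prems] by auto
    then have "e \<le> norm (z - x)" "e ^ size B \<le> norm (poly (\<Prod>x\<in>#B. [:- x, 1:]) z)"
      using far add.IH by auto
    moreover have "0 \<le> e ^ size B" using e by simp
    ultimately have "e * e ^ size B \<le> norm (z - x) * norm (poly (\<Prod>x\<in>#B. [:- x, 1:]) z)"
      by (intro mult_mono) auto
    also have "\<dots> = norm (poly (\<Prod>x\<in>#add_mset x B. [:- x, 1:]) z)"
      by (simp add: norm_mult[symmetric] algebra_simps)
    finally show ?case by simp
  qed simp
  from this[of A] show False using small A val[of z] by simp
qed

text \<open>The cofactor of \<open>u - v\<close> is a polynomial expression that becomes the
  derivative when \<open>u\<close> and \<open>v\<close> coincide. It serves as a difference quotient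
  without division.\<close>

lemma monic_val_diff:
  "monic_val d a u - monic_val d a v =
     (u - v) * ((\<Sum>m<d. v ^ (d - Suc m) * u ^ m) - (\<Sum>i<d. a i * (\<Sum>m<i. v ^ (i - Suc m) * u ^ m)))"
proof -
  have "monic_val d a u - monic_val d a v = (u ^ d - v ^ d) - (\<Sum>i<d. a i * (u ^ i - v ^ i))"
    by (simp add: monic_val_def sum_subtractf algebra_simps)
  then show ?thesis
    unfolding power_diff_sumr2 by (simp add: algebra_simps sum_distrib_left)
qed

text \<open>An implicit function theorem by hand. The cofactor \<open>Q\<close> is nonzero near the
  simple root, so two nearby roots must coincide; \<open>monic_root_near\<close> gives existence and
  continuity; dividing by \<open>Q\<close> expresses increments of the root through increments of
  the coefficients.\<close>

lemma simple_root_function: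
  fixes a :: "nat \<Rightarrow> complex ^ 'n::finite \<Rightarrow> complex"
  assumes U: "open U" "p \<in> U" and a: "\<And>i x. i < d \<Longrightarrow> x \<in> U \<Longrightarrow> cdiff (a i) x" and d: "0 < d"
    and root: "monic_val d (\<lambda>i. a i p) \<tau>0 = 0" and simple: "dchar d (\<lambda>i. a i p) \<tau>0 \<noteq> 0"
  obtains V e \<tau> where "open V" "p \<in> V" "V \<subseteq> U" "0 < e"
    "\<And>x. x \<in> V \<Longrightarrow> monic_val d (\<lambda>i. a i x) (\<tau> x) = 0"
    "\<And>x. x \<in> V \<Longrightarrow> norm (\<tau> x - \<tau>0) < e" "\<And>x. x \<in> V \<Longrightarrow> cdiff \<tau> x"
    "\<And>x z. x \<in> V \<Longrightarrow> monic_val d (\<lambda>i. a i x) z = 0 \<Longrightarrow> norm (z - \<tau>0) < e \<Longrightarrow> z = \<tau> x"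
proof -
  let ?F = "\<lambda>x. monic_val d (\<lambda>i. a i x)"
  define Q where "Q x u v = (\<Sum>m<d. v ^ (d - Suc m) * u ^ m) - (\<Sum>i<d. a i x * (\<Sum>m<i. v ^ (i - Suc m) * u ^ m))"
    for x and u v :: complex
  have FQ: "?F x u - ?F x v = (u - v) * Q x u v" for x u v
    unfolding Q_def by (rule monic_val_diff)
  have pw: "(\<Sum>m<i. z ^ (i - Suc m) * z ^ m) = of_nat i * z ^ (i - 1)" for i and z :: complex
  proof -
    have "(\<Sum>m<i. z ^ (i - Suc m) * z ^ m) = (\<Sum>m<i. z ^ (i - 1))"
      by (rule sum.cong) (auto simp flip: power_add)
    then show ?thesis by simp
  qed
  have Qp: "Q p \<tau>0 \<tau>0 \<noteq> 0"
    using simple unfolding Q_def pw dchar_def by (simp add: mult.assoc mult.left_commute)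
  have ta: "((\<lambda>x. a i x) \<longlongrightarrow> a i x0) (nhds x0)" if "i < d" "x0 \<in> U" for i x0
    using cdiff_isCont[OF a[OF that]] by (simp add: tendsto_nhds_iff isCont_def)
  have "((\<lambda>z. Q (fst z) (fst (snd z)) (snd (snd z))) \<longlongrightarrow> Q p \<tau>0 \<tau>0) (nhds p \<times>\<^sub>F (nhds \<tau>0 \<times>\<^sub>F nhds \<tau>0))"
    unfolding Q_def
    by (intro tendsto_intros filterlim_compose[OF ta filterlim_fst] U
        filterlim_compose[OF filterlim_fst filterlim_snd] filterlim_compose[OF filterlim_snd filterlim_snd]) auto
  then have "\<forall>\<^sub>F z in nhds p \<times>\<^sub>F (nhds \<tau>0 \<times>\<^sub>F nhds \<tau>0). Q (fst z) (fst (snd z)) (snd (snd z)) \<noteq> 0"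
    using Qp by (rule tendsto_imp_eventually_ne)
  then have "\<forall>\<^sub>F z in nhds (p, \<tau>0, \<tau>0). Q (fst z) (fst (snd z)) (snd (snd z)) \<noteq> 0"
    by (simp add: nhds_prod)
  then obtain r where r: "0 < r" "\<And>z. dist z (p, \<tau>0, \<tau>0) < r \<Longrightarrow> Q (fst z) (fst (snd z)) (snd (snd z)) \<noteq> 0"
    unfolding eventually_nhds_metric by blast
  \<comment> \<open>The distance in the triple product is at most the sum of three
    distances.\<close>
  define e where "e = r / 3"
  have e: "0 < e" using r by (simp add: e_def)
  have Qne: "Q x u v \<noteq> 0" if "dist x p < e" "norm (u - \<tau>0) < e" "norm (v - \<tau>0) < e" for x u v
  proof -
    have "dist (x, u, v) (p, \<tau>0, \<tau>0) \<le> dist x p + (dist u \<tau>0 + dist v \<tau>0)"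
      unfolding dist_Pair_Pair
      by (rule order_trans[OF sqrt_sum_squares_le_sum]) (auto intro: sqrt_sum_squares_le_sum)
    also have "\<dots> < r" using that by (simp add: dist_norm e_def)
    finally show ?thesis using r(2)[of "(x, u, v)"] by simp
  qed
  have tF: "((\<lambda>x. ?F x u) \<longlongrightarrow> ?F x0 u) (nhds x0)" if "x0 \<in> U" for x0 u
    unfolding monic_val_def by (intro tendsto_intros ta that) auto
  have small: "\<forall>\<^sub>F x in nhds x0. norm (?F x u) < s ^ d" if "x0 \<in> U" "?F x0 u = 0" "0 < s" for x0 u s
    using tendstoD[OF tF[OF that(1), of u], of "s ^ d"] that by (simp add: dist_norm)
  have "\<forall>\<^sub>F x in nhds p. dist x p < e"
    using e unfolding eventually_nhds_metric by blast
  with small[OF U(2) root e] eventually_nhds_in_open[OF U]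
  have "\<forall>\<^sub>F x in nhds p. norm (?F x \<tau>0) < e ^ d \<and> dist x p < e \<and> x \<in> U"
    by eventually_elim auto
  then obtain V where V: "open V" "p \<in> V" "\<And>x. x \<in> V \<Longrightarrow> norm (?F x \<tau>0) < e ^ d \<and> dist x p < e \<and> x \<in> U"
    unfolding eventually_nhds by blast
  have "\<forall>x\<in>V. \<exists>w. ?F x w = 0 \<and> norm (w - \<tau>0) < e"
    using monic_root_near[OF d e] V(3) by blast
  then obtain \<tau> where \<tau>: "\<And>x. x \<in> V \<Longrightarrow> ?F x (\<tau> x) = 0 \<and> norm (\<tau> x - \<tau>0) < e"
    by metis
  have uniq: "z = \<tau> x" if "x \<in> V" "?F x z = 0" "norm (z - \<tau>0) < e" for x z
    using FQ[of x z "\<tau> x"] Qne[of x z "\<tau> x"] V(3)[OF that(1)] \<tau>[OF that(1)] that by auto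
  have cont: "isCont \<tau> x0" if x0: "x0 \<in> V" for x0
    unfolding isCont_def tendsto_iff
  proof (intro allI impI)
    fix s :: real assume s: "0 < s"
    \<comment> \<open>The second bound keeps a root near \<open>\<tau> x0\<close> inside the ball of
      radius \<open>e\<close> around \<open>\<tau>0\<close>, where uniqueness identifies it with
      \<open>\<tau> x\<close>.\<close>
    define s' where "s' = min s (e - norm (\<tau> x0 - \<tau>0))"
    have s': "0 < s'" using s \<tau>[OF x0] by (simp add: s'_def)
    have "\<forall>\<^sub>F x in nhds x0. norm (?F x (\<tau> x0)) < s' ^ d \<and> x \<in> V"
      using small[of x0 "\<tau> x0", OF _ _ s'] V \<tau> x0
      by (intro eventually_conj) (auto intro: eventually_nhds_in_open)
    then have "\<forall>\<^sub>F x in nhds x0. dist (\<tau> x) (\<tau> x0) < s"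
    proof eventually_elim
      case (elim x)
      obtain w where w: "?F x w = 0" "norm (w - \<tau> x0) < s'"
        using monic_root_near[OF d s'] elim by blast
      have "norm (w - \<tau>0) \<le> norm (w - \<tau> x0) + norm (\<tau> x0 - \<tau>0)"
        using norm_triangle_ineq[of "w - \<tau> x0" "\<tau> x0 - \<tau>0"] by simp
      also have "\<dots> < e" using w(2) by (simp add: s'_def)
      finally have "w = \<tau> x" using uniq w elim by blast
      then show ?case using w(2) by (simp add: dist_norm s'_def)
    qed
    then show "\<forall>\<^sub>F x in at x0. dist (\<tau> x) (\<tau> x0) < s"
      by (rule filter_leD[OF at_within_le_nhds])
  qed
  have cd: "cdiff \<tau> x0" if x0: "x0 \<in> V" for x0
  proof (rule cdiff_cong_open[OF _ V(1) x0])
    let ?g = "\<lambda>i x. \<tau> x ^ i / Q x0 (\<tau> x) (\<tau> x0)"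
    have Q0: "Q x0 (\<tau> x) (\<tau> x0) \<noteq> 0" if "x \<in> V" for x
      using Qne V(3) \<tau> that x0 by blast
    have "isCont (\<lambda>x. Q x0 (\<tau> x) (\<tau> x0)) x0"
      unfolding Q_def by (intro continuous_intros cont x0)
    then have g: "isCont (?g i) x0" for i
      by (intro continuous_intros cont x0 Q0) auto
    show "cdiff (\<lambda>x. \<tau> x0 + (\<Sum>i<d. (a i x - a i x0) * ?g i x)) x0"
    proof (intro cdiff_add cdiff_sum cdiff_const cdiff_mult_vanishing g)
      fix i assume "i \<in> {..<d}"
      then have "cdiff (\<lambda>x. a i x + - a i x0) x0"
        using V(3)[OF x0] by (intro cdiff_add a cdiff_const) auto
      then show "cdiff (\<lambda>x. a i x - a i x0) x0" by simp
    qed auto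
    fix x assume x: "x \<in> V"
    \<comment> \<open>Both \<open>?F x0 (\<tau> x0)\<close> and \<open>?F x (\<tau> x)\<close> are
      zero, so one may be exchanged for the other. What remains is linear in the increments of the
      coefficients; these vanish at \<open>x0\<close>, and their cofactors \<open>?g\<close> need
      only be continuous.\<close>
    have "(\<tau> x - \<tau> x0) * Q x0 (\<tau> x) (\<tau> x0) = ?F x0 (\<tau> x) - ?F x (\<tau> x)"
      unfolding FQ[symmetric] using \<tau>[OF x] \<tau>[OF x0] by simp
    also have "\<dots> = (\<Sum>i<d. (a i x - a i x0) * \<tau> x ^ i)"
      by (simp add: monic_val_def sum_subtractf algebra_simps)
    finally have eq: "(\<Sum>i<d. (a i x - a i x0) * \<tau> x ^ i) / Q x0 (\<tau> x) (\<tau> x0) = \<tau> x - \<tau> x0"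
      using Q0[OF x] by (simp add: field_simps)
    have "(\<Sum>i<d. (a i x - a i x0) * ?g i x) = \<tau> x - \<tau> x0"
      unfolding eq[symmetric] by (simp add: sum_divide_distrib)
    then show "\<tau> x0 + (\<Sum>i<d. (a i x - a i x0) * ?g i x) = \<tau> x" by simp
  qed
  show thesis
    by (rule that[of V e \<tau>]) (use V \<tau> e uniq cd in auto)
qed

section \<open>The local sections\<close>

context quotient_chart
begin

lemma sigma_regular:
  assumes w: "w \<in> carrier W"
  shows "openin (subtopology (zariski vcoord) Y) (E w)" "E w \<subseteq> Y"
    "regular_map (induced (induced (aff_space vcoord) Y) (E w)) (induced (aff_space vcoord) Y) (\<sigma> w)"
    "\<And>x. x \<in> E w \<Longrightarrow> \<sigma> w x \<in> Y"
proof -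
  have "birational_automorphism X (E w) (\<sigma> w)"
    using action w unfolding faithful_birational_action_def birational_action_def X_def vec_space_eq by blast
  then show 1: "openin (subtopology (zariski vcoord) Y) (E w)"
    and 3: "regular_map (induced (induced (aff_space vcoord) Y) (E w)) (induced (aff_space vcoord) Y) (\<sigma> w)"
    unfolding birational_automorphism_def rational_map_def X_def by auto
  show 2: "E w \<subseteq> Y" using 1 unfolding openin_subtopology_zariski_iff by blast
  show "\<sigma> w x \<in> Y" if "x \<in> E w" for x
    using 3 2 that unfolding regular_map_def continuous_map_def by auto
qed

text \<open>Faithfulness gives a moved point somewhere in \<open>E w\<close>. Openness of the moved
  locus, checked coordinate by coordinate, is what later brings such a point into
  \<open>Y0\<close>.\<close>

lemma moved_open_nonempty:
  assumes w: "w \<in> carrier W" "w \<noteq> \<one>\<^bsub>W\<^esub>"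
  shows "openin T {x \<in> E w. \<sigma> w x \<noteq> x}" "{x \<in> E w. \<sigma> w x \<noteq> x} \<noteq> {}"
proof -
  note s = sigma_regular[OF w(1)]
  have "openin (subtopology (zariski vcoord) Y) (topspace (subtopology (zariski vcoord) Y))" by blast
  then have oY: "openin (subtopology (zariski vcoord) Y) Y" by simp
  have eq: "{x \<in> E w. \<sigma> w x \<in> Y} = E w" using s(4) by blast
  have "openin (subtopology (zariski vcoord) Y) {x \<in> E w. \<sigma> w x $ j - x $ j \<noteq> 0}" for j
  proof (rule openin_locrat_nonzero[OF s(1)])
    have j: "(\<lambda>x. x $ j) \<in> poly_funs vcoord" by (intro poly_funs.coord) auto
    have "locrat vcoord (E w) (\<lambda>x. \<sigma> w x $ j)"
      using locrat_comp_regular_map[OF s(3,2) oY locrat_poly[OF j]] unfolding eq .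
    then show "locrat vcoord (E w) (\<lambda>x. \<sigma> w x $ j - x $ j)"
      by (intro locrat_diff locrat_poly[OF j])
  qed
  moreover have "{x \<in> E w. \<sigma> w x \<noteq> x} = (\<Union>j. {x \<in> E w. \<sigma> w x $ j - x $ j \<noteq> 0})"
    by (auto simp: vec_eq_iff)
  ultimately show "openin T {x \<in> E w. \<sigma> w x \<noteq> x}" unfolding T_def by auto
  show "{x \<in> E w. \<sigma> w x \<noteq> x} \<noteq> {}"
    using action w unfolding faithful_birational_action_def by blast
qed

lemma galois_slice_exists: "\<exists>Y0. galois_slice Y W \<sigma> Y0 D1 \<theta> k"
proof -
  have act: "birational_action W (induced (aff_space vcoord) Y) E \<sigma>"
    and one: "\<forall>x\<in>E \<one>\<^bsub>W\<^esub>. \<sigma> \<one>\<^bsub>W\<^esub> x = x"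
    using action unfolding faithful_birational_action_def birational_action_def vec_space_eq by auto
  have oneW: "\<one>\<^bsub>W\<^esub> \<in> carrier W" using groupW by (simp add: group.is_monoid)
  obtain Y0 where Y0: "openin (subtopology (zariski vcoord) Y) Y0" "Y0 \<noteq> {}"
    "\<And>w. w \<in> carrier W \<Longrightarrow> Y0 \<subseteq> E w"
    "\<And>w y. w \<in> carrier W \<Longrightarrow> y \<in> Y0 \<Longrightarrow> \<sigma> w y \<in> Y0"
    "\<And>v w y. v \<in> carrier W \<Longrightarrow> w \<in> carrier W \<Longrightarrow> y \<in> Y0 \<Longrightarrow> \<sigma> v (\<sigma> w y) = \<sigma> (v \<otimes>\<^bsub>W\<^esub> w) y"
    by (rule birational_action_stable_open[OF irrY groupW finiteW act]) (rule that)
  have Y0Y: "Y0 \<subseteq> Y" using Y0(1) unfolding openin_subtopology_zariski_iff by blast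
  have "galois_slice Y W \<sigma> Y0 D1 \<theta> k"
  proof (rule galois_slice.intro)
    show "closedin (zariski vcoord) Y"
      using Y unfolding closed_subvariety_def vec_space_eq by simp
    show "irreducible_top (subtopology (zariski vcoord) Y)" by (rule irrY)
    show "group W" "finite (carrier W)" by (fact groupW finiteW)+
    show "openin (subtopology (zariski vcoord) Y) Y0" "Y0 \<noteq> {}" by (fact Y0)+
    show "\<sigma> w y \<in> Y0" if "w \<in> carrier W" "y \<in> Y0" for w y using Y0(4) that .
    show "\<sigma> v (\<sigma> w y) = \<sigma> (v \<otimes>\<^bsub>W\<^esub> w) y" if "v \<in> carrier W" "w \<in> carrier W" "y \<in> Y0" for v w y
      using Y0(5) that .
    show "\<sigma> \<one>\<^bsub>W\<^esub> y = y" if "y \<in> Y0" for y using one Y0(3)[OF oneW] that by blast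
    show "\<exists>y\<in>Y0. \<sigma> w y \<noteq> y" if "w \<in> carrier W" "w \<noteq> \<one>\<^bsub>W\<^esub>" for w
      using irreducible_top_inter[OF irrT moved_open_nonempty[OF that] Y0(1)[folded T_def] Y0(2)] by blast
    show "locrat vcoord {y \<in> Y0. \<sigma> w y \<in> U} (\<lambda>y. f (\<sigma> w y))"
      if "w \<in> carrier W" "openin (subtopology (zariski vcoord) Y) U" "locrat vcoord U f" for w U f
      by (rule locrat_mono[OF locrat_comp_regular_map[OF sigma_regular(3,2)[OF that(1)] that(2,3)]])
        (use Y0(3)[OF that(1)] in auto)
    show "openin (subtopology (zariski vcoord) Y) {y \<in> Y0. \<sigma> w y \<in> U}"
      if "w \<in> carrier W" "openin (subtopology (zariski vcoord) Y) U" for w U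
    proof -
      have "{y \<in> Y0. \<sigma> w y \<in> U} = Y0 \<inter> {y \<in> E w. \<sigma> w y \<in> U}" using Y0(3)[OF that(1)] by blast
      then show ?thesis
        using openin_regular_map_preimage[OF sigma_regular(3,1)[OF that(1)] that(2)] Y0(1) by auto
    qed
    show "openin (zariski vcoord) D1" by (rule openin_D1)
    show "Y \<inter> D1 \<noteq> {}" using meets unfolding D1_def by blast
    show "locrat vcoord D1 (\<lambda>x. p (\<theta> x))" if "p \<in> poly_funs scoord" for p
      using locrat_theta_poly that .
    show "\<theta> x i = 0" if "x \<in> D1" "k \<le> i" for x i
      using S0 c_in that unfolding D1_def \<theta>_def by blast
    show "p (\<theta> x) = 0" if "p \<in> poly_funs scoord" "openin (subtopology (zariski vcoord) Y) N" "N \<noteq> {}"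
      "\<And>y. y \<in> N \<Longrightarrow> y \<in> D1 \<Longrightarrow> p (\<theta> y) = 0" "x \<in> D1" for p N x
      unfolding \<theta>_def
      by (rule theta_vanish[OF that(1) that(2)[folded T_def] that(3,4)]) (use that(5) in \<open>auto simp: D1_def\<close>)
    show "\<theta> (\<sigma> w y) = \<theta> y" if "w \<in> carrier W" "y \<in> Y0" "y \<in> D1" "\<sigma> w y \<in> D1" for w y
      using theta_invariant[OF that(1), of y] that Y0(3)[OF that(1)] Y0(4)[OF that(1,2)] Y0Y by blast
    show "\<exists>p\<in>poly_funs scoord. \<exists>q\<in>poly_funs scoord. \<exists>N'. openin (subtopology (zariski vcoord) Y) N' \<and>
        N' \<noteq> {} \<and> N' \<subseteq> N \<and> N' \<subseteq> D1 \<and> (\<forall>y\<in>N'. q (\<theta> y) \<noteq> 0 \<and> u y * q (\<theta> y) = p (\<theta> y))"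
      if N: "openin (subtopology (zariski vcoord) Y) N" "N \<noteq> {}" "N \<subseteq> Y0" "locrat vcoord N u"
        and st: "\<And>w y. w \<in> carrier W \<Longrightarrow> y \<in> N \<Longrightarrow> \<sigma> w y \<in> N"
        and inv: "\<And>w y. w \<in> carrier W \<Longrightarrow> y \<in> N \<Longrightarrow> u (\<sigma> w y) = u y" for N u
    proof -
      have NE: "N \<subseteq> E w" if "w \<in> carrier W" for w using Y0(3)[OF that] N(3) by blast
      obtain p q N' where "p \<in> poly_funs scoord" "q \<in> poly_funs scoord" "openin T N'" "N' \<noteq> {}"
        "N' \<subseteq> N" "N' \<subseteq> D1" "\<And>y. y \<in> N' \<Longrightarrow> q (\<theta> y) \<noteq> 0 \<and> u y * q (\<theta> y) = p (\<theta> y)"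
        by (rule theta_surj[OF N(1)[folded T_def] N(2,4) NE st inv]) (assumption | rule that)+
      then show ?thesis unfolding T_def by (intro bexI[of _ p] bexI[of _ q] exI[of _ N']) auto
    qed
  qed
  then show ?thesis by blast
qed

lemma theta_eq_iff:
  "x \<in> D1 \<Longrightarrow> x' \<in> D1 \<Longrightarrow> \<theta> x = \<theta> x' \<longleftrightarrow> \<pi> x = \<pi> x'"
  unfolding D1_def \<theta>_def using gc by (metis (no_types, lifting) mem_Collect_eq)

text \<open>The chart \<open>c\<close> is injective, so \<theta> has the same fibres on
  \<open>D1\<close> as \<pi>, and \<open>D1\<close> contains with a point its entire orbit.\<close>

lemma theta_orbit:
  assumes "x \<in> D1"
  shows "x' \<in> orbit G R x \<longleftrightarrow> x' \<in> D1 \<and> \<theta> x' = \<theta> x"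
proof -
  have "orbit G R x = {x' \<in> D. \<pi> x' = \<pi> x}"
    using quotient assms unfolding rational_quotient_def D1_def by blast
  then show ?thesis using assms theta_eq_iff[of x' x] unfolding D1_def by auto
qed

text \<open>The neighbourhood in \<open>Y\<close> is taken to be the image of \<rho>. Then every
  fibre is nonempty and is the orbit of any of its points cut with the domain; what has to be earned
  is that the image is open in \<open>Y\<close>.\<close>

theorem local_sections:
  assumes G: "linear_algebraic_group G" and R: "representation G R"
  shows "\<exists>U. openin (ztop vec_space) U \<and> U \<noteq> {} \<and>
    (\<forall>p\<in>U. orbit G R p \<inter> Y \<noteq> {}) \<and>
    (\<forall>p\<in>U. \<forall>y\<in>orbit G R p \<inter> Y. \<exists>U\<^sub>p U\<^sub>y \<rho>.
       open U\<^sub>p \<and> p \<in> U\<^sub>p \<and>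
       openin (top_of_set Y) U\<^sub>y \<and> y \<in> U\<^sub>y \<and>
       holomorphic_map_on \<rho> U\<^sub>p \<and> \<rho> ` U\<^sub>p \<subseteq> U\<^sub>y \<and> \<rho> p = y \<and>
       (\<forall>x\<in>U\<^sub>p. x \<in> D \<and> \<rho> x \<in> D \<and> \<pi> (\<rho> x) = \<pi> x) \<and>
       (\<forall>y'\<in>U\<^sub>y. \<exists>q. {x \<in> U\<^sub>p. \<rho> x = y'} = orbit G R q \<inter> U\<^sub>p))"
proof -
  obtain Y0 where slice: "galois_slice Y W \<sigma> Y0 D1 \<theta> k" using galois_slice_exists by blast
  obtain U d t and a :: "nat \<Rightarrow> complex ^ 'n \<Rightarrow> complex" and l :: "'n \<Rightarrow> nat \<Rightarrow> complex ^ 'n \<Rightarrow> complex"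
  where U: "openin (zariski vcoord) U" "U \<subseteq> D1" "U \<noteq> {}"
    and sat: "\<And>x x'. x \<in> U \<Longrightarrow> x' \<in> D1 \<Longrightarrow> \<theta> x' = \<theta> x \<Longrightarrow> x' \<in> U"
    and d: "0 < d" and t: "t \<in> poly_funs vcoord"
    and la: "\<And>i. i < d \<Longrightarrow> locrat vcoord U (a i)" and ll: "\<And>j i. i < d \<Longrightarrow> locrat vcoord U (l j i)"
    and ea: "\<And>i x x'. i < d \<Longrightarrow> x \<in> U \<Longrightarrow> x' \<in> U \<Longrightarrow> \<theta> x = \<theta> x' \<Longrightarrow> a i x = a i x'"
    and el: "\<And>j i x x'. i < d \<Longrightarrow> x \<in> U \<Longrightarrow> x' \<in> U \<Longrightarrow> \<theta> x = \<theta> x' \<Longrightarrow> l j i x = l j i x'"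
    and simple: "\<And>x \<tau>. x \<in> U \<Longrightarrow> \<tau> ^ d = (\<Sum>i<d. a i x * \<tau> ^ i) \<Longrightarrow> dchar d (\<lambda>i. a i x) \<tau> \<noteq> 0"
    and pt: "\<And>x \<tau> y. x \<in> U \<Longrightarrow> \<tau> ^ d = (\<Sum>i<d. a i x * \<tau> ^ i) \<Longrightarrow> y = (\<chi> j. \<Sum>i<d. l j i x * \<tau> ^ i) \<Longrightarrow>
       y \<in> Y \<and> y \<in> D1 \<and> \<theta> y = \<theta> x \<and> t y = \<tau>"
    and onY: "\<And>y. y \<in> Y \<Longrightarrow> y \<in> U \<Longrightarrow> t y ^ d = (\<Sum>i<d. a i y * t y ^ i) \<and> (\<chi> j. \<Sum>i<d. l j i y * t y ^ i) = y"
    by (rule galois_slice.root_cover[OF slice]) (rule that)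
  have oU: "open U" using zariski_open_imp_open[OF U(1)] .
  have UD: "x \<in> D1" if "x \<in> U" for x using that U(2) by blast
  have root_iff: "monic_val d (\<lambda>i. a i x) z = 0 \<longleftrightarrow> z ^ d = (\<Sum>i<d. a i x * z ^ i)" for x z
    by (simp add: monic_val_def)
  have mcong: "monic_val d (\<lambda>i. a i x) z = monic_val d (\<lambda>i. a i x') z"
    if "x \<in> U" "x' \<in> U" "\<theta> x = \<theta> x'" for x x' z
    using ea[OF _ that] by (simp add: monic_val_def)
  \<comment> \<open>Saturation of \<open>U\<close> puts \<open>y\<close> into \<open>U\<close>, and
    the coefficients depend on \<theta> only, so the facts known over the base point
    \<open>y\<close> hold over \<open>x\<close> as well.\<close>
  have onY': "monic_val d (\<lambda>i. a i x) (t y) = 0" "(\<chi> j. \<Sum>i<d. l j i x * t y ^ i) = y" "y \<in> U"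
    if "x \<in> U" "y \<in> Y" "y \<in> D1" "\<theta> y = \<theta> x" for x y
  proof -
    show yU: "y \<in> U" using sat that by blast
    have y: "monic_val d (\<lambda>i. a i y) (t y) = 0" "(\<chi> j. \<Sum>i<d. l j i y * t y ^ i) = y"
      using onY[OF that(2) yU] unfolding root_iff by auto
    show "monic_val d (\<lambda>i. a i x) (t y) = 0" using y(1) mcong[OF yU that(1,4)] by simp
    have "(\<chi> j. \<Sum>i<d. l j i x * t y ^ i) = (\<chi> j. \<Sum>i<d. l j i y * t y ^ i)"
      using el[OF _ yU that(1,4)] by (simp add: vec_eq_iff)
    then show "(\<chi> j. \<Sum>i<d. l j i x * t y ^ i) = y" using y(2) by simp
  qed
  have "orbit G R p \<inter> Y \<noteq> {}" if p: "p \<in> U" for p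
  proof -
    obtain \<tau> where "\<tau> ^ d = (\<Sum>i<d. a i p * \<tau> ^ i)" using monic_root_exists[OF d, of "\<lambda>i. a i p"] by blast
    from pt[OF p this refl] show ?thesis using theta_orbit[OF UD[OF p]] by blast
  qed
  moreover have "\<exists>U\<^sub>p U\<^sub>y \<rho>.
       open U\<^sub>p \<and> p \<in> U\<^sub>p \<and>
       openin (top_of_set Y) U\<^sub>y \<and> y \<in> U\<^sub>y \<and>
       holomorphic_map_on \<rho> U\<^sub>p \<and> \<rho> ` U\<^sub>p \<subseteq> U\<^sub>y \<and> \<rho> p = y \<and>
       (\<forall>x\<in>U\<^sub>p. x \<in> D \<and> \<rho> x \<in> D \<and> \<pi> (\<rho> x) = \<pi> x) \<and>
       (\<forall>y'\<in>U\<^sub>y. \<exists>q. {x \<in> U\<^sub>p. \<rho> x = y'} = orbit G R q \<inter> U\<^sub>p)"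
    if p: "p \<in> U" and y: "y \<in> orbit G R p \<inter> Y" for p y
  proof -
    have y': "y \<in> Y" "y \<in> D1" "\<theta> y = \<theta> p" using y theta_orbit[OF UD[OF p]] by auto
    note yp = onY'[OF p y']
    have simple_p: "dchar d (\<lambda>i. a i p) (t y) \<noteq> 0"
      using simple[OF p] yp(1) unfolding root_iff by blast
    obtain V e \<tau> where V: "open V" "p \<in> V" "V \<subseteq> U" and e: "0 < e"
      and \<tau>: "\<And>x. x \<in> V \<Longrightarrow> monic_val d (\<lambda>i. a i x) (\<tau> x) = 0"
        "\<And>x. x \<in> V \<Longrightarrow> norm (\<tau> x - t y) < e" "\<And>x. x \<in> V \<Longrightarrow> cdiff \<tau> x"
      and uniq: "\<And>x z. x \<in> V \<Longrightarrow> monic_val d (\<lambda>i. a i x) z = 0 \<Longrightarrow> norm (z - t y) < e \<Longrightarrow> z = \<tau> x"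
      by (rule simple_root_function[OF oU p locrat_cdiff[OF oU la] d yp(1) simple_p]) (assumption | rule that)+
    define \<rho> where "\<rho> x = (\<chi> j. \<Sum>i<d. l j i x * \<tau> x ^ i)" for x
    have VU: "x \<in> U" if "x \<in> V" for x using that V(3) by blast
    have \<rho>: "\<rho> x \<in> Y" "\<rho> x \<in> D1" "\<theta> (\<rho> x) = \<theta> x" "t (\<rho> x) = \<tau> x" if "x \<in> V" for x
      using pt[OF VU[OF that] _ \<rho>_def] \<tau>(1)[OF that] unfolding root_iff by auto
    \<comment> \<open>Closeness of \<open>t z\<close> to \<open>t y\<close> singles out the followed
      root, and a root determines the point of \<open>Y\<close> through L. This uniqueness is used
      for the base point, for openness of the image and for the fibres.\<close>
    have sect: "z = \<rho> x" if "x \<in> V" "z \<in> Y" "z \<in> D1" "\<theta> z = \<theta> x" "norm (t z - t y) < e" for x z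
    proof -
      note zx = onY'[OF VU[OF that(1)] that(2-4)]
      have "t z = \<tau> x" using uniq[OF that(1) zx(1) that(5)] .
      then show ?thesis using zx(2) unfolding \<rho>_def by simp
    qed
    have \<rho>p: "\<rho> p = y" using sect[OF V(2) y'] e by simp
    have hol: "holomorphic_map_on \<rho> V"
    proof (rule holomorphic_map_onI[OF V(1)])
      fix j x assume x: "x \<in> V"
      show "cdiff (\<lambda>x. \<rho> x $ j) x"
        unfolding \<rho>_def vec_lambda_beta
        by (intro cdiff_sum cdiff_mult cdiff_power \<tau>(3)[OF x] locrat_cdiff[OF oU ll VU[OF x]]) auto
    qed
    \<comment> \<open>A point z of the image lies on the orbit of some \<open>x1\<close> in
      \<open>V\<close>, say as the translate by \<open>h\<close>. The inverse of \<open>h\<close>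
      carries points v of \<open>Y\<close> near z into \<open>V\<close> along their orbits, and by
      \<open>sect\<close> each such v is the value of \<rho> at the point it is carried to.\<close>
    have "openin (top_of_set Y) (\<rho> ` V)"
    proof (subst openin_subopen, intro ballI)
      fix z assume "z \<in> \<rho> ` V"
      then obtain x1 where x1: "x1 \<in> V" "z = \<rho> x1" by blast
      have "z \<in> orbit G R x1" using \<rho>[OF x1(1)] x1 theta_orbit UD VU by blast
      then obtain h where h: "h \<in> G" "z = R h *v x1" unfolding orbit_def by blast
      have hi: "matrix_inv h \<in> G" using G h(1) unfolding linear_algebraic_group_def by blast
      have "G \<subseteq> GL"
        using G closedin_subset unfolding linear_algebraic_group_def by fastforce
      then have "invertible h" using h(1) unfolding GL_def by blast
      then have inv: "h ** matrix_inv h = mat 1 \<and> matrix_inv h ** h = mat 1"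
        unfolding invertible_def matrix_inv_def by (rule someI_ex)
      have Rinv: "R (matrix_inv h) ** R h = mat 1" "R h ** R (matrix_inv h) = mat 1"
        using R h(1) hi inv unfolding representation_def by metis+
      let ?k = "\<lambda>v. R (matrix_inv h) *v v"
      have kz: "?k z = x1" using h(2) Rinv by (simp add: matrix_vector_mul_assoc)
      \<comment> \<open>The first condition lands in the domain of \<rho>; the second keeps
        \<open>t v\<close> in the range where \<open>sect\<close> applies.\<close>
      let ?O = "{v. ?k v \<in> V} \<inter> {v. norm (t v - t y) < e}"
      have "continuous_on UNIV ?k"
        unfolding matrix_vector_mult_def by (intro continuous_intros)
      then have "open {v. ?k v \<in> V}"
        using open_vimage[OF V(1)] by (simp add: vimage_def)
      moreover have "open {v. norm (t v - t y) < e}"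
        by (intro open_Collect_less continuous_intros continuous_poly_funs t)
      ultimately have "openin (top_of_set Y) (Y \<inter> ?O)" by (intro openin_open_Int) auto
      moreover have "z \<in> Y \<inter> ?O"
        using kz x1 \<rho>[OF x1(1)] \<tau>(2)[OF x1(1)] by simp
      moreover have "Y \<inter> ?O \<subseteq> \<rho> ` V"
      proof
        fix v assume v: "v \<in> Y \<inter> ?O"
        have "R h *v ?k v = v" using Rinv by (simp add: matrix_vector_mul_assoc)
        then have "v \<in> orbit G R (?k v)" unfolding orbit_def using h(1) by force
        then have "v \<in> D1" "\<theta> v = \<theta> (?k v)" using v theta_orbit[of "?k v" v] UD VU by auto
        then show "v \<in> \<rho> ` V" using sect[of "?k v" v] v by blast
      qed
      ultimately show "\<exists>T. openin (top_of_set Y) T \<and> z \<in> T \<and> T \<subseteq> \<rho> ` V" by blast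
    qed
    moreover have "{x \<in> V. \<rho> x = \<rho> x1} = orbit G R x1 \<inter> V" if x1: "x1 \<in> V" for x1
    proof (intro equalityI subsetI)
      fix x assume "x \<in> {x \<in> V. \<rho> x = \<rho> x1}"
      then show "x \<in> orbit G R x1 \<inter> V"
        using \<rho>(3)[of x] \<rho>(3)[OF x1] UD VU theta_orbit[of x1 x] x1 by auto
    next
      fix x assume x: "x \<in> orbit G R x1 \<inter> V"
      then have "\<theta> x = \<theta> x1" using theta_orbit UD VU x1 by blast
      then have "\<rho> x1 = \<rho> x"
        using sect[of x "\<rho> x1"] x \<rho>[OF x1] \<tau>(2)[OF x1] by simp
      then show "x \<in> {x \<in> V. \<rho> x = \<rho> x1}" using x by simp
    qed
    then have "\<forall>y'\<in>\<rho> ` V. \<exists>q. {x \<in> V. \<rho> x = y'} = orbit G R q \<inter> V" by blast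
    moreover have "x \<in> D \<and> \<rho> x \<in> D \<and> \<pi> (\<rho> x) = \<pi> x" if "x \<in> V" for x
      using \<rho>(2,3)[OF that] UD[OF VU[OF that]] theta_eq_iff[of "\<rho> x" x] unfolding D1_def by simp
    ultimately show ?thesis
      using V \<rho>p hol by (intro exI[of _ V] exI[of _ "\<rho> ` V"] exI[of _ \<rho>]) auto
  qed
  ultimately show ?thesis
    using U(1,3) unfolding vec_space_eq by (intro exI[of _ U]) auto
qed

end

text \<open>The hypothesis \<open>Y \<inter> D \<noteq> {}\<close> says that \<pi> can be restricted
  to \<open>Y\<close>. Let the nonzero scalars act on the line, with \<open>Y\<close> the origin and
  \<open>W\<close> trivial: restriction is an isomorphism between the constants, but
  \<open>D\<close> omits the origin and no orbit of a nonzero point meets \<open>Y\<close>. A point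
  of \<open>Y \<inter> D\<close> also selects the affine chart of \<open>Z\<close> used
  throughout.\<close>

theorem lemma4:
  fixes G :: "(complex ^ 'm::finite ^ 'm) set"
    and R :: "complex ^ 'm ^ 'm \<Rightarrow> complex ^ 'n::finite ^ 'n"
    and Y :: "(complex ^ 'n) set"
    and W :: "'w monoid"
    and E :: "'w \<Rightarrow> (complex ^ 'n) set"
    and \<sigma> :: "'w \<Rightarrow> complex ^ 'n \<Rightarrow> complex ^ 'n"
    and Z :: "'z fspace"
    and D :: "(complex ^ 'n) set"
    and \<pi> :: "complex ^ 'n \<Rightarrow> 'z"
  assumes "reductive_group G"
    and "representation G R"
    and "closed_subvariety Y"
    and "group W" and "finite (carrier W)"
    and "faithful_birational_action W (induced vec_space Y) E \<sigma>"
    and "galois_restriction_property G R Y W E \<sigma>"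
    and "rational_quotient G R Z D \<pi>"
    and "Y \<inter> D \<noteq> {}"
  shows "\<exists>U. openin (ztop vec_space) U \<and> U \<noteq> {} \<and>
    (\<forall>p\<in>U. orbit G R p \<inter> Y \<noteq> {}) \<and>
    (\<forall>p\<in>U. \<forall>y\<in>orbit G R p \<inter> Y. \<exists>U\<^sub>p U\<^sub>y \<rho>.
       open U\<^sub>p \<and> p \<in> U\<^sub>p \<and>
       openin (top_of_set Y) U\<^sub>y \<and> y \<in> U\<^sub>y \<and>
       holomorphic_map_on \<rho> U\<^sub>p \<and> \<rho> ` U\<^sub>p \<subseteq> U\<^sub>y \<and> \<rho> p = y \<and>
       (\<forall>x\<in>U\<^sub>p. x \<in> D \<and> \<rho> x \<in> D \<and> \<pi> (\<rho> x) = \<pi> x) \<and>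
       (\<forall>y'\<in>U\<^sub>y. \<exists>q. {x \<in> U\<^sub>p. \<rho> x = y'} = orbit G R q \<inter> U\<^sub>p))"
proof -
  obtain y0 where y0: "y0 \<in> Y" "y0 \<in> D" using assms(9) by blast
  have rq: "variety Z" "regular_map (induced vec_space D) Z \<pi>"
    using assms(8) unfolding rational_quotient_def rational_map_def by auto
  have "\<pi> y0 \<in> topspace (ztop Z)"
    using rq(2) y0(2) unfolding regular_map_def continuous_map_def by (auto simp: vec_space_def)
  moreover obtain \<U> where \<U>: "\<Union>\<U> = topspace (ztop Z)"
    "\<forall>U\<in>\<U>. openin (ztop Z) U \<and> affine_fspace (induced Z U)"
    using rq(1) unfolding variety_def by blast
  ultimately obtain Z1 where Z1: "\<pi> y0 \<in> Z1" "openin (ztop Z) Z1" "affine_fspace (induced Z Z1)"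
    by blast
  obtain S where S: "algebraic_set S" "isomorphic_fspace (induced Z Z1) (induced seq_space S)"
    using Z1(3) unfolding affine_fspace_def by blast
  obtain k where k: "\<forall>x\<in>S. \<forall>i\<ge>k. x i = 0" using S(1) unfolding algebraic_set_def by blast
  obtain c g where cg: "regular_map (induced Z Z1) (induced seq_space S) c"
    "regular_map (induced seq_space S) (induced Z Z1) g"
    "\<forall>x\<in>topspace (ztop (induced Z Z1)). g (c x) = x"
    "\<forall>y\<in>topspace (ztop (induced seq_space S)). c (g y) = y"
    using S(2) unfolding isomorphic_fspace_def by blast
  have Z1top: "topspace (ztop (induced Z Z1)) = Z1" using openin_subset[OF Z1(2)] by auto
  interpret quotient_chart G R Y W E \<sigma> Z D \<pi> Z1 S k c g
  proof (rule quotient_chart.intro)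
    show "\<exists>y\<in>Y \<inter> D. \<pi> y \<in> Z1" using y0 Z1 by blast
  qed (use assms Z1 k cg Z1top in \<open>auto simp: seq_space_def\<close>)
  have "linear_algebraic_group G" using assms(1) unfolding reductive_group_def by blast
  from local_sections[OF this assms(2)] show ?thesis .
qed

end
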